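(* There exists an infinite, residually finite, locally finite group $G$ such that $C^*(G)$ is just-infinite.
   Context: Groups are discrete. A group is locally finite if each of its finitely generated subgroups is finite. $C^*(G)$ denotes the full (universal) group $C^*$-algebra of $G$ over $\mathbb{C}$ (for locally finite $G$ it coincides with the reduced group $C^*$-algebra $C^*_r(G)$, because $G$ is amenable). A $C^*$-algebra $A$ is called just-infinite if it is infinite-dimensional and for every nonzero closed two-sided ideal $I$ of $A$ the quotient $A/I$ is finite-dimensional. *)

theory Defs
  imports
    "HOL-Analysis.Infinite_Sum"
    "HOL-Algebra.QuotRing"
    "HOL-Algebra.Generated_Groups"
    "HOL-Algebra.Module"
begin

section \<open>Groups\<close>

definition residually_finite :: "('g, 'm) monoid_scheme \<Rightarrow> bool" where
  "residually_finite G \<longleftrightarrow>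
     (\<forall>g\<in>carrier G. g \<noteq> \<one>\<^bsub>G\<^esub> \<longrightarrow> (\<exists>N. N \<lhd> G \<and> finite (carrier (G Mod N)) \<and> g \<notin> N))"

definition locally_finite :: "('g, 'm) monoid_scheme \<Rightarrow> bool" where
  "locally_finite G \<longleftrightarrow> (\<forall>S\<subseteq>carrier G. finite S \<longrightarrow> finite (generate G S))"


section \<open>\<open>C\<close>*-algebras\<close>

definition complex_ring :: "complex ring" where
  "complex_ring = \<lparr>carrier = UNIV, mult = (*), one = 1, zero = 0, add = (+)\<rparr>"

record 'a normed_star_algebra = "(complex, 'a) module" +
  star :: "'a \<Rightarrow> 'a"
  nrm :: "'a \<Rightarrow> real"

definition cauchy_in :: "('a, 'm) normed_star_algebra_scheme \<Rightarrow> (nat \<Rightarrow> 'a) \<Rightarrow> bool" where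
  "cauchy_in A s \<longleftrightarrow> (\<forall>n. s n \<in> carrier A) \<and>
     (\<forall>e>0. \<exists>N. \<forall>m\<ge>N. \<forall>n\<ge>N. nrm A (s m \<ominus>\<^bsub>A\<^esub> s n) < e)"

definition tends_to_in :: "('a, 'm) normed_star_algebra_scheme \<Rightarrow> (nat \<Rightarrow> 'a) \<Rightarrow> 'a \<Rightarrow> bool" where
  "tends_to_in A s a \<longleftrightarrow> (\<lambda>n. nrm A (s n \<ominus>\<^bsub>A\<^esub> a)) \<longlonglongrightarrow> 0"

text \<open>The zero algebra is not excluded.\<close>

locale unital_cstar_algebra = ring A + Module.module complex_ring A
  for A :: "('a, 'm) normed_star_algebra_scheme" (structure) +
  assumes smult_mult_left:
      "\<lbrakk>x \<in> carrier A; y \<in> carrier A\<rbrakk> \<Longrightarrow> (c \<odot> x) \<otimes> y = c \<odot> (x \<otimes> y)"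
    and smult_mult_right:
      "\<lbrakk>x \<in> carrier A; y \<in> carrier A\<rbrakk> \<Longrightarrow> x \<otimes> (c \<odot> y) = c \<odot> (x \<otimes> y)"
    and star_closed: "x \<in> carrier A \<Longrightarrow> star A x \<in> carrier A"
    and star_star: "x \<in> carrier A \<Longrightarrow> star A (star A x) = x"
    and star_add:
      "\<lbrakk>x \<in> carrier A; y \<in> carrier A\<rbrakk> \<Longrightarrow> star A (x \<oplus> y) = star A x \<oplus> star A y"
    and star_smult: "x \<in> carrier A \<Longrightarrow> star A (c \<odot> x) = cnj c \<odot> star A x"
    and star_mult:
      "\<lbrakk>x \<in> carrier A; y \<in> carrier A\<rbrakk> \<Longrightarrow> star A (x \<otimes> y) = star A y \<otimes> star A x"
    and nrm_nonneg: "x \<in> carrier A \<Longrightarrow> 0 \<le> nrm A x"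
    and nrm_eq_zero_iff: "x \<in> carrier A \<Longrightarrow> nrm A x = 0 \<longleftrightarrow> x = \<zero>"
    and nrm_triangle:
      "\<lbrakk>x \<in> carrier A; y \<in> carrier A\<rbrakk> \<Longrightarrow> nrm A (x \<oplus> y) \<le> nrm A x + nrm A y"
    and nrm_smult: "x \<in> carrier A \<Longrightarrow> nrm A (c \<odot> x) = cmod c * nrm A x"
    and nrm_mult:
      "\<lbrakk>x \<in> carrier A; y \<in> carrier A\<rbrakk> \<Longrightarrow> nrm A (x \<otimes> y) \<le> nrm A x * nrm A y"
    and cstar_identity: "x \<in> carrier A \<Longrightarrow> nrm A (star A x \<otimes> x) = (nrm A x)\<^sup>2"
    and complete: "cauchy_in A s \<Longrightarrow> \<exists>a\<in>carrier A. tends_to_in A s a"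

definition finite_dimensional :: "('a, 'm) normed_star_algebra_scheme \<Rightarrow> bool" where
  "finite_dimensional A \<longleftrightarrow>
     (\<exists>B. finite B \<and> B \<subseteq> carrier A \<and>
          (\<forall>a\<in>carrier A. \<exists>c. a = (\<Oplus>\<^bsub>A\<^esub>b\<in>B. c b \<odot>\<^bsub>A\<^esub> b)))"

definition closed_ideal :: "'a set \<Rightarrow> ('a, 'm) normed_star_algebra_scheme \<Rightarrow> bool" where
  "closed_ideal I A \<longleftrightarrow> ideal I A \<and>
     (\<forall>c. \<forall>x\<in>I. c \<odot>\<^bsub>A\<^esub> x \<in> I) \<and>
     (\<forall>s a. (\<forall>n. s n \<in> I) \<and> a \<in> carrier A \<and> tends_to_in A s a \<longrightarrow> a \<in> I)"

text \<open>The ring structure is that of \<^const>\<open>FactRing\<close>; the norm is the quotient norm.\<close>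

definition quotient_algebra ::
    "('a, 'm) normed_star_algebra_scheme \<Rightarrow> 'a set \<Rightarrow> 'a set normed_star_algebra" where
  "quotient_algebra A I =
     \<lparr>carrier = carrier (A Quot I), mult = mult (A Quot I), one = one (A Quot I),
      zero = zero (A Quot I), add = add (A Quot I),
      smult = (\<lambda>c P. \<Union>a\<in>P. I +>\<^bsub>A\<^esub> (c \<odot>\<^bsub>A\<^esub> a)),
      star = (\<lambda>P. \<Union>a\<in>P. I +>\<^bsub>A\<^esub> star A a),
      nrm = (\<lambda>P. Inf (nrm A ` P))\<rparr>"

definition just_infinite :: "('a, 'm) normed_star_algebra_scheme \<Rightarrow> bool" where
  "just_infinite A \<longleftrightarrow> unital_cstar_algebra A \<and> \<not> finite_dimensional A \<and>
     (\<forall>I. closed_ideal I A \<and> I \<noteq> {\<zero>\<^bsub>A\<^esub>} \<longrightarrow> finite_dimensional (quotient_algebra A I))"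


section \<open>Completion of a seminormed *-algebra\<close>

text \<open>
  The Cauchy sequences with pointwise operations and seminorm \<open>lim \<parallel>s n\<parallel>\<close>, modulo the null
  sequences.  On a class of Cauchy sequences the seminorm is constant, so the quotient
  norm is that constant.  The seminorm need not be definite: its null space is killed.
\<close>

definition cauchy_algebra ::
    "('a, 'm) normed_star_algebra_scheme \<Rightarrow> (nat \<Rightarrow> 'a) normed_star_algebra" where
  "cauchy_algebra A =
     \<lparr>carrier = {s. cauchy_in A s}, mult = (\<lambda>s t n. s n \<otimes>\<^bsub>A\<^esub> t n), one = (\<lambda>n. \<one>\<^bsub>A\<^esub>),
      zero = (\<lambda>n. \<zero>\<^bsub>A\<^esub>), add = (\<lambda>s t n. s n \<oplus>\<^bsub>A\<^esub> t n),
      smult = (\<lambda>c s n. c \<odot>\<^bsub>A\<^esub> s n), star = (\<lambda>s n. star A (s n)),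
      nrm = (\<lambda>s. lim (\<lambda>n. nrm A (s n)))\<rparr>"

definition completion ::
    "('a, 'm) normed_star_algebra_scheme \<Rightarrow> (nat \<Rightarrow> 'a) set normed_star_algebra" where
  "completion A =
     quotient_algebra (cauchy_algebra A) {s. cauchy_in A s \<and> (\<lambda>n. nrm A (s n)) \<longlonglongrightarrow> 0}"


section \<open>Unitary representations\<close>

text \<open>The Hilbert space \<open>\<ell>\<^sup>2(X)\<close>, realised as functions vanishing off \<open>X\<close>.\<close>

definition ell2 :: "'x set \<Rightarrow> ('x \<Rightarrow> complex) set" where
  "ell2 X = {\<psi>. (\<forall>x. x \<notin> X \<longrightarrow> \<psi> x = 0) \<and> (\<lambda>x. (cmod (\<psi> x))\<^sup>2) summable_on X}"

definition ell2_inner :: "'x set \<Rightarrow> ('x \<Rightarrow> complex) \<Rightarrow> ('x \<Rightarrow> complex) \<Rightarrow> complex" where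
  "ell2_inner X \<phi> \<psi> = (\<Sum>\<^sub>\<infinity>x\<in>X. cnj (\<phi> x) * \<psi> x)"

definition ell2_norm :: "'x set \<Rightarrow> ('x \<Rightarrow> complex) \<Rightarrow> real" where
  "ell2_norm X \<psi> = sqrt (\<Sum>\<^sub>\<infinity>x\<in>X. (cmod (\<psi> x))\<^sup>2)"

definition unitary_op :: "'x set \<Rightarrow> (('x \<Rightarrow> complex) \<Rightarrow> 'x \<Rightarrow> complex) \<Rightarrow> bool" where
  "unitary_op X T \<longleftrightarrow>
     (\<forall>\<phi>\<in>ell2 X. \<forall>\<psi>\<in>ell2 X. T (\<lambda>x. \<phi> x + \<psi> x) = (\<lambda>x. T \<phi> x + T \<psi> x)) \<and>
     (\<forall>c. \<forall>\<psi>\<in>ell2 X. T (\<lambda>x. c * \<psi> x) = (\<lambda>x. c * T \<psi> x)) \<and>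
     T ` ell2 X = ell2 X \<and>
     (\<forall>\<phi>\<in>ell2 X. \<forall>\<psi>\<in>ell2 X. ell2_inner X (T \<phi>) (T \<psi>) = ell2_inner X \<phi> \<psi>)"

definition op_norm :: "'x set \<Rightarrow> (('x \<Rightarrow> complex) \<Rightarrow> 'x \<Rightarrow> complex) \<Rightarrow> real" where
  "op_norm X T = Sup {ell2_norm X (T \<psi>) |\<psi>. \<psi> \<in> ell2 X \<and> ell2_norm X \<psi> \<le> 1}"

definition unitary_rep ::
    "('g, 'm) monoid_scheme \<Rightarrow> 'x set \<Rightarrow> ('g \<Rightarrow> ('x \<Rightarrow> complex) \<Rightarrow> 'x \<Rightarrow> complex) \<Rightarrow> bool" where
  "unitary_rep G X U \<longleftrightarrow>
     (\<forall>g\<in>carrier G. unitary_op X (U g)) \<and>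
     (\<forall>g\<in>carrier G. \<forall>h\<in>carrier G. \<forall>\<psi>\<in>ell2 X. U (g \<otimes>\<^bsub>G\<^esub> h) \<psi> = U g (U h \<psi>))"

definition rep_extend ::
    "('g \<Rightarrow> ('x \<Rightarrow> complex) \<Rightarrow> 'x \<Rightarrow> complex) \<Rightarrow> ('g \<Rightarrow> complex) \<Rightarrow> ('x \<Rightarrow> complex) \<Rightarrow> 'x \<Rightarrow> complex"
  where "rep_extend U f \<psi> = (\<lambda>x. \<Sum>g | f g \<noteq> 0. f g * U g \<psi> x)"


section \<open>The full group \<open>C\<close>*-algebra\<close>

text \<open>
  The universal norm is the supremum of the norms of a group ring element over all unitary
  representations.  To make this range over a set, the Hilbert spaces are \<open>\<ell>\<^sup>2(X)\<close> with
  \<open>X\<close> a set of elements of \<open>'g \<times> nat\<close>.  This loses nothing: the supremum is attained on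
  cyclic representations, and a cyclic representation of \<open>G\<close> acts on a Hilbert space whose
  orthonormal bases have at most \<open>|G| \<cdot> \<aleph>\<^sub>0\<close> elements.
\<close>

definition full_norm :: "('g, 'm) monoid_scheme \<Rightarrow> ('g \<Rightarrow> complex) \<Rightarrow> real" where
  "full_norm G f =
     Sup {op_norm X (rep_extend U f) |(X :: ('g \<times> nat) set) U. unitary_rep G X U}"

text \<open>The complex group ring: finitely supported functions with convolution.\<close>

definition group_algebra :: "('g, 'm) monoid_scheme \<Rightarrow> ('g \<Rightarrow> complex) normed_star_algebra" where
  "group_algebra G =
     \<lparr>carrier = {f. finite {g. f g \<noteq> 0} \<and> {g. f g \<noteq> 0} \<subseteq> carrier G},
      mult = (\<lambda>f h x. if x \<in> carrier G
                      then \<Sum>y | f y \<noteq> 0. f y * h (inv\<^bsub>G\<^esub> y \<otimes>\<^bsub>G\<^esub> x) else 0),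
      one = (\<lambda>x. if x = \<one>\<^bsub>G\<^esub> then 1 else 0),
      zero = (\<lambda>x. 0),
      add = (\<lambda>f h x. f x + h x),
      smult = (\<lambda>c f x. c * f x),
      star = (\<lambda>f x. if x \<in> carrier G then cnj (f (inv\<^bsub>G\<^esub> x)) else 0),
      nrm = full_norm G\<rparr>"

definition full_group_cstar_algebra ::
    "('g, 'm) monoid_scheme \<Rightarrow> (nat \<Rightarrow> 'g \<Rightarrow> complex) set normed_star_algebra" where
  "full_group_cstar_algebra G = completion (group_algebra G)"

end

theory Submission
  imports Defs
    "HOL-Analysis.Topology_Euclidean_Space"
    "HOL-Combinatorics.Permutations"
    "HOL-Library.Countable_Set"
begin

text \<open>
  The group is the union of a chain of finite subgroups \<open>F 0 \<subseteq> F 1 \<subseteq> \<dots>\<close>.  Abstractly \<open>F (n + 1)\<close> is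
  the product of \<open>F n\<close> with a finite group \<open>block n\<close>, and \<open>F n\<close> is embedded in this product as the
  graph of a homomorphism \<open>rho n : F n \<rightarrow> block n\<close>.  Forgetting all but the first \<open>n\<close> factors is a
  homomorphism onto a finite group which is injective on \<open>F n\<close>; so the group is residually finite.

  The blocks are chosen so that \<open>F n\<close> is invisible to a suitable idempotent of the group algebra of
  \<open>block n\<close>.  Let \<open>d\<close> be the order of \<open>F n\<close>, and let \<open>block n\<close> be generated by the transvections of
  the vector space of dimension \<open>d + 1\<close> over the field with two elements.  The group \<open>F n\<close> acts by
  permuting the coordinates \<open>1, \<dots>, d\<close> as in its regular representation and fixing the coordinate
  \<open>0\<close>.  The maps \<open>v \<mapsto> v + v\<^sub>0 w\<close>, where \<open>w\<close> has coordinate \<open>0\<close> equal to zero, form an elementary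
  abelian group \<open>V\<close> normalised by \<open>F n\<close>.  The character of \<open>V\<close> given by a single coordinate of \<open>w\<close> is
  moved by every nontrivial element of \<open>F n\<close>, since the regular action is free.  If \<open>e\<close> is the
  idempotent of this character, it follows that \<open>e f e = 0\<close> for \<open>1 \<noteq> f \<in> F n\<close>, whence
  \<open>e a e = a(1) e\<close> for every \<open>a\<close> in the group algebra of \<open>F n\<close> (\<open>e_compress\<close>).

  This identity controls the closed ideals.  Let \<open>b \<noteq> 0\<close> lie in a closed ideal \<open>J\<close>, and approximate
  \<open>b\<close> up to \<open>\<epsilon> < \<parallel>a\<parallel>\<close> by an \<open>a\<close> in the group algebra of \<open>F n\<close>.  By Fell absorption the norm of \<open>a\<close> is
  its norm in the regular representation of \<open>F n\<close> (\<open>full_norm_le_finite_subgroup\<close>), so that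
  \<open>\<parallel>a \<xi>\<parallel>\<^sub>2 > \<epsilon> \<parallel>\<xi>\<parallel>\<^sub>2\<close> for some \<open>\<xi>\<close> supported on \<open>F n\<close>.  The element \<open>(a \<xi> e)\<^sup>* b (\<xi> e)\<close> of \<open>J\<close> is, after
  scaling, at distance less than one from \<open>(a \<xi> e)\<^sup>* (a \<xi> e) / \<parallel>a \<xi>\<parallel>\<^sub>2\<^sup>2 = e\<close>, and a Neumann series gives
  \<open>e \<in> J\<close> (\<open>closed_ideal_contains_e\<close>).  This works for the idempotents of all later levels as well,
  since \<open>a\<close> also lies in their group algebras.

  All nontrivial characters of \<open>V\<close> are conjugate under \<open>block n\<close>, so their idempotents all belong to
  \<open>J\<close>.  Their sum is \<open>1\<close> minus the average over \<open>V\<close>, and therefore \<open>v - 1 \<in> J\<close> for \<open>v \<in> V\<close>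
  (\<open>V_augmentation\<close>).  All transvections are conjugate in \<open>block n\<close>, so \<open>u - 1 \<in> J\<close> for every \<open>u\<close> in
  \<open>block n\<close> (\<open>insert_at_in_normal\<close>), and modulo \<open>J\<close> every element of \<open>F (n + 1)\<close> agrees with an element of
  \<open>F n\<close>.  Hence the image of a single \<open>F n\<close> spans a dense subspace of the quotient by \<open>J\<close>, and this
  subspace, being finite-dimensional, is everything.

  Before this argument can be run, the full group C*-algebra has to be shown to be a C*-algebra.  The
  universal norm is the least uniform bound for the operators of all unitary representations, which
  yields the axioms of a C*-seminorm; completing such a seminorm yields a C*-algebra
  (\<open>completion_unital_cstar\<close>).  The regular representation shows that the seminorm is definite on the
  group algebra, and so the completion is infinite-dimensional.
\<close>

section \<open>C*-seminorms\<close>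

lemma cring_complex_ring: "cring complex_ring"
proof (rule cringI)
  show "abelian_group complex_ring"
    by (rule abelian_groupI) (auto simp: complex_ring_def intro: exI[of _ "- _"])
  show "Group.comm_monoid complex_ring"
    by (rule comm_monoidI) (auto simp: complex_ring_def)
qed (auto simp: complex_ring_def algebra_simps)

lemma complex_ring_simps [simp]:
  "carrier complex_ring = UNIV" "mult complex_ring = (*)" "one complex_ring = 1"
  "zero complex_ring = 0" "add complex_ring = (+)"
  by (simp_all add: complex_ring_def)

text \<open>
  The axioms of a unital C*-algebra apart from definiteness of the norm and completeness: the data
  that a C*-seminorm on a star algebra provides.  Group algebras are of this kind, and the two
  remaining axioms are produced by completion.
\<close>

locale pre_cstar_algebra = Module.module complex_ring A + ring A
  for A :: "('a, 'm) normed_star_algebra_scheme" (structure) +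
  assumes smult_mult_left:
      "\<lbrakk>x \<in> carrier A; y \<in> carrier A\<rbrakk> \<Longrightarrow> (c \<odot> x) \<otimes> y = c \<odot> (x \<otimes> y)"
    and smult_mult_right:
      "\<lbrakk>x \<in> carrier A; y \<in> carrier A\<rbrakk> \<Longrightarrow> x \<otimes> (c \<odot> y) = c \<odot> (x \<otimes> y)"
    and star_closed [simp, intro]: "x \<in> carrier A \<Longrightarrow> star A x \<in> carrier A"
    and star_star: "x \<in> carrier A \<Longrightarrow> star A (star A x) = x"
    and star_add:
      "\<lbrakk>x \<in> carrier A; y \<in> carrier A\<rbrakk> \<Longrightarrow> star A (x \<oplus> y) = star A x \<oplus> star A y"
    and star_smult: "x \<in> carrier A \<Longrightarrow> star A (c \<odot> x) = cnj c \<odot> star A x"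
    and star_mult:
      "\<lbrakk>x \<in> carrier A; y \<in> carrier A\<rbrakk> \<Longrightarrow> star A (x \<otimes> y) = star A y \<otimes> star A x"
    and nrm_nonneg: "x \<in> carrier A \<Longrightarrow> 0 \<le> nrm A x"
    and nrm_triangle:
      "\<lbrakk>x \<in> carrier A; y \<in> carrier A\<rbrakk> \<Longrightarrow> nrm A (x \<oplus> y) \<le> nrm A x + nrm A y"
    and nrm_smult: "x \<in> carrier A \<Longrightarrow> nrm A (c \<odot> x) = cmod c * nrm A x"
    and nrm_mult:
      "\<lbrakk>x \<in> carrier A; y \<in> carrier A\<rbrakk> \<Longrightarrow> nrm A (x \<otimes> y) \<le> nrm A x * nrm A y"
    and cstar_identity: "x \<in> carrier A \<Longrightarrow> nrm A (star A x \<otimes> x) = (nrm A x)\<^sup>2"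
begin

lemma smult_closed' [simp, intro]: "x \<in> carrier A \<Longrightarrow> c \<odot> x \<in> carrier A"
  by (rule smult_closed) simp_all

lemma smult_zero_left [simp]: "x \<in> carrier A \<Longrightarrow> 0 \<odot> x = \<zero>"
  using smult_l_null[of x] by simp

lemma a_inv_smult: "x \<in> carrier A \<Longrightarrow> \<ominus> x = (-1) \<odot> x"
  using smult_l_minus[of 1 x] smult_one[of x]
proof -
  assume x: "x \<in> carrier A"
  have "(-1) \<odot> x \<oplus> x = (-1) \<odot> x \<oplus> 1 \<odot> x" using smult_one[OF x] by simp
  also have "\<dots> = (-1 + 1) \<odot> x" using smult_l_distr[of "-1" 1 x] x by simp
  finally have "(-1) \<odot> x \<oplus> x = \<zero>" using x by simp
  thus ?thesis using x by (metis minus_equality smult_closed')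
qed

lemma nrm_zero [simp]: "nrm A \<zero> = 0"
  using nrm_smult[of "\<zero>" 0] by simp

lemma nrm_a_inv: "x \<in> carrier A \<Longrightarrow> nrm A (\<ominus> x) = nrm A x"
  by (simp add: a_inv_smult nrm_smult)

lemma nrm_minus_commute:
  assumes "x \<in> carrier A" "y \<in> carrier A" shows "nrm A (x \<ominus> y) = nrm A (y \<ominus> x)"
proof -
  have "x \<ominus> y = \<ominus> (y \<ominus> x)" using assms by (simp add: minus_eq minus_add a_comm)
  thus ?thesis using assms nrm_a_inv[of "y \<ominus> x"] by simp
qed

lemma minus_split:
  assumes "x \<in> carrier A" "y \<in> carrier A" "z \<in> carrier A"
  shows "x \<ominus> z = (x \<ominus> y) \<oplus> (y \<ominus> z)"
  using assms by (simp add: minus_eq a_assoc r_neg1)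

lemma nrm_minus_triangle:
  assumes "x \<in> carrier A" "y \<in> carrier A" "z \<in> carrier A"
  shows "nrm A (x \<ominus> z) \<le> nrm A (x \<ominus> y) + nrm A (y \<ominus> z)"
  using minus_split[OF assms] nrm_triangle[of "x \<ominus> y" "y \<ominus> z"] assms by simp

lemma minus_zero_right: "x \<in> carrier A \<Longrightarrow> x \<ominus> \<zero> = x"
  by (simp add: minus_eq)

lemma nrm_minus_le:
  "x \<in> carrier A \<Longrightarrow> y \<in> carrier A \<Longrightarrow> nrm A (x \<ominus> y) \<le> nrm A x + nrm A y"
  using nrm_triangle[of x "\<ominus> y"] by (simp add: minus_eq nrm_a_inv)

lemma nrm_abs_diff:
  assumes "x \<in> carrier A" "y \<in> carrier A"
  shows "\<bar>nrm A x - nrm A y\<bar> \<le> nrm A (x \<ominus> y)"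
  using nrm_minus_triangle[of x y \<zero>] nrm_minus_triangle[of y x \<zero>] assms nrm_minus_commute[of x y]
  by (simp add: minus_zero_right)

lemma minus_add_add:
  assumes "x \<in> carrier A" "y \<in> carrier A" "x' \<in> carrier A" "y' \<in> carrier A"
  shows "(x \<oplus> y) \<ominus> (x' \<oplus> y') = (x \<ominus> x') \<oplus> (y \<ominus> y')"
  using assms by (simp add: minus_eq minus_add a_ac)

lemma minus_mult_mult:
  assumes "x \<in> carrier A" "y \<in> carrier A" "x' \<in> carrier A" "y' \<in> carrier A"
  shows "(x \<otimes> y) \<ominus> (x' \<otimes> y') = x \<otimes> (y \<ominus> y') \<oplus> (x \<ominus> x') \<otimes> y'"
  using assms by (simp add: minus_eq l_distr r_distr l_minus r_minus a_assoc r_neg1 r_neg2)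

lemma minus_smult:
  assumes "x \<in> carrier A" "y \<in> carrier A"
  shows "c \<odot> x \<ominus> c \<odot> y = c \<odot> (x \<ominus> y)"
  using assms smult_r_distr[of c x "\<ominus> y"] smult_r_minus[of c y] by (simp add: minus_eq)

lemma star_a_inv: "x \<in> carrier A \<Longrightarrow> star A (\<ominus> x) = \<ominus> (star A x)"
  by (simp add: a_inv_smult star_smult)

lemma star_minus:
  assumes "x \<in> carrier A" "y \<in> carrier A"
  shows "star A (x \<ominus> y) = star A x \<ominus> star A y"
  using assms by (simp add: minus_eq star_add star_a_inv)

text \<open>
  The C*-identity and submultiplicativity give \<open>\<parallel>z\<parallel>\<^sup>2 \<le> \<parallel>z\<^sup>*\<parallel> \<parallel>z\<parallel>\<close>; applied to \<open>x\<close> and to \<open>x\<^sup>*\<close> this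
  yields both inequalities.
\<close>

lemma nrm_star: assumes x: "x \<in> carrier A" shows "nrm A (star A x) = nrm A x"
proof -
  have le: "nrm A z \<le> nrm A (star A z)" if z: "z \<in> carrier A" for z
  proof (cases "nrm A z = 0")
    case False
    have "nrm A z * nrm A z \<le> nrm A (star A z) * nrm A z"
      using cstar_identity[OF z] nrm_mult[of "star A z" z] z by (simp add: power2_eq_square)
    thus ?thesis using False nrm_nonneg[OF z] by simp
  qed (use z nrm_nonneg in auto)
  from le[OF x] le[of "star A x"] x show ?thesis by (simp add: star_star)
qed

lemma nrm_mult_diff:
  assumes "x \<in> carrier A" "y \<in> carrier A" "x' \<in> carrier A" "y' \<in> carrier A"
  shows "nrm A ((x \<otimes> y) \<ominus> (x' \<otimes> y')) \<le> nrm A x * nrm A (y \<ominus> y') + nrm A (x \<ominus> x') * nrm A y'"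
  unfolding minus_mult_mult[OF assms]
  using assms nrm_triangle[of "x \<otimes> (y \<ominus> y')" "(x \<ominus> x') \<otimes> y'"] nrm_mult[of x "y \<ominus> y'"]
    nrm_mult[of "x \<ominus> x'" y'] by simp

lemma cauchy_closed: "cauchy_in A s \<Longrightarrow> s n \<in> carrier A"
  by (simp add: cauchy_in_def)

text \<open>
  Used for scalar multiples and adjoints, which multiply all distances by a constant.
\<close>

lemma cauchy_dominated:
  assumes c: "\<And>n. t n \<in> carrier A" and s: "cauchy_in A s" and k: "0 \<le> k"
    and le: "\<And>m n. nrm A (t m \<ominus> t n) \<le> k * nrm A (s m \<ominus> s n)"
  shows "cauchy_in A t"
  unfolding cauchy_in_def
proof (intro conjI allI impI)
  fix e :: real assume e: "0 < e"
  then have "0 < e / (k + 1)" using k by simp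
  then obtain N where N: "\<And>m n. m \<ge> N \<Longrightarrow> n \<ge> N \<Longrightarrow> nrm A (s m \<ominus> s n) < e / (k + 1)"
    using s unfolding cauchy_in_def by blast
  show "\<exists>N. \<forall>m\<ge>N. \<forall>n\<ge>N. nrm A (t m \<ominus> t n) < e"
  proof (intro exI allI impI)
    fix m n assume "N \<le> m" "N \<le> n"
    hence "nrm A (s m \<ominus> s n) * (k + 1) < e" using N k by (simp add: pos_less_divide_eq)
    moreover have "k * nrm A (s m \<ominus> s n) \<le> nrm A (s m \<ominus> s n) * (k + 1)"
      using nrm_nonneg[of "s m \<ominus> s n"] s by (simp add: cauchy_in_def algebra_simps)
    ultimately show "nrm A (t m \<ominus> t n) < e" using le[of m n] by linarith
  qed
qed (rule c)

lemma cauchy_nrm_convergent: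
  assumes "cauchy_in A s" shows "convergent (\<lambda>n. nrm A (s n))"
proof -
  have "Cauchy (\<lambda>n. nrm A (s n))"
    unfolding Cauchy_def dist_real_def
  proof (intro allI impI)
    fix e :: real assume "0 < e"
    then obtain N where N: "\<And>m n. m \<ge> N \<Longrightarrow> n \<ge> N \<Longrightarrow> nrm A (s m \<ominus> s n) < e"
      using assms unfolding cauchy_in_def by blast
    have "\<bar>nrm A (s m) - nrm A (s n)\<bar> < e" if "m \<ge> N" "n \<ge> N" for m n
      using N[OF that] nrm_abs_diff[of "s m" "s n"] assms by (simp add: cauchy_in_def)
    thus "\<exists>M. \<forall>m\<ge>M. \<forall>n\<ge>M. \<bar>nrm A (s m) - nrm A (s n)\<bar> < e" by blast
  qed
  thus ?thesis by (rule Cauchy_convergent)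
qed

lemma cauchy_nrm_lim: "cauchy_in A s \<Longrightarrow> (\<lambda>n. nrm A (s n)) \<longlonglongrightarrow> lim (\<lambda>n. nrm A (s n))"
  using cauchy_nrm_convergent convergent_LIMSEQ_iff by blast

lemma cauchy_bounded:
  assumes "cauchy_in A s" obtains B where "0 \<le> B" "\<And>n. nrm A (s n) \<le> B"
proof -
  from convergent_imp_Bseq[OF cauchy_nrm_convergent[OF assms]]
  obtain K where K: "0 < K" "\<And>n. norm (nrm A (s n)) \<le> K" by (auto elim!: BseqE)
  show ?thesis
  proof (rule that)
    show "0 \<le> K" using K by simp
    show "nrm A (s n) \<le> K" for n using K(2)[of n] by simp
  qed
qed

lemma cauchy_const: "x \<in> carrier A \<Longrightarrow> cauchy_in A (\<lambda>_. x)"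
  by (simp add: cauchy_in_def minus_eq r_neg)

lemma cauchyD:
  assumes "cauchy_in A s" "0 < e"
  obtains N where "\<And>m n. m \<ge> N \<Longrightarrow> n \<ge> N \<Longrightarrow> nrm A (s m \<ominus> s n) < e"
  using assms unfolding cauchy_in_def by blast

lemma cauchy_add:
  assumes s: "cauchy_in A s" and t: "cauchy_in A t" shows "cauchy_in A (\<lambda>n. s n \<oplus> t n)"
  unfolding cauchy_in_def
proof (intro conjI allI impI)
  fix e :: real assume e: "0 < e"
  hence "0 < e/2" by simp
  from cauchyD[OF s this] obtain N where
    N: "\<And>m n. m \<ge> N \<Longrightarrow> n \<ge> N \<Longrightarrow> nrm A (s m \<ominus> s n) < e/2" by blast
  from cauchyD[OF t \<open>0 < e/2\<close>] obtain M where
    M: "\<And>m n. m \<ge> M \<Longrightarrow> n \<ge> M \<Longrightarrow> nrm A (t m \<ominus> t n) < e/2" by blast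
  have "nrm A ((s m \<oplus> t m) \<ominus> (s n \<oplus> t n)) < e" if "m \<ge> max N M" "n \<ge> max N M" for m n
    using N[of m n] M[of m n] that nrm_triangle[of "s m \<ominus> s n" "t m \<ominus> t n"]
      cauchy_closed[OF s] cauchy_closed[OF t] by (simp add: minus_add_add)
  thus "\<exists>N. \<forall>m\<ge>N. \<forall>n\<ge>N. nrm A ((s m \<oplus> t m) \<ominus> (s n \<oplus> t n)) < e" by blast
qed (use s t in \<open>simp add: cauchy_in_def\<close>)

lemma cauchy_smult:
  assumes s: "cauchy_in A s" shows "cauchy_in A (\<lambda>n. c \<odot> s n)"
proof (rule cauchy_dominated[OF _ s, of _ "cmod c"])
  note [simp] = cauchy_closed[OF s]
  show "c \<odot> s n \<in> carrier A" for n by simp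
  show "nrm A (c \<odot> s m \<ominus> c \<odot> s n) \<le> cmod c * nrm A (s m \<ominus> s n)" for m n
    by (simp add: minus_smult nrm_smult)
qed simp

lemma cauchy_star:
  assumes s: "cauchy_in A s" shows "cauchy_in A (\<lambda>n. star A (s n))"
proof (rule cauchy_dominated[OF _ s, of _ 1])
  note [simp] = cauchy_closed[OF s]
  show "star A (s n) \<in> carrier A" for n by simp
  show "nrm A (star A (s m) \<ominus> star A (s n)) \<le> 1 * nrm A (s m \<ominus> s n)" for m n
    by (simp add: star_minus[symmetric] nrm_star)
qed simp

lemma cauchy_mult:
  assumes s: "cauchy_in A s" and t: "cauchy_in A t" shows "cauchy_in A (\<lambda>n. s n \<otimes> t n)"
  unfolding cauchy_in_def
proof (intro conjI allI impI)
  note [simp] = cauchy_closed[OF s] cauchy_closed[OF t]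
  obtain B where B: "0 \<le> B" "\<And>n. nrm A (s n) \<le> B" using cauchy_bounded[OF s] by blast
  obtain C where C: "0 \<le> C" "\<And>n. nrm A (t n) \<le> C" using cauchy_bounded[OF t] by blast
  fix e :: real assume e: "0 < e"
  define d where "d = e / (B + C + 1)"
  have d: "0 < d" using e B C by (simp add: d_def)
  from cauchyD[OF s this] obtain N where
    N: "\<And>m n. m \<ge> N \<Longrightarrow> n \<ge> N \<Longrightarrow> nrm A (s m \<ominus> s n) < d" by blast
  from cauchyD[OF t d] obtain M where
    M: "\<And>m n. m \<ge> M \<Longrightarrow> n \<ge> M \<Longrightarrow> nrm A (t m \<ominus> t n) < d" by blast
  have "nrm A ((s m \<otimes> t m) \<ominus> (s n \<otimes> t n)) < e" if mn: "m \<ge> max N M" "n \<ge> max N M" for m n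
  proof -
    have "nrm A ((s m \<otimes> t m) \<ominus> (s n \<otimes> t n))
        \<le> nrm A (s m) * nrm A (t m \<ominus> t n) + nrm A (s m \<ominus> s n) * nrm A (t n)"
      by (rule nrm_mult_diff) simp_all
    also have "\<dots> \<le> B * d + d * C"
      using N[of m n] M[of m n] mn B C d by (intro add_mono mult_mono) (auto simp: nrm_nonneg less_imp_le)
    also have "\<dots> < d * (B + C + 1)" using d by (simp add: algebra_simps)
    also have "\<dots> = e" using B C by (simp add: d_def)
    finally show ?thesis .
  qed
  thus "\<exists>N. \<forall>m\<ge>N. \<forall>n\<ge>N. nrm A ((s m \<otimes> t m) \<ominus> (s n \<otimes> t n)) < e" by blast
qed (use s t in \<open>simp add: cauchy_in_def\<close>)

end

section \<open>Completion of a pre-C*-algebra\<close>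

text \<open>
  Separates the axioms that pass to limits from the two that the completion creates.
\<close>

lemma unital_cstar_algebra_iff:
  "unital_cstar_algebra A \<longleftrightarrow> pre_cstar_algebra A \<and>
     (\<forall>x\<in>carrier A. nrm A x = 0 \<longrightarrow> x = \<zero>\<^bsub>A\<^esub>) \<and>
     (\<forall>s. cauchy_in A s \<longrightarrow> (\<exists>a\<in>carrier A. tends_to_in A s a))"
proof
  assume "unital_cstar_algebra A"
  then interpret unital_cstar_algebra A .
  have "pre_cstar_algebra A"
    by unfold_locales
      (fact smult_mult_left smult_mult_right star_closed star_star star_add star_smult star_mult
         nrm_nonneg nrm_triangle nrm_smult nrm_mult cstar_identity)+
  thus "pre_cstar_algebra A \<and> (\<forall>x\<in>carrier A. nrm A x = 0 \<longrightarrow> x = \<zero>\<^bsub>A\<^esub>) \<and>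
     (\<forall>s. cauchy_in A s \<longrightarrow> (\<exists>a\<in>carrier A. tends_to_in A s a))"
    using complete nrm_eq_zero_iff by blast
next
  assume a: "pre_cstar_algebra A \<and> (\<forall>x\<in>carrier A. nrm A x = 0 \<longrightarrow> x = \<zero>\<^bsub>A\<^esub>) \<and>
     (\<forall>s. cauchy_in A s \<longrightarrow> (\<exists>a\<in>carrier A. tends_to_in A s a))"
  then interpret pre_cstar_algebra A by (rule conjunct1)
  show "unital_cstar_algebra A"
  proof
    show "nrm A x = 0 \<longleftrightarrow> x = \<zero>\<^bsub>A\<^esub>" if "x \<in> carrier A" for x
      using a that nrm_zero by blast
    show "\<exists>a\<in>carrier A. tends_to_in A s a" if "cauchy_in A s" for s using a that by blast
  qed (fact smult_mult_left smult_mult_right star_closed star_star star_add star_smult star_mult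
         nrm_nonneg nrm_triangle nrm_smult nrm_mult cstar_identity)+
qed

lemma null_le:
  fixes f g :: "nat \<Rightarrow> real"
  assumes "\<And>n. 0 \<le> f n" "\<And>n. f n \<le> g n" "g \<longlonglongrightarrow> 0" shows "f \<longlonglongrightarrow> 0"
  by (rule tendsto_sandwich[OF always_eventually always_eventually tendsto_const assms(3)])
     (use assms in auto)

text \<open>
  The operations are those of the quotient ring, stored in a record of another type.
\<close>

lemma quotient_algebra_ring:
  assumes "ideal I A" shows "ring (quotient_algebra A I)"
proof -
  interpret Q: ring "A Quot I" by (rule ideal.quotient_is_ring[OF assms])
  note simps = quotient_algebra_def Q.a_ac Q.m_assoc Q.l_distr Q.r_distr
  show ?thesis
  proof (rule ringI)
    show "abelian_group (quotient_algebra A I)"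
      by (rule abelian_groupI) (auto simp: simps intro: Q.add.l_inv_ex)
    show "monoid (quotient_algebra A I)" by (rule monoidI) (auto simp: simps)
  qed (auto simp: simps)
qed

context pre_cstar_algebra
begin

abbreviation "C \<equiv> cauchy_algebra A"
abbreviation "Null \<equiv> {s. cauchy_in A s \<and> (\<lambda>n. nrm A (s n)) \<longlonglongrightarrow> 0}"

lemma cauchy_algebra_ring: "ring C"
proof (rule ringI)
  show "abelian_group C"
  proof (rule abelian_groupI)
    fix s assume s: "s \<in> carrier C"
    hence "cauchy_in A (\<lambda>n. \<ominus> s n)"
      using cauchy_smult[of s "-1"] by (simp add: cauchy_algebra_def cauchy_closed a_inv_smult)
    thus "\<exists>t\<in>carrier C. t \<oplus>\<^bsub>C\<^esub> s = \<zero>\<^bsub>C\<^esub>"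
      using s by (intro bexI[of _ "\<lambda>n. \<ominus> s n"]) (auto simp: cauchy_algebra_def cauchy_closed l_neg)
  qed (auto simp: cauchy_algebra_def cauchy_add cauchy_const cauchy_closed a_ac)
  show "monoid C"
    by (rule monoidI) (auto simp: cauchy_algebra_def cauchy_mult cauchy_const cauchy_closed m_assoc)
qed (auto simp: cauchy_algebra_def cauchy_closed l_distr r_distr)

lemma cauchy_algebra_simps:
  "carrier C = {s. cauchy_in A s}" "s \<otimes>\<^bsub>C\<^esub> t = (\<lambda>n. s n \<otimes> t n)" "s \<oplus>\<^bsub>C\<^esub> t = (\<lambda>n. s n \<oplus> t n)"
  "\<zero>\<^bsub>C\<^esub> = (\<lambda>_. \<zero>)"
  by (simp_all add: cauchy_algebra_def)

lemma cauchy_algebra_a_inv: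
  assumes s: "cauchy_in A s" shows "\<ominus>\<^bsub>C\<^esub> s = (\<lambda>n. \<ominus> s n)"
proof -
  interpret C: ring C by (rule cauchy_algebra_ring)
  have "cauchy_in A (\<lambda>n. \<ominus> s n)"
    using cauchy_smult[OF s, of "-1"] s by (simp add: a_inv_smult cauchy_closed)
  thus ?thesis using s
    by (intro C.minus_equality) (auto simp: cauchy_algebra_simps cauchy_closed l_neg)
qed

text \<open>
  Absorption uses that Cauchy sequences are bounded.
\<close>

lemma null_ideal: "ideal Null C"
proof (rule idealI[OF cauchy_algebra_ring])
  interpret C: ring C by (rule cauchy_algebra_ring)
  show "subgroup Null (add_monoid C)"
  proof (rule subgroup.intro)
    fix s assume s: "s \<in> Null"
    hence "\<ominus>\<^bsub>C\<^esub> s \<in> Null"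
      using cauchy_smult[of s "-1"]
      by (auto simp: cauchy_algebra_a_inv a_inv_smult cauchy_closed nrm_smult)
    thus "inv\<^bsub>add_monoid C\<^esub> s \<in> Null" by (simp add: a_inv_def)
  next
    fix s t assume s: "s \<in> Null" and t: "t \<in> Null"
    have "(\<lambda>n. nrm A (s n) + nrm A (t n)) \<longlonglongrightarrow> 0" using s t by (auto intro!: tendsto_add_zero)
    hence "(\<lambda>n. nrm A (s n \<oplus> t n)) \<longlonglongrightarrow> 0"
      by (rule null_le[rotated 2]) (use s t in \<open>simp_all add: cauchy_closed nrm_nonneg nrm_triangle\<close>)
    thus "s \<otimes>\<^bsub>add_monoid C\<^esub> t \<in> Null" using s t by (simp add: cauchy_algebra_simps cauchy_add)
  qed (auto simp: cauchy_algebra_simps cauchy_const)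
next
  fix s t assume s: "s \<in> Null" and t: "t \<in> carrier C"
  hence t': "cauchy_in A t" by (simp add: cauchy_algebra_simps)
  obtain B where B: "0 \<le> B" "\<And>n. nrm A (t n) \<le> B" using cauchy_bounded[OF t'] by blast
  have lim: "(\<lambda>n. B * nrm A (s n)) \<longlonglongrightarrow> 0" using s by (auto intro!: tendsto_mult_right_zero)
  have le1: "nrm A (t n \<otimes> s n) \<le> B * nrm A (s n)" for n
    using nrm_mult[of "t n" "s n"] mult_right_mono[OF B(2)[of n], of "nrm A (s n)"] s t'
    by (simp add: cauchy_closed nrm_nonneg)
  have le2: "nrm A (s n \<otimes> t n) \<le> B * nrm A (s n)" for n
    using nrm_mult[of "s n" "t n"] mult_right_mono[OF B(2)[of n], of "nrm A (s n)"] s t'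
    by (simp add: cauchy_closed nrm_nonneg mult.commute)
  have "(\<lambda>n. nrm A (t n \<otimes> s n)) \<longlonglongrightarrow> 0"
    by (rule null_le[OF _ le1 lim]) (use s t' in \<open>simp add: cauchy_closed nrm_nonneg\<close>)
  thus "t \<otimes>\<^bsub>C\<^esub> s \<in> Null" using s t' by (simp add: cauchy_algebra_simps cauchy_mult)
  have "(\<lambda>n. nrm A (s n \<otimes> t n)) \<longlonglongrightarrow> 0"
    by (rule null_le[OF _ le2 lim]) (use s t' in \<open>simp add: cauchy_closed nrm_nonneg\<close>)
  thus "s \<otimes>\<^bsub>C\<^esub> t \<in> Null" using s t' by (simp add: cauchy_algebra_simps cauchy_mult)
qed

text \<open>
  A point of the completion, represented by a Cauchy sequence.
\<close>

definition cls :: "(nat \<Rightarrow> 'a) \<Rightarrow> (nat \<Rightarrow> 'a) set" where "cls s = Null +>\<^bsub>C\<^esub> s"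

lemma cls_eq:
  assumes s: "cauchy_in A s"
  shows "cls s = {t. cauchy_in A t \<and> (\<lambda>n. nrm A (t n \<ominus> s n)) \<longlonglongrightarrow> 0}"
proof -
  have "t \<in> cls s" if t: "cauchy_in A t" and l: "(\<lambda>n. nrm A (t n \<ominus> s n)) \<longlonglongrightarrow> 0" for t
  proof -
    have "cauchy_in A (\<lambda>n. t n \<ominus> s n)"
      using cauchy_add[OF t cauchy_smult[OF s, of "-1"]] s
      by (simp add: minus_eq a_inv_smult cauchy_closed)
    moreover have "t = (\<lambda>n. (t n \<ominus> s n) \<oplus> s n)"
      using s t by (auto simp: cauchy_closed minus_eq a_assoc l_neg)
    ultimately show ?thesis using l unfolding cls_def a_r_coset_def'
      by (auto simp: cauchy_algebra_def)
  qed
  moreover have "cauchy_in A t \<and> (\<lambda>n. nrm A (t n \<ominus> s n)) \<longlonglongrightarrow> 0" if "t \<in> cls s" for t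
  proof -
    from that obtain h where h: "h \<in> Null" "t = (\<lambda>n. h n \<oplus> s n)"
      unfolding cls_def a_r_coset_def' by (auto simp: cauchy_algebra_def)
    thus ?thesis using s by (auto simp: cauchy_add cauchy_closed minus_eq a_assoc r_neg)
  qed
  ultimately show ?thesis by blast
qed

lemma cls_self: "cauchy_in A s \<Longrightarrow> s \<in> cls s"
  by (simp add: cls_eq cauchy_closed minus_eq r_neg)

lemma null_trans:
  assumes "cauchy_in A s" "cauchy_in A t" "cauchy_in A u"
    "(\<lambda>n. nrm A (s n \<ominus> t n)) \<longlonglongrightarrow> 0" "(\<lambda>n. nrm A (t n \<ominus> u n)) \<longlonglongrightarrow> 0"
  shows "(\<lambda>n. nrm A (s n \<ominus> u n)) \<longlonglongrightarrow> 0"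
  by (rule null_le[OF _ _ tendsto_add_zero[OF assms(4,5)]])
     (use assms in \<open>simp_all add: cauchy_closed nrm_nonneg nrm_minus_triangle\<close>)

lemma cls_eq_iff:
  assumes s: "cauchy_in A s" and t: "cauchy_in A t"
  shows "cls s = cls t \<longleftrightarrow> (\<lambda>n. nrm A (s n \<ominus> t n)) \<longlonglongrightarrow> 0"
proof
  assume "cls s = cls t"
  hence "s \<in> cls t" using cls_self[OF s] by simp
  thus "(\<lambda>n. nrm A (s n \<ominus> t n)) \<longlonglongrightarrow> 0" using t by (simp add: cls_eq)
next
  assume a: "(\<lambda>n. nrm A (s n \<ominus> t n)) \<longlonglongrightarrow> 0"
  hence "(\<lambda>n. nrm A (t n \<ominus> s n)) \<longlonglongrightarrow> 0"
    using s t by (simp add: cauchy_closed nrm_minus_commute)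
  thus "cls s = cls t" using a s t null_trans[of _ s t] null_trans[of _ t s]
    by (auto simp: cls_eq)
qed

lemma completion_carrier: "carrier (completion A) = cls ` {s. cauchy_in A s}"
proof -
  have "carrier (completion A) = (\<Union>s\<in>carrier C. {Null +>\<^bsub>C\<^esub> s})"
    by (simp add: completion_def quotient_algebra_def FactRing_def A_RCOSETS_def' )
  thus ?thesis by (auto simp: cls_def cauchy_algebra_def)
qed

lemma completion_mult:
  assumes "cauchy_in A s" "cauchy_in A t"
  shows "cls s \<otimes>\<^bsub>completion A\<^esub> cls t = cls (\<lambda>n. s n \<otimes> t n)"
proof -
  have "cls s \<otimes>\<^bsub>completion A\<^esub> cls t = rcoset_mult C Null (Null +>\<^bsub>C\<^esub> s) (Null +>\<^bsub>C\<^esub> t)"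
    by (simp add: completion_def quotient_algebra_def FactRing_def cls_def)
  also have "\<dots> = Null +>\<^bsub>C\<^esub> (s \<otimes>\<^bsub>C\<^esub> t)"
    by (rule ideal.rcoset_mult_add[OF null_ideal]) (use assms in \<open>auto simp: cauchy_algebra_def\<close>)
  finally show ?thesis by (simp add: cls_def cauchy_algebra_def)
qed

lemma completion_add:
  assumes "cauchy_in A s" "cauchy_in A t"
  shows "cls s \<oplus>\<^bsub>completion A\<^esub> cls t = cls (\<lambda>n. s n \<oplus> t n)"
proof -
  interpret I: ideal Null C by (rule null_ideal)
  have "cls s \<oplus>\<^bsub>completion A\<^esub> cls t = (Null +>\<^bsub>C\<^esub> s) <+>\<^bsub>C\<^esub> (Null +>\<^bsub>C\<^esub> t)"
    by (simp add: completion_def quotient_algebra_def FactRing_def cls_def)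
  also have "\<dots> = Null +>\<^bsub>C\<^esub> (s \<oplus>\<^bsub>C\<^esub> t)"
    by (rule I.a_rcos_sum) (use assms in \<open>auto simp: cauchy_algebra_def\<close>)
  finally show ?thesis by (simp add: cls_def cauchy_algebra_def)
qed

lemma completion_one: "\<one>\<^bsub>completion A\<^esub> = cls (\<lambda>_. \<one>)"
  by (simp add: completion_def quotient_algebra_def FactRing_def cls_def cauchy_algebra_def)

lemma completion_zero: "\<zero>\<^bsub>completion A\<^esub> = cls (\<lambda>_. \<zero>)"
proof -
  have "cls (\<lambda>_. \<zero>) = Null"
    by (auto simp: cls_eq cauchy_const minus_zero_right cauchy_closed)
  thus ?thesis by (simp add: completion_def quotient_algebra_def FactRing_def)
qed

text \<open>
  In the quotient, a scalar multiple of a class is defined as a union over all representatives; the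
  union collapses because all of its members are equal.  The same happens for the adjoint and, with
  an infimum in place of the union, for the norm.
\<close>

lemma completion_smult:
  assumes s: "cauchy_in A s"
  shows "c \<odot>\<^bsub>completion A\<^esub> cls s = cls (\<lambda>n. c \<odot> s n)"
proof -
  have eq: "cls (\<lambda>n. c \<odot> t n) = cls (\<lambda>n. c \<odot> s n)" if "t \<in> cls s" for t
  proof -
    from that have t: "cauchy_in A t" and l: "(\<lambda>n. nrm A (t n \<ominus> s n)) \<longlonglongrightarrow> 0"
      using s by (auto simp: cls_eq)
    have "(\<lambda>n. cmod c * nrm A (t n \<ominus> s n)) \<longlonglongrightarrow> 0" by (rule tendsto_mult_right_zero[OF l])
    thus ?thesis
      unfolding cls_eq_iff[OF cauchy_smult[OF t] cauchy_smult[OF s]]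
      by (simp add: minus_smult nrm_smult cauchy_closed[OF s] cauchy_closed[OF t])
  qed
  have "(\<Union>t\<in>cls s. cls (\<lambda>n. c \<odot> t n)) = (\<Union>t\<in>cls s. cls (\<lambda>n. c \<odot> s n))"
    by (rule SUP_cong[OF refl eq])
  also have "\<dots> = cls (\<lambda>n. c \<odot> s n)" using cls_self[OF s] by blast
  finally have "(\<Union>t\<in>cls s. cls (\<lambda>n. c \<odot> t n)) = cls (\<lambda>n. c \<odot> s n)" .
  thus ?thesis by (simp add: completion_def quotient_algebra_def cls_def cauchy_algebra_def)
qed

lemma completion_star:
  assumes s: "cauchy_in A s"
  shows "star (completion A) (cls s) = cls (\<lambda>n. star A (s n))"
proof -
  have eq: "cls (\<lambda>n. star A (t n)) = cls (\<lambda>n. star A (s n))" if "t \<in> cls s" for t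
  proof -
    from that have t: "cauchy_in A t" and l: "(\<lambda>n. nrm A (t n \<ominus> s n)) \<longlonglongrightarrow> 0"
      using s by (auto simp: cls_eq)
    show ?thesis
      unfolding cls_eq_iff[OF cauchy_star[OF t] cauchy_star[OF s]]
      using l by (simp add: star_minus[symmetric] nrm_star cauchy_closed[OF s] cauchy_closed[OF t])
  qed
  have "(\<Union>t\<in>cls s. cls (\<lambda>n. star A (t n))) = (\<Union>t\<in>cls s. cls (\<lambda>n. star A (s n)))"
    by (rule SUP_cong[OF refl eq])
  also have "\<dots> = cls (\<lambda>n. star A (s n))" using cls_self[OF s] by blast
  finally have "(\<Union>t\<in>cls s. cls (\<lambda>n. star A (t n))) = cls (\<lambda>n. star A (s n))" .
  thus ?thesis by (simp add: completion_def quotient_algebra_def cls_def cauchy_algebra_def)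
qed

lemma completion_nrm:
  assumes s: "cauchy_in A s"
  shows "nrm (completion A) (cls s) = lim (\<lambda>n. nrm A (s n))"
proof -
  have eq: "lim (\<lambda>n. nrm A (t n)) = lim (\<lambda>n. nrm A (s n))" if "t \<in> cls s" for t
  proof -
    from that have t: "cauchy_in A t" and l: "(\<lambda>n. nrm A (t n \<ominus> s n)) \<longlonglongrightarrow> 0"
      using s by (auto simp: cls_eq)
    have "(\<lambda>n. nrm A (t n) - nrm A (s n)) \<longlonglongrightarrow> 0"
      by (rule tendsto_rabs_zero_cancel, rule null_le[OF _ _ l])
         (use s t in \<open>simp_all add: cauchy_closed nrm_abs_diff\<close>)
    from tendsto_add[OF this cauchy_nrm_lim[OF s]]
    have "(\<lambda>n. nrm A (t n)) \<longlonglongrightarrow> lim (\<lambda>n. nrm A (s n))" by simp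
    thus ?thesis by (rule limI)
  qed
  have "(\<lambda>t. lim (\<lambda>n. nrm A (t n))) ` cls s = (\<lambda>t. lim (\<lambda>n. nrm A (s n))) ` cls s"
    by (rule image_cong[OF refl eq])
  also have "\<dots> = {lim (\<lambda>n. nrm A (s n))}" using cls_self[OF s] by blast
  finally have "(\<lambda>t. lim (\<lambda>n. nrm A (t n))) ` cls s = {lim (\<lambda>n. nrm A (s n))}" .
  thus ?thesis by (simp add: completion_def quotient_algebra_def cauchy_algebra_def)
qed

lemma completion_nrm_tendsto:
  assumes s: "cauchy_in A s"
  shows "(\<lambda>n. nrm A (s n)) \<longlonglongrightarrow> nrm (completion A) (cls s)"
  using cauchy_nrm_lim[OF s] completion_nrm[OF s] by simp

lemmas completion_simps = completion_mult completion_add completion_one completion_zero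
  completion_smult completion_star cauchy_mult cauchy_add cauchy_smult cauchy_star cauchy_const
  cauchy_closed

lemma completion_pre_cstar: "pre_cstar_algebra (completion A)"
proof -
  let ?Q = "completion A"
  interpret Q: ring ?Q
    unfolding completion_def by (rule quotient_algebra_ring[OF null_ideal])
  have ag: "abelian_group ?Q" ..
  interpret M: Module.module complex_ring ?Q
  proof (rule moduleI[OF cring_complex_ring ag])
    fix a b x y assume xy: "x \<in> carrier ?Q" "y \<in> carrier ?Q"
    then obtain s t where s: "cauchy_in A s" "x = cls s" and t: "cauchy_in A t" "y = cls t"
      by (auto simp: completion_carrier)
    note [simp] = s t cauchy_closed[OF s(1)] cauchy_closed[OF t(1)] cauchy_smult completion_smult
      completion_add
    show "a \<odot>\<^bsub>?Q\<^esub> x \<in> carrier ?Q" by (auto simp: completion_carrier)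
    show "(a \<oplus>\<^bsub>complex_ring\<^esub> b) \<odot>\<^bsub>?Q\<^esub> x = a \<odot>\<^bsub>?Q\<^esub> x \<oplus>\<^bsub>?Q\<^esub> b \<odot>\<^bsub>?Q\<^esub> x"
      using smult_l_distr[of a b] by simp
    show "a \<odot>\<^bsub>?Q\<^esub> (x \<oplus>\<^bsub>?Q\<^esub> y) = a \<odot>\<^bsub>?Q\<^esub> x \<oplus>\<^bsub>?Q\<^esub> a \<odot>\<^bsub>?Q\<^esub> y"
      using smult_r_distr[of a] by (simp add: cauchy_add)
    show "(a \<otimes>\<^bsub>complex_ring\<^esub> b) \<odot>\<^bsub>?Q\<^esub> x = a \<odot>\<^bsub>?Q\<^esub> (b \<odot>\<^bsub>?Q\<^esub> x)"
      using smult_assoc1[of a b] by simp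
    show "\<one>\<^bsub>complex_ring\<^esub> \<odot>\<^bsub>?Q\<^esub> x = x"
      using smult_one by simp
  qed
  note lim_rules = completion_nrm_tendsto[OF cauchy_mult] completion_nrm_tendsto[OF cauchy_add]
  show ?thesis
  proof
    fix x y c assume xy: "x \<in> carrier ?Q" "y \<in> carrier ?Q"
    then obtain s t where s: "cauchy_in A s" "x = cls s" and t: "cauchy_in A t" "y = cls t"
      by (auto simp: completion_carrier)
    show "(c \<odot>\<^bsub>?Q\<^esub> x) \<otimes>\<^bsub>?Q\<^esub> y = c \<odot>\<^bsub>?Q\<^esub> (x \<otimes>\<^bsub>?Q\<^esub> y)" "x \<otimes>\<^bsub>?Q\<^esub> (c \<odot>\<^bsub>?Q\<^esub> y) = c \<odot>\<^bsub>?Q\<^esub> (x \<otimes>\<^bsub>?Q\<^esub> y)"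
      "star ?Q (x \<oplus>\<^bsub>?Q\<^esub> y) = star ?Q x \<oplus>\<^bsub>?Q\<^esub> star ?Q y"
      "star ?Q (x \<otimes>\<^bsub>?Q\<^esub> y) = star ?Q y \<otimes>\<^bsub>?Q\<^esub> star ?Q x"
      using s t by (simp_all add: completion_simps smult_mult_left smult_mult_right star_add star_mult)
    show "nrm ?Q (x \<oplus>\<^bsub>?Q\<^esub> y) \<le> nrm ?Q x + nrm ?Q y"
      unfolding s t completion_add[OF s(1) t(1)]
      by (rule LIMSEQ_le[OF lim_rules(2)[OF s(1) t(1)] tendsto_add[OF completion_nrm_tendsto[OF s(1)]
            completion_nrm_tendsto[OF t(1)]]])
         (use s t in \<open>auto simp: cauchy_closed nrm_triangle\<close>)
    show "nrm ?Q (x \<otimes>\<^bsub>?Q\<^esub> y) \<le> nrm ?Q x * nrm ?Q y"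
      unfolding s t completion_mult[OF s(1) t(1)]
      by (rule LIMSEQ_le[OF lim_rules(1)[OF s(1) t(1)] tendsto_mult[OF completion_nrm_tendsto[OF s(1)]
            completion_nrm_tendsto[OF t(1)]]])
         (use s t in \<open>auto simp: cauchy_closed nrm_mult\<close>)
  next
    fix x c assume x: "x \<in> carrier ?Q"
    then obtain s where s: "cauchy_in A s" "x = cls s" by (auto simp: completion_carrier)
    show "star ?Q x \<in> carrier ?Q" "star ?Q (star ?Q x) = x"
      "star ?Q (c \<odot>\<^bsub>?Q\<^esub> x) = cnj c \<odot>\<^bsub>?Q\<^esub> star ?Q x"
      using s by (auto simp: completion_simps completion_carrier star_star star_smult)
    show "0 \<le> nrm ?Q x"
      unfolding s by (rule LIMSEQ_le_const[OF completion_nrm_tendsto[OF s(1)]])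
        (use s in \<open>auto simp: cauchy_closed nrm_nonneg\<close>)
    have "(\<lambda>n. nrm A (c \<odot> s n)) \<longlonglongrightarrow> cmod c * nrm ?Q (cls s)"
      using tendsto_mult_left[OF completion_nrm_tendsto[OF s(1)], of "cmod c"] s
      by (simp add: nrm_smult cauchy_closed)
    from LIMSEQ_unique[OF completion_nrm_tendsto[OF cauchy_smult[OF s(1)]] this]
    show "nrm ?Q (c \<odot>\<^bsub>?Q\<^esub> x) = cmod c * nrm ?Q x" using s by (simp add: completion_smult)
    have "(\<lambda>n. nrm A (star A (s n) \<otimes> s n)) \<longlonglongrightarrow> (nrm ?Q (cls s))\<^sup>2"
      using tendsto_power[OF completion_nrm_tendsto[OF s(1)], of 2] s
      by (simp add: cstar_identity cauchy_closed)
    from LIMSEQ_unique[OF completion_nrm_tendsto[OF cauchy_mult[OF cauchy_star[OF s(1)] s(1)]] this]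
    show "nrm ?Q (star ?Q x \<otimes>\<^bsub>?Q\<^esub> x) = (nrm ?Q x)\<^sup>2" using s by (simp add: completion_simps)
  qed
qed

text \<open>
  The canonical map into the completion; it kills the elements of norm zero.
\<close>

definition emb :: "'a \<Rightarrow> (nat \<Rightarrow> 'a) set" where "emb x = cls (\<lambda>_. x)"

lemma emb_closed: "x \<in> carrier A \<Longrightarrow> emb x \<in> carrier (completion A)"
  by (auto simp: emb_def completion_carrier cauchy_const)

lemma emb_simps:
  "x \<in> carrier A \<Longrightarrow> y \<in> carrier A \<Longrightarrow> emb x \<otimes>\<^bsub>completion A\<^esub> emb y = emb (x \<otimes> y)"
  "x \<in> carrier A \<Longrightarrow> y \<in> carrier A \<Longrightarrow> emb x \<oplus>\<^bsub>completion A\<^esub> emb y = emb (x \<oplus> y)"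
  "x \<in> carrier A \<Longrightarrow> c \<odot>\<^bsub>completion A\<^esub> emb x = emb (c \<odot> x)"
  "x \<in> carrier A \<Longrightarrow> star (completion A) (emb x) = emb (star A x)"
  "\<one>\<^bsub>completion A\<^esub> = emb \<one>"
  "\<zero>\<^bsub>completion A\<^esub> = emb \<zero>"
  by (simp_all add: emb_def completion_simps)

lemma emb_nrm: "x \<in> carrier A \<Longrightarrow> nrm (completion A) (emb x) = nrm A x"
  by (simp add: emb_def completion_nrm cauchy_const)

lemma completion_minus:
  assumes s: "cauchy_in A s" and t: "cauchy_in A t"
  shows "cls s \<ominus>\<^bsub>completion A\<^esub> cls t = cls (\<lambda>n. s n \<ominus> t n)"
proof -
  interpret Q: pre_cstar_algebra "completion A" by (rule completion_pre_cstar)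
  have "cls t \<in> carrier (completion A)" using t by (auto simp: completion_carrier)
  hence "cls s \<ominus>\<^bsub>completion A\<^esub> cls t = cls (\<lambda>n. s n \<oplus> (-1) \<odot> t n)"
    using s t by (simp add: Q.minus_eq Q.a_inv_smult completion_simps)
  thus ?thesis using t by (simp add: minus_eq a_inv_smult cauchy_closed)
qed

lemma emb_minus:
  "x \<in> carrier A \<Longrightarrow> y \<in> carrier A \<Longrightarrow> emb x \<ominus>\<^bsub>completion A\<^esub> emb y = emb (x \<ominus> y)"
  by (simp add: emb_def completion_minus cauchy_const)

lemma cls_emb_close:
  assumes s: "cauchy_in A s" and e: "0 \<le> e" and N: "\<And>n. n \<ge> N \<Longrightarrow> nrm A (s n \<ominus> x) \<le> e"
    and x: "x \<in> carrier A"
  shows "nrm (completion A) (cls s \<ominus>\<^bsub>completion A\<^esub> emb x) \<le> e"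
proof -
  have c: "cauchy_in A (\<lambda>n. s n \<ominus> x)"
    using cauchy_add[OF s cauchy_const[of "\<ominus> x"]] x by (simp add: minus_eq)
  show ?thesis unfolding emb_def completion_minus[OF s cauchy_const[OF x]]
    by (rule LIMSEQ_le_const2[OF completion_nrm_tendsto[OF c]]) (use N in blast)
qed

text \<open>
  A Cauchy sequence is approximated by its own late terms.
\<close>

lemma emb_dense:
  assumes b: "b \<in> carrier (completion A)" and e: "0 < e"
  shows "\<exists>x\<in>carrier A. nrm (completion A) (b \<ominus>\<^bsub>completion A\<^esub> emb x) < e"
proof -
  obtain s where s: "cauchy_in A s" "b = cls s" using b by (auto simp: completion_carrier)
  have "0 < e/2" using e by simp
  then obtain N where N: "\<And>m n. m \<ge> N \<Longrightarrow> n \<ge> N \<Longrightarrow> nrm A (s m \<ominus> s n) < e/2"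
    using s(1) unfolding cauchy_in_def by blast
  have "nrm (completion A) (cls s \<ominus>\<^bsub>completion A\<^esub> emb (s N)) \<le> e/2"
  proof (rule cls_emb_close[OF s(1)])
    show "nrm A (s n \<ominus> s N) \<le> e/2" if "n \<ge> N" for n using N[OF that, of N] by simp
  qed (use e s in \<open>simp_all add: cauchy_closed\<close>)
  thus ?thesis using e s cauchy_closed[OF s(1), of N] by (intro bexI[of _ "s N"]) auto
qed

text \<open>
  Definiteness: a class of norm zero consists of null sequences.  Completeness: a Cauchy sequence of
  classes is replaced by elements \<open>a k\<close> of \<open>A\<close> with the \<open>k\<close>-th class within \<open>1 / (k + 1)\<close> of \<open>emb (a k)\<close>;
  then \<open>a\<close> is a Cauchy sequence and its class is the limit.
\<close>

theorem completion_unital_cstar: "unital_cstar_algebra (completion A)"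
  unfolding unital_cstar_algebra_iff
proof (intro conjI ballI allI impI completion_pre_cstar)
  let ?Q = "completion A"
  fix x assume "x \<in> carrier ?Q" and n: "nrm ?Q x = 0"
  then obtain s where s: "cauchy_in A s" "x = cls s" by (auto simp: completion_carrier)
  show "x = \<zero>\<^bsub>?Q\<^esub>"
    using completion_nrm_tendsto[OF s(1)] s n
    by (simp add: completion_zero cls_eq_iff cauchy_const minus_zero_right cauchy_closed)
next
  let ?Q = "completion A"
  interpret Q: pre_cstar_algebra "?Q" by (rule completion_pre_cstar)
  fix P assume P: "cauchy_in ?Q P"
  have Pc [simp]: "P k \<in> carrier ?Q" for k using P by (simp add: cauchy_in_def)
  \<comment> \<open>The \<open>k\<close>-th approximating element.  Distances between these elements agree with distances in the completion.\<close>
  define a where "a k = (SOME x. x \<in> carrier A \<and> nrm ?Q (P k \<ominus>\<^bsub>?Q\<^esub> emb x) < inverse (real (Suc k)))" for k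
  have a: "a k \<in> carrier A \<and> nrm ?Q (P k \<ominus>\<^bsub>?Q\<^esub> emb (a k)) < inverse (real (Suc k))" for k
    unfolding a_def
  proof (rule someI_ex)
    have "0 < inverse (real (Suc k))" by simp
    from emb_dense[OF Pc[of k] this]
    show "\<exists>x. x \<in> carrier A \<and> nrm ?Q (P k \<ominus>\<^bsub>?Q\<^esub> emb x) < inverse (real (Suc k))" by blast
  qed
  hence ac [simp]: "a k \<in> carrier A" and al: "nrm ?Q (P k \<ominus>\<^bsub>?Q\<^esub> emb (a k)) < inverse (real (Suc k))" for k
    by auto
  have ec: "emb (a k) \<in> carrier ?Q" for k by (simp add: emb_closed)
  have ad: "nrm A (a k \<ominus> a l) \<le> inverse (real (Suc k)) + nrm ?Q (P k \<ominus>\<^bsub>?Q\<^esub> P l) + inverse (real (Suc l))" for k l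
  proof -
    have "nrm A (a k \<ominus> a l) = nrm ?Q (emb (a k) \<ominus>\<^bsub>?Q\<^esub> emb (a l))" by (simp add: emb_nrm emb_minus)
    also have "\<dots> \<le> nrm ?Q (emb (a k) \<ominus>\<^bsub>?Q\<^esub> P k) + (nrm ?Q (P k \<ominus>\<^bsub>?Q\<^esub> P l) + nrm ?Q (P l \<ominus>\<^bsub>?Q\<^esub> emb (a l)))"
      using Q.nrm_minus_triangle[OF ec[of k] Pc[of k] ec[of l]]
        Q.nrm_minus_triangle[OF Pc[of k] Pc[of l] ec[of l]] by linarith
    also have "\<dots> \<le> inverse (real (Suc k)) + nrm ?Q (P k \<ominus>\<^bsub>?Q\<^esub> P l) + inverse (real (Suc l))"
      using al[of k] al[of l] Q.nrm_minus_commute[OF ec[of k] Pc[of k]] by linarith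
    finally show ?thesis .
  qed
  have small: "\<exists>N. \<forall>n\<ge>N. inverse (real (Suc n)) < e" if "e > 0" for e :: real
    using order_tendstoD(2)[OF LIMSEQ_inverse_real_of_nat that] by (simp add: eventually_sequentially)
  have ca: "cauchy_in A a"
    unfolding cauchy_in_def
  proof (intro conjI allI impI ac)
    fix e :: real assume "0 < e"
    hence e: "0 < e/3" by simp
    obtain N where N: "\<And>n. n \<ge> N \<Longrightarrow> inverse (real (Suc n)) < e/3"
      using small[OF e] by blast
    obtain M where M: "\<And>m n. m \<ge> M \<Longrightarrow> n \<ge> M \<Longrightarrow> nrm ?Q (P m \<ominus>\<^bsub>?Q\<^esub> P n) < e/3"
      using Q.cauchyD[OF P e] by blast
    have "nrm A (a m \<ominus> a n) < e" if "m \<ge> max N M" "n \<ge> max N M" for m n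
      using ad[of m n] N[of m] N[of n] M[of m n] that by linarith
    thus "\<exists>N. \<forall>m\<ge>N. \<forall>n\<ge>N. nrm A (a m \<ominus> a n) < e" by blast
  qed
  have clsa: "cls a \<in> carrier ?Q" using ca by (auto simp: completion_carrier)
  show "\<exists>x\<in>carrier ?Q. tends_to_in ?Q P x"
  proof (intro bexI[OF _ clsa])
    show "tends_to_in ?Q P (cls a)"
      unfolding tends_to_in_def LIMSEQ_iff
    proof (intro allI impI)
      fix e :: real assume "0 < e"
      hence e: "0 < e/2" by simp
      obtain N where N: "\<And>n. n \<ge> N \<Longrightarrow> inverse (real (Suc n)) < e/2"
        using small[OF e] by blast
      obtain M where M: "\<And>m n. m \<ge> M \<Longrightarrow> n \<ge> M \<Longrightarrow> nrm A (a m \<ominus> a n) < e/2"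
        using cauchyD[OF ca e] by blast
      have "nrm ?Q (P k \<ominus>\<^bsub>?Q\<^esub> cls a) < e" if k: "k \<ge> max N M" for k
      proof -
        have "nrm ?Q (cls a \<ominus>\<^bsub>?Q\<^esub> emb (a k)) \<le> e/2"
        proof (rule cls_emb_close[OF ca])
          show "nrm A (a n \<ominus> a k) \<le> e/2" if "n \<ge> M" for n using M[OF that, of k] k by simp
        qed (use e in simp_all)
        thus ?thesis
          using Q.nrm_minus_triangle[OF Pc[of k] ec[of k] clsa] al[of k] N[of k] k
            Q.nrm_minus_commute[OF ec[of k] clsa] by linarith
      qed
      thus "\<exists>no. \<forall>n\<ge>no. norm (nrm ?Q (P n \<ominus>\<^bsub>?Q\<^esub> cls a) - 0) < e"
        using Q.nrm_nonneg clsa by (intro exI[of _ "max N M"]) simp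
    qed
  qed
qed

end

section \<open>Square-summable functions\<close>

lemma ell2_norm_nonneg [simp]: "0 \<le> ell2_norm X \<psi>"
  by (simp add: ell2_norm_def infsum_nonneg)

lemma ell2_norm_power2: "(ell2_norm X \<psi>)\<^sup>2 = (\<Sum>\<^sub>\<infinity>x\<in>X. (cmod (\<psi> x))\<^sup>2)"
  by (simp add: ell2_norm_def infsum_nonneg)

lemma ell2_summable: "\<psi> \<in> ell2 X \<Longrightarrow> (\<lambda>x. (cmod (\<psi> x))\<^sup>2) summable_on X"
  by (simp add: ell2_def)

lemma ell2_zero [simp]: "(\<lambda>x. 0) \<in> ell2 X"
  by (simp add: ell2_def)

lemma ell2_norm_zero [simp]: "ell2_norm X (\<lambda>x. 0) = 0"
  by (simp add: ell2_norm_def)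

lemma L2_set_le_ell2_norm:
  assumes "\<psi> \<in> ell2 X" "finite F" "F \<subseteq> X"
  shows "L2_set (\<lambda>x. cmod (\<psi> x)) F \<le> ell2_norm X \<psi>"
  unfolding L2_set_def ell2_norm_def
  using finite_sum_le_infsum[OF ell2_summable[OF assms(1)] assms(2,3)] by simp

text \<open>
  Square summability and norm bounds are tested on finite sets.  In this way the triangle inequality
  and the Cauchy-Schwarz inequality reduce to their finite versions.
\<close>

lemma ell2I_L2_set:
  assumes z: "\<And>x. x \<notin> X \<Longrightarrow> \<psi> x = 0" and c: "0 \<le> c"
    and le: "\<And>F. finite F \<Longrightarrow> F \<subseteq> X \<Longrightarrow> L2_set (\<lambda>x. cmod (\<psi> x)) F \<le> c"
  shows "\<psi> \<in> ell2 X" and "ell2_norm X \<psi> \<le> c"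
proof -
  have le': "(\<Sum>x\<in>F. (cmod (\<psi> x))\<^sup>2) \<le> c\<^sup>2" if "finite F" "F \<subseteq> X" for F
    using power_mono[OF le[OF that], of 2] by (simp add: L2_set_def sum_nonneg)
  have s: "(\<lambda>x. (cmod (\<psi> x))\<^sup>2) summable_on X"
    by (rule nonneg_bdd_above_summable_on) (use le' in \<open>auto intro!: bdd_aboveI[of _ "c\<^sup>2"]\<close>)
  thus "\<psi> \<in> ell2 X" using z by (simp add: ell2_def)
  have "(\<Sum>\<^sub>\<infinity>x\<in>X. (cmod (\<psi> x))\<^sup>2) \<le> c\<^sup>2"
    by (rule infsum_le_finite_sums[OF s]) (use le' in auto)
  hence "(ell2_norm X \<psi>)\<^sup>2 \<le> c\<^sup>2" by (simp add: ell2_norm_power2)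
  thus "ell2_norm X \<psi> \<le> c" using c by (rule power2_le_imp_le)
qed

lemma
  assumes "\<phi> \<in> ell2 X" "\<psi> \<in> ell2 X"
  shows ell2_add: "(\<lambda>x. \<phi> x + \<psi> x) \<in> ell2 X"
    and ell2_norm_triangle: "ell2_norm X (\<lambda>x. \<phi> x + \<psi> x) \<le> ell2_norm X \<phi> + ell2_norm X \<psi>"
proof -
  have "L2_set (\<lambda>x. cmod (\<phi> x + \<psi> x)) F \<le> ell2_norm X \<phi> + ell2_norm X \<psi>"
    if F: "finite F" "F \<subseteq> X" for F
  proof -
    have "L2_set (\<lambda>x. cmod (\<phi> x + \<psi> x)) F \<le> L2_set (\<lambda>x. cmod (\<phi> x) + cmod (\<psi> x)) F"
      by (rule L2_set_mono) (auto simp: norm_triangle_ineq)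
    also have "\<dots> \<le> L2_set (\<lambda>x. cmod (\<phi> x)) F + L2_set (\<lambda>x. cmod (\<psi> x)) F"
      by (rule L2_set_triangle_ineq)
    also have "\<dots> \<le> ell2_norm X \<phi> + ell2_norm X \<psi>"
      using F assms by (intro add_mono L2_set_le_ell2_norm)
    finally show ?thesis .
  qed
  moreover have "\<phi> x + \<psi> x = 0" if "x \<notin> X" for x using that assms by (simp add: ell2_def)
  ultimately show "(\<lambda>x. \<phi> x + \<psi> x) \<in> ell2 X"
    "ell2_norm X (\<lambda>x. \<phi> x + \<psi> x) \<le> ell2_norm X \<phi> + ell2_norm X \<psi>"
    using ell2I_L2_set[of X "\<lambda>x. \<phi> x + \<psi> x" "ell2_norm X \<phi> + ell2_norm X \<psi>"] by simp_all
qed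

lemma
  assumes "\<psi> \<in> ell2 X"
  shows ell2_scale: "(\<lambda>x. c * \<psi> x) \<in> ell2 X"
    and ell2_norm_scale: "ell2_norm X (\<lambda>x. c * \<psi> x) = cmod c * ell2_norm X \<psi>"
proof -
  show "(\<lambda>x. c * \<psi> x) \<in> ell2 X"
    using assms by (auto simp: ell2_def norm_mult power_mult_distrib intro!: summable_on_cmult_right)
  have "(\<Sum>\<^sub>\<infinity>x\<in>X. (cmod (c * \<psi> x))\<^sup>2) = (cmod c)\<^sup>2 * (\<Sum>\<^sub>\<infinity>x\<in>X. (cmod (\<psi> x))\<^sup>2)"
    unfolding norm_mult power_mult_distrib by (rule infsum_cmult_right) (use assms in \<open>simp add: ell2_def\<close>)
  thus "ell2_norm X (\<lambda>x. c * \<psi> x) = cmod c * ell2_norm X \<psi>"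
    by (simp add: ell2_norm_def real_sqrt_mult)
qed

lemma ell2_sum:
  assumes "finite S" "\<And>i. i \<in> S \<Longrightarrow> f i \<in> ell2 X"
  shows "(\<lambda>x. \<Sum>i\<in>S. c i * f i x) \<in> ell2 X \<and>
    ell2_norm X (\<lambda>x. \<Sum>i\<in>S. c i * f i x) \<le> (\<Sum>i\<in>S. cmod (c i) * ell2_norm X (f i))"
  using assms
proof (induction rule: finite_induct)
  case (insert i S)
  hence i: "f i \<in> ell2 X" and IH: "(\<lambda>x. \<Sum>i\<in>S. c i * f i x) \<in> ell2 X"
    "ell2_norm X (\<lambda>x. \<Sum>i\<in>S. c i * f i x) \<le> (\<Sum>i\<in>S. cmod (c i) * ell2_norm X (f i))" by auto
  note ci = ell2_scale[OF i, of "c i"] ell2_norm_scale[OF i, of "c i"]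
  show ?case using insert.hyps ell2_add[OF ci(1) IH(1)] ell2_norm_triangle[OF ci(1) IH(1)] IH(2) ci(2)
    by simp
qed simp

lemma ell2_inner_summable:
  assumes "\<phi> \<in> ell2 X" "\<psi> \<in> ell2 X"
  shows "(\<lambda>x. norm (cnj (\<phi> x) * \<psi> x)) summable_on X" and "(\<lambda>x. cnj (\<phi> x) * \<psi> x) summable_on X"
proof -
  show "(\<lambda>x. norm (cnj (\<phi> x) * \<psi> x)) summable_on X"
    by (rule abs_summable_product) (use assms in \<open>simp_all add: ell2_def norm_mult power2_eq_square\<close>)
  thus "(\<lambda>x. cnj (\<phi> x) * \<psi> x) summable_on X" by (rule abs_summable_summable)
qed

lemma ell2_Cauchy_Schwarz:
  assumes "\<phi> \<in> ell2 X" "\<psi> \<in> ell2 X"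
  shows "cmod (ell2_inner X \<phi> \<psi>) \<le> ell2_norm X \<phi> * ell2_norm X \<psi>"
proof -
  have "cmod (ell2_inner X \<phi> \<psi>) \<le> (\<Sum>\<^sub>\<infinity>x\<in>X. norm (cnj (\<phi> x) * \<psi> x))"
    unfolding ell2_inner_def by (rule norm_infsum_bound[OF ell2_inner_summable(1)[OF assms]])
  also have "\<dots> \<le> ell2_norm X \<phi> * ell2_norm X \<psi>"
  proof (rule infsum_le_finite_sums[OF ell2_inner_summable(1)[OF assms]])
    fix F assume F: "finite F" "F \<subseteq> X"
    have "(\<Sum>x\<in>F. norm (cnj (\<phi> x) * \<psi> x)) \<le> L2_set (\<lambda>x. cmod (\<phi> x)) F * L2_set (\<lambda>x. cmod (\<psi> x)) F"
      using L2_set_mult_ineq[of "\<lambda>x. cmod (\<phi> x)" "\<lambda>x. cmod (\<psi> x)" F] by (simp add: norm_mult)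
    also have "\<dots> \<le> ell2_norm X \<phi> * ell2_norm X \<psi>"
      using F assms by (intro mult_mono L2_set_le_ell2_norm) auto
    finally show "(\<Sum>x\<in>F. norm (cnj (\<phi> x) * \<psi> x)) \<le> ell2_norm X \<phi> * ell2_norm X \<psi>" .
  qed
  finally show ?thesis .
qed

lemma ell2_inner_self:
  assumes "\<psi> \<in> ell2 X" shows "ell2_inner X \<psi> \<psi> = of_real ((ell2_norm X \<psi>)\<^sup>2)"
proof -
  have "((\<lambda>x. (cmod (\<psi> x))\<^sup>2) has_sum (ell2_norm X \<psi>)\<^sup>2) X"
    unfolding ell2_norm_power2 using ell2_summable[OF assms] by simp
  hence "((\<lambda>x. of_real ((cmod (\<psi> x))\<^sup>2)) has_sum complex_of_real ((ell2_norm X \<psi>)\<^sup>2)) X"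
    by (rule has_sum_of_real)
  hence "((\<lambda>x. cnj (\<psi> x) * \<psi> x) has_sum complex_of_real ((ell2_norm X \<psi>)\<^sup>2)) X"
    unfolding complex_norm_square by (simp add: mult.commute)
  thus ?thesis unfolding ell2_inner_def by (rule infsumI)
qed

lemma infsum_finite_sum:
  fixes f :: "'i \<Rightarrow> 'x \<Rightarrow> 'a :: real_normed_vector"
  assumes "finite S" "\<And>i. i \<in> S \<Longrightarrow> f i summable_on X"
  shows "(\<lambda>x. \<Sum>i\<in>S. f i x) summable_on X \<and> (\<Sum>\<^sub>\<infinity>x\<in>X. \<Sum>i\<in>S. f i x) = (\<Sum>i\<in>S. \<Sum>\<^sub>\<infinity>x\<in>X. f i x)"
  using assms by (induction rule: finite_induct) (simp_all add: summable_on_add infsum_add)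

lemma ell2_inner_sum_right:
  assumes "\<phi> \<in> ell2 X" "finite S" "\<And>i. i \<in> S \<Longrightarrow> f i \<in> ell2 X"
  shows "ell2_inner X \<phi> (\<lambda>x. \<Sum>i\<in>S. c i * f i x) = (\<Sum>i\<in>S. c i * ell2_inner X \<phi> (f i))"
proof -
  have "ell2_inner X \<phi> (\<lambda>x. \<Sum>i\<in>S. c i * f i x) = (\<Sum>\<^sub>\<infinity>x\<in>X. \<Sum>i\<in>S. c i * (cnj (\<phi> x) * f i x))"
    unfolding ell2_inner_def by (intro infsum_cong) (simp add: sum_distrib_left algebra_simps)
  also have "\<dots> = (\<Sum>i\<in>S. \<Sum>\<^sub>\<infinity>x\<in>X. c i * (cnj (\<phi> x) * f i x))"
    using assms by (intro infsum_finite_sum[THEN conjunct2] summable_on_cmult_right ell2_inner_summable) auto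
  also have "\<dots> = (\<Sum>i\<in>S. c i * ell2_inner X \<phi> (f i))"
    unfolding ell2_inner_def using assms
    by (intro sum.cong refl infsum_cmult_right ell2_inner_summable) auto
  finally show ?thesis .
qed

lemma ell2_inner_cnj: "ell2_inner X \<phi> \<psi> = cnj (ell2_inner X \<psi> \<phi>)"
  unfolding ell2_inner_def infsum_cnj[symmetric] by (rule infsum_cong) (simp add: mult.commute)

lemma ell2_inner_sum_left:
  assumes "\<phi> \<in> ell2 X" "finite S" "\<And>i. i \<in> S \<Longrightarrow> f i \<in> ell2 X"
  shows "ell2_inner X (\<lambda>x. \<Sum>i\<in>S. c i * f i x) \<phi> = (\<Sum>i\<in>S. cnj (c i) * ell2_inner X (f i) \<phi>)"
  by (subst ell2_inner_cnj, subst ell2_inner_sum_right[OF assms])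
     (simp_all add: ell2_inner_cnj[of X \<phi>])

section \<open>The complex group algebra\<close>

abbreviation supp :: "('g \<Rightarrow> complex) \<Rightarrow> 'g set" where "supp f \<equiv> {g. f g \<noteq> 0}"

context group
begin

abbreviation CG ("\<C>") where "CG \<equiv> group_algebra G"

lemma group_algebra_carrier: "f \<in> carrier \<C> \<longleftrightarrow> finite (supp f) \<and> supp f \<subseteq> carrier G"
  by (simp add: group_algebra_def)

lemma group_algebra_outside: "f \<in> carrier \<C> \<Longrightarrow> x \<notin> carrier G \<Longrightarrow> f x = 0"
  by (auto simp: group_algebra_carrier)

text \<open>
  A convolution may be expanded over any finite set containing the support of the left factor.  This
  allows different products to be compared over a common index set.
\<close>

lemma group_algebra_mult:
  assumes "finite S" "supp f \<subseteq> S" "x \<in> carrier G"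
  shows "(f \<otimes>\<^bsub>\<C>\<^esub> h) x = (\<Sum>y\<in>S. f y * h (inv y \<otimes> x))"
  using assms by (simp add: group_algebra_def) (rule sum.mono_neutral_left, auto)

lemma group_algebra_mult_outside: "x \<notin> carrier G \<Longrightarrow> (f \<otimes>\<^bsub>\<C>\<^esub> h) x = 0"
  by (simp add: group_algebra_def)

lemma group_algebra_simps:
  "(f \<oplus>\<^bsub>\<C>\<^esub> h) x = f x + h x" "\<zero>\<^bsub>\<C>\<^esub> = (\<lambda>_. 0)" "(c \<odot>\<^bsub>\<C>\<^esub> f) x = c * f x"
  "\<one>\<^bsub>\<C>\<^esub> = (\<lambda>x. if x = \<one> then 1 else 0)"
  "star \<C> f x = (if x \<in> carrier G then cnj (f (inv x)) else 0)" "nrm \<C> = full_norm G"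
  by (simp_all add: group_algebra_def)

lemma supp_mult:
  assumes f: "f \<in> carrier \<C>"
  shows "supp (f \<otimes>\<^bsub>\<C>\<^esub> h) \<subseteq> (\<lambda>(y, z). y \<otimes> z) ` (supp f \<times> supp h)"
proof
  fix x assume x: "x \<in> supp (f \<otimes>\<^bsub>\<C>\<^esub> h)"
  hence xG: "x \<in> carrier G" by (auto intro: ccontr simp: group_algebra_mult_outside)
  have "(\<Sum>y\<in>supp f. f y * h (inv y \<otimes> x)) \<noteq> 0"
    using x xG f group_algebra_mult[of "supp f" f x h] by (simp add: group_algebra_carrier)
  then obtain y where y: "y \<in> supp f" "f y * h (inv y \<otimes> x) \<noteq> 0" by (meson sum.not_neutral_contains_not_neutral)
  have "y \<in> carrier G" using y f by (auto simp: group_algebra_carrier)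
  hence "x = y \<otimes> (inv y \<otimes> x)" using xG by (simp add: m_assoc[symmetric])
  thus "x \<in> (\<lambda>(y, z). y \<otimes> z) ` (supp f \<times> supp h)" using y by (auto intro!: image_eqI[of _ _ "(y, inv y \<otimes> x)"])
qed

lemma group_algebra_mult_closed:
  assumes "f \<in> carrier \<C>" "h \<in> carrier \<C>" shows "f \<otimes>\<^bsub>\<C>\<^esub> h \<in> carrier \<C>"
proof -
  have "finite ((\<lambda>(y, z). y \<otimes> z) ` (supp f \<times> supp h))" using assms by (simp add: group_algebra_carrier)
  hence "finite (supp (f \<otimes>\<^bsub>\<C>\<^esub> h))" using supp_mult[OF assms(1)] by (rule rev_finite_subset)
  thus ?thesis by (auto simp: group_algebra_carrier group_algebra_mult_outside intro: ccontr)
qed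

lemma group_algebra_add_closed:
  assumes "f \<in> carrier \<C>" "h \<in> carrier \<C>" shows "f \<oplus>\<^bsub>\<C>\<^esub> h \<in> carrier \<C>"
proof -
  have "supp (f \<oplus>\<^bsub>\<C>\<^esub> h) \<subseteq> supp f \<union> supp h" by (auto simp: group_algebra_simps)
  thus ?thesis using assms by (auto simp: group_algebra_carrier intro: finite_subset)
qed

lemma group_algebra_smult_closed:
  assumes "f \<in> carrier \<C>" shows "c \<odot>\<^bsub>\<C>\<^esub> f \<in> carrier \<C>"
proof -
  have "supp (c \<odot>\<^bsub>\<C>\<^esub> f) \<subseteq> supp f" by (auto simp: group_algebra_simps)
  thus ?thesis using assms by (auto simp: group_algebra_carrier intro: finite_subset)
qed

lemma group_algebra_star_closed:
  assumes "f \<in> carrier \<C>" shows "star \<C> f \<in> carrier \<C>"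
proof -
  have "supp (star \<C> f) \<subseteq> (\<lambda>x. inv x) ` supp f"
  proof
    fix x assume x: "x \<in> supp (star \<C> f)"
    hence xG: "x \<in> carrier G" and "f (inv x) \<noteq> 0" by (auto simp: group_algebra_simps split: if_splits)
    moreover have "x = inv (inv x)" using xG by simp
    ultimately show "x \<in> (\<lambda>x. inv x) ` supp f" by blast
  qed
  moreover have "finite ((\<lambda>x. inv x) ` supp f)" using assms by (simp add: group_algebra_carrier)
  ultimately have "finite (supp (star \<C> f))" by (rule finite_subset)
  thus ?thesis by (auto simp: group_algebra_carrier group_algebra_simps)
qed

lemma inj_on_mult_left: "y \<in> carrier G \<Longrightarrow> S \<subseteq> carrier G \<Longrightarrow> inj_on (\<lambda>w. y \<otimes> w) S"
  by (rule inj_on_subset[OF inj_on_cmult])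

text \<open>
  Both sides are expanded over \<open>y\<close> in the support of \<open>f\<close>.  On the left the second index \<open>z\<close> ranges over
  products; for fixed \<open>y\<close> only the \<open>z = y w\<close> with \<open>w\<close> in the support of \<open>h\<close> contribute.
\<close>

lemma group_algebra_mult_assoc:
  assumes f: "f \<in> carrier \<C>" and h: "h \<in> carrier \<C>" and k: "k \<in> carrier \<C>"
  shows "(f \<otimes>\<^bsub>\<C>\<^esub> h) \<otimes>\<^bsub>\<C>\<^esub> k = f \<otimes>\<^bsub>\<C>\<^esub> (h \<otimes>\<^bsub>\<C>\<^esub> k)"
proof
  fix x
  let ?P = "(\<lambda>(y, z). y \<otimes> z) ` (supp f \<times> supp h)"
  have fin: "finite (supp f)" "finite (supp h)" "supp f \<subseteq> carrier G" "supp h \<subseteq> carrier G"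
    using f h by (auto simp: group_algebra_carrier)
  have finP: "finite ?P" using fin by simp
  show "((f \<otimes>\<^bsub>\<C>\<^esub> h) \<otimes>\<^bsub>\<C>\<^esub> k) x = (f \<otimes>\<^bsub>\<C>\<^esub> (h \<otimes>\<^bsub>\<C>\<^esub> k)) x"
  proof (cases "x \<in> carrier G")
    case x: True
    have P: "z \<in> carrier G" if "z \<in> ?P" for z using that fin by auto
    have "((f \<otimes>\<^bsub>\<C>\<^esub> h) \<otimes>\<^bsub>\<C>\<^esub> k) x = (\<Sum>z\<in>?P. (f \<otimes>\<^bsub>\<C>\<^esub> h) z * k (inv z \<otimes> x))"
      by (rule group_algebra_mult[OF finP supp_mult[OF f] x])
    also have "\<dots> = (\<Sum>z\<in>?P. \<Sum>y\<in>supp f. f y * h (inv y \<otimes> z) * k (inv z \<otimes> x))"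
      using P by (intro sum.cong refl) (simp add: group_algebra_mult[OF fin(1) order_refl] sum_distrib_right)
    also have "\<dots> = (\<Sum>y\<in>supp f. \<Sum>z\<in>?P. f y * h (inv y \<otimes> z) * k (inv z \<otimes> x))"
      by (rule sum.swap)
    also have "\<dots> = (\<Sum>y\<in>supp f. f y * (h \<otimes>\<^bsub>\<C>\<^esub> k) (inv y \<otimes> x))"
    proof (rule sum.cong[OF refl])
      fix y assume y: "y \<in> supp f"
      hence yG: "y \<in> carrier G" using fin by auto
      have "(\<Sum>z\<in>?P. f y * h (inv y \<otimes> z) * k (inv z \<otimes> x))
          = (\<Sum>z\<in>(\<lambda>w. y \<otimes> w) ` supp h. f y * h (inv y \<otimes> z) * k (inv z \<otimes> x))"
      proof (rule sum.mono_neutral_right[OF finP])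
        show "\<forall>z\<in>?P - (\<lambda>w. y \<otimes> w) ` supp h. f y * h (inv y \<otimes> z) * k (inv z \<otimes> x) = 0"
        proof
          fix z assume z: "z \<in> ?P - (\<lambda>w. y \<otimes> w) ` supp h"
          have "z = y \<otimes> (inv y \<otimes> z)" using P[of z] z yG by (simp add: m_assoc[symmetric])
          hence "h (inv y \<otimes> z) = 0" using z by blast
          thus "f y * h (inv y \<otimes> z) * k (inv z \<otimes> x) = 0" by simp
        qed
      qed (use y in auto)
      also have "\<dots> = (\<Sum>w\<in>supp h. f y * h (inv y \<otimes> (y \<otimes> w)) * k (inv (y \<otimes> w) \<otimes> x))"
        by (subst sum.reindex[OF inj_on_mult_left[OF yG fin(4)]]) simp
      also have "\<dots> = (\<Sum>w\<in>supp h. f y * (h w * k (inv w \<otimes> (inv y \<otimes> x))))"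
        using fin yG x by (intro sum.cong refl) (auto simp: subset_iff m_assoc[symmetric] inv_mult_group)
      also have "\<dots> = f y * (h \<otimes>\<^bsub>\<C>\<^esub> k) (inv y \<otimes> x)"
        using yG x by (simp add: group_algebra_mult[OF fin(2) order_refl] sum_distrib_left)
      finally show "(\<Sum>z\<in>?P. f y * h (inv y \<otimes> z) * k (inv z \<otimes> x)) = f y * (h \<otimes>\<^bsub>\<C>\<^esub> k) (inv y \<otimes> x)" .
    qed
    also have "\<dots> = (f \<otimes>\<^bsub>\<C>\<^esub> (h \<otimes>\<^bsub>\<C>\<^esub> k)) x" by (rule group_algebra_mult[OF fin(1) order_refl x, symmetric])
    finally show ?thesis .
  qed (simp add: group_algebra_mult_outside)
qed

lemma group_algebra_ring: "ring \<C>"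
proof (rule ringI)
  show "abelian_group \<C>"
  proof (rule abelian_groupI)
    fix f assume "f \<in> carrier \<C>"
    thus "\<exists>h\<in>carrier \<C>. h \<oplus>\<^bsub>\<C>\<^esub> f = \<zero>\<^bsub>\<C>\<^esub>"
      by (intro bexI[OF _ group_algebra_smult_closed[of f "-1"]]) (auto simp: group_algebra_simps)
  qed (simp_all add: group_algebra_add_closed, simp_all add: group_algebra_simps group_algebra_carrier fun_eq_iff)
  show "monoid \<C>"
  proof (rule monoidI)
    show "\<one>\<^bsub>\<C>\<^esub> \<in> carrier \<C>" by (auto simp: group_algebra_simps group_algebra_carrier)
    fix f assume f: "f \<in> carrier \<C>"
    show "\<one>\<^bsub>\<C>\<^esub> \<otimes>\<^bsub>\<C>\<^esub> f = f"
    proof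
      fix x show "(\<one>\<^bsub>\<C>\<^esub> \<otimes>\<^bsub>\<C>\<^esub> f) x = f x"
        by (cases "x \<in> carrier G")
           (use f in \<open>auto simp: group_algebra_mult[of "{\<one>}"] group_algebra_simps group_algebra_mult_outside group_algebra_outside\<close>)
    qed
    show "f \<otimes>\<^bsub>\<C>\<^esub> \<one>\<^bsub>\<C>\<^esub> = f"
    proof
      fix x
      have fin: "finite (insert x (supp f))" using f by (simp add: group_algebra_carrier)
      show "(f \<otimes>\<^bsub>\<C>\<^esub> \<one>\<^bsub>\<C>\<^esub>) x = f x"
      proof (cases "x \<in> carrier G")
        case True
        have "f y * \<one>\<^bsub>\<C>\<^esub> (inv y \<otimes> x) = (if y = x then f x else 0)" if "y \<in> insert x (supp f)" for y
        proof -
          have y: "y \<in> carrier G" using that f True by (auto simp: group_algebra_carrier)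
          have "inv y \<otimes> x = \<one> \<longleftrightarrow> y = x"
            using inv_solve_left[of \<one> y x] y True by auto
          thus ?thesis by (simp add: group_algebra_simps)
        qed
        hence "(f \<otimes>\<^bsub>\<C>\<^esub> \<one>\<^bsub>\<C>\<^esub>) x = (\<Sum>y\<in>insert x (supp f). if y = x then f x else 0)"
          unfolding group_algebra_mult[OF fin subset_insertI True] by (rule sum.cong[OF refl])
        also have "\<dots> = f x" using fin by (simp only: sum.delta) simp
        finally show ?thesis .
      qed (use f in \<open>simp add: group_algebra_mult_outside group_algebra_outside\<close>)
    qed
  qed (simp_all add: group_algebra_mult_closed group_algebra_mult_assoc)
next
  fix f h k assume fhk: "f \<in> carrier \<C>" "h \<in> carrier \<C>" "k \<in> carrier \<C>"
  show "(f \<oplus>\<^bsub>\<C>\<^esub> h) \<otimes>\<^bsub>\<C>\<^esub> k = f \<otimes>\<^bsub>\<C>\<^esub> k \<oplus>\<^bsub>\<C>\<^esub> h \<otimes>\<^bsub>\<C>\<^esub> k"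
  proof
    fix x
    have fin: "finite (supp f \<union> supp h)" using fhk by (simp add: group_algebra_carrier)
    show "((f \<oplus>\<^bsub>\<C>\<^esub> h) \<otimes>\<^bsub>\<C>\<^esub> k) x = (f \<otimes>\<^bsub>\<C>\<^esub> k \<oplus>\<^bsub>\<C>\<^esub> h \<otimes>\<^bsub>\<C>\<^esub> k) x"
    proof (cases "x \<in> carrier G")
      case True
      have "((f \<oplus>\<^bsub>\<C>\<^esub> h) \<otimes>\<^bsub>\<C>\<^esub> k) x = (\<Sum>y\<in>supp f \<union> supp h. (f \<oplus>\<^bsub>\<C>\<^esub> h) y * k (inv y \<otimes> x))"
        by (rule group_algebra_mult[OF fin _ True]) (auto simp: group_algebra_simps)
      thus ?thesis
        by (simp add: group_algebra_mult[OF fin _ True] group_algebra_simps sum.distrib distrib_right)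
    qed (simp add: group_algebra_simps group_algebra_mult_outside)
  qed
  show "k \<otimes>\<^bsub>\<C>\<^esub> (f \<oplus>\<^bsub>\<C>\<^esub> h) = k \<otimes>\<^bsub>\<C>\<^esub> f \<oplus>\<^bsub>\<C>\<^esub> k \<otimes>\<^bsub>\<C>\<^esub> h"
  proof
    fix x
    have fin: "finite (supp k)" using fhk by (simp add: group_algebra_carrier)
    show "(k \<otimes>\<^bsub>\<C>\<^esub> (f \<oplus>\<^bsub>\<C>\<^esub> h)) x = (k \<otimes>\<^bsub>\<C>\<^esub> f \<oplus>\<^bsub>\<C>\<^esub> k \<otimes>\<^bsub>\<C>\<^esub> h) x"
      by (cases "x \<in> carrier G")
         (simp_all add: group_algebra_mult[OF fin order_refl] group_algebra_simps
           group_algebra_mult_outside sum.distrib distrib_left)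
  qed
qed

lemma group_algebra_module: "Module.module complex_ring \<C>"
proof (rule moduleI[OF cring_complex_ring])
  show "abelian_group \<C>" using group_algebra_ring by (simp add: ring_def)
qed (auto simp: group_algebra_smult_closed group_algebra_simps fun_eq_iff algebra_simps)

lemma group_algebra_star_mult:
  assumes f: "f \<in> carrier \<C>" and h: "h \<in> carrier \<C>"
  shows "star \<C> (f \<otimes>\<^bsub>\<C>\<^esub> h) = star \<C> h \<otimes>\<^bsub>\<C>\<^esub> star \<C> f"
proof
  fix x
  show "star \<C> (f \<otimes>\<^bsub>\<C>\<^esub> h) x = (star \<C> h \<otimes>\<^bsub>\<C>\<^esub> star \<C> f) x"
  proof (cases "x \<in> carrier G")
    case x: True
    have fin: "finite (supp f)" "supp f \<subseteq> carrier G" "finite (supp (star \<C> h))" "supp (star \<C> h) \<subseteq> carrier G"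
      using f group_algebra_star_closed[OF h] by (auto simp: group_algebra_carrier)
    let ?T = "(\<lambda>y. x \<otimes> y) ` supp f \<union> supp (star \<C> h)"
    have T: "finite ?T" "?T \<subseteq> carrier G" using fin x by auto
    have "star \<C> (f \<otimes>\<^bsub>\<C>\<^esub> h) x = (\<Sum>y\<in>supp f. cnj (f y) * cnj (h (inv y \<otimes> inv x)))"
      using x by (simp add: group_algebra_simps(5) group_algebra_mult[OF fin(1) order_refl])
    also have "\<dots> = (\<Sum>y\<in>supp f. star \<C> h (x \<otimes> y) * star \<C> f (inv (x \<otimes> y) \<otimes> x))"
    proof (rule sum.cong[OF refl])
      fix y assume "y \<in> supp f"
      hence y: "y \<in> carrier G" using fin by auto
      have "inv (x \<otimes> y) \<otimes> x = inv y" using x y by (simp add: inv_mult_group m_assoc)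
      thus "cnj (f y) * cnj (h (inv y \<otimes> inv x)) = star \<C> h (x \<otimes> y) * star \<C> f (inv (x \<otimes> y) \<otimes> x)"
        using x y by (simp add: group_algebra_simps inv_mult_group)
    qed
    also have "\<dots> = (\<Sum>z\<in>(\<lambda>y. x \<otimes> y) ` supp f. star \<C> h z * star \<C> f (inv z \<otimes> x))"
      by (subst sum.reindex[OF inj_on_mult_left[OF x fin(2)]]) simp
    also have "\<dots> = (\<Sum>z\<in>?T. star \<C> h z * star \<C> f (inv z \<otimes> x))"
    proof (rule sum.mono_neutral_left[OF T(1)])
      show "\<forall>z\<in>?T - (\<lambda>y. x \<otimes> y) ` supp f. star \<C> h z * star \<C> f (inv z \<otimes> x) = 0"
      proof
        fix z assume z: "z \<in> ?T - (\<lambda>y. x \<otimes> y) ` supp f"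
        hence zG: "z \<in> carrier G" using T by blast
        have "z = x \<otimes> (inv x \<otimes> z)" using zG x by (simp add: m_assoc[symmetric])
        hence "f (inv x \<otimes> z) = 0" using z by blast
        thus "star \<C> h z * star \<C> f (inv z \<otimes> x) = 0"
          using zG x by (simp add: group_algebra_simps inv_mult_group)
      qed
    qed auto
    also have "\<dots> = (star \<C> h \<otimes>\<^bsub>\<C>\<^esub> star \<C> f) x"
      by (rule group_algebra_mult[OF T(1) _ x, symmetric]) auto
    finally show ?thesis .
  qed (simp add: group_algebra_simps group_algebra_mult_outside)
qed

end

section \<open>Unitary representations\<close>

locale unitary_representation = group G for G (structure) +
  fixes X :: "'x set" and U :: "'a \<Rightarrow> ('x \<Rightarrow> complex) \<Rightarrow> 'x \<Rightarrow> complex"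
  assumes rep: "unitary_rep G X U"
begin

lemma U_op: "g \<in> carrier G \<Longrightarrow> unitary_op X (U g)"
  using rep by (simp add: unitary_rep_def)

lemma U_closed [simp, intro]: "g \<in> carrier G \<Longrightarrow> \<psi> \<in> ell2 X \<Longrightarrow> U g \<psi> \<in> ell2 X"
  using U_op unfolding unitary_op_def by blast

lemma U_inner: "g \<in> carrier G \<Longrightarrow> \<phi> \<in> ell2 X \<Longrightarrow> \<psi> \<in> ell2 X \<Longrightarrow>
    ell2_inner X (U g \<phi>) (U g \<psi>) = ell2_inner X \<phi> \<psi>"
  using U_op unfolding unitary_op_def by blast

lemma U_add: "g \<in> carrier G \<Longrightarrow> \<phi> \<in> ell2 X \<Longrightarrow> \<psi> \<in> ell2 X \<Longrightarrow>
    U g (\<lambda>x. \<phi> x + \<psi> x) = (\<lambda>x. U g \<phi> x + U g \<psi> x)"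
  using U_op unfolding unitary_op_def by blast

lemma U_scale: "g \<in> carrier G \<Longrightarrow> \<psi> \<in> ell2 X \<Longrightarrow> U g (\<lambda>x. c * \<psi> x) = (\<lambda>x. c * U g \<psi> x)"
  using U_op unfolding unitary_op_def by blast

lemma U_mult: "g \<in> carrier G \<Longrightarrow> h \<in> carrier G \<Longrightarrow> \<psi> \<in> ell2 X \<Longrightarrow> U (g \<otimes> h) \<psi> = U g (U h \<psi>)"
  using rep by (simp add: unitary_rep_def)

lemma U_norm: "g \<in> carrier G \<Longrightarrow> \<psi> \<in> ell2 X \<Longrightarrow> ell2_norm X (U g \<psi>) = ell2_norm X \<psi>"
  using U_inner[of g \<psi> \<psi>] ell2_inner_self[of "U g \<psi>" X] ell2_inner_self[of \<psi> X]
  by (simp del: of_real_power)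

text \<open>
  The identity acts as an idempotent, and it is surjective because it is unitary.
\<close>

lemma U_one: assumes "\<psi> \<in> ell2 X" shows "U \<one> \<psi> = \<psi>"
proof -
  have "\<psi> \<in> U \<one> ` ell2 X" using U_op[OF one_closed] assms unfolding unitary_op_def by blast
  then obtain \<phi> where "\<phi> \<in> ell2 X" "\<psi> = U \<one> \<phi>" by blast
  thus ?thesis using U_mult[of \<one> \<one> \<phi>] by simp
qed

text \<open>
  A unitary operator has its inverse as adjoint.
\<close>

lemma U_adjoint:
  assumes "g \<in> carrier G" "\<phi> \<in> ell2 X" "\<psi> \<in> ell2 X"
  shows "ell2_inner X (U g \<phi>) \<psi> = ell2_inner X \<phi> (U (inv g) \<psi>)"
proof -
  have "\<psi> = U g (U (inv g) \<psi>)" using assms U_mult[of g "inv g" \<psi>] by (simp add: U_one)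
  thus ?thesis using assms U_inner[of g \<phi> "U (inv g) \<psi>"] by simp
qed

lemma U_zero: assumes "g \<in> carrier G" shows "U g (\<lambda>x. 0) = (\<lambda>x. 0)"
  using U_scale[OF assms ell2_zero, of 0] by simp

lemma U_sum:
  assumes g: "g \<in> carrier G" and "finite S" "\<And>i. i \<in> S \<Longrightarrow> f i \<in> ell2 X"
  shows "U g (\<lambda>x. \<Sum>i\<in>S. c i * f i x) = (\<lambda>x. \<Sum>i\<in>S. c i * U g (f i) x)"
  using assms(2,3)
proof (induction rule: finite_induct)
  case empty show ?case using U_zero[OF g] by simp
next
  case (insert i S)
  hence i: "f i \<in> ell2 X" and S: "\<And>j. j \<in> S \<Longrightarrow> f j \<in> ell2 X" by auto
  have "U g (\<lambda>x. \<Sum>i\<in>insert i S. c i * f i x) = U g (\<lambda>x. c i * f i x + (\<Sum>i\<in>S. c i * f i x))"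
    using insert.hyps by simp
  also have "\<dots> = (\<lambda>x. U g (\<lambda>x. c i * f i x) x + U g (\<lambda>x. \<Sum>i\<in>S. c i * f i x) x)"
    by (rule U_add[OF g ell2_scale[OF i] ell2_sum[OF insert.hyps(1), THEN conjunct1]]) (rule S)
  also have "\<dots> = (\<lambda>x. \<Sum>i\<in>insert i S. c i * U g (f i) x)"
    using insert.hyps insert.IH[OF S] U_scale[OF g i, of "c i"] by simp
  finally show ?case .
qed

lemma rep_extend_superset:
  assumes "finite S" "supp f \<subseteq> S" shows "rep_extend U f \<psi> = (\<lambda>x. \<Sum>g\<in>S. f g * U g \<psi> x)"
  unfolding rep_extend_def using assms by (intro ext sum.mono_neutral_left) auto

lemma rep_extend_closed:
  assumes "f \<in> carrier \<C>" "\<psi> \<in> ell2 X" shows "rep_extend U f \<psi> \<in> ell2 X"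
  unfolding rep_extend_def using assms
  by (intro ell2_sum[THEN conjunct1]) (auto simp: group_algebra_carrier)

lemma rep_extend_bound:
  assumes f: "f \<in> carrier \<C>" and psi: "\<psi> \<in> ell2 X"
  shows "ell2_norm X (rep_extend U f \<psi>) \<le> (\<Sum>g\<in>supp f. cmod (f g)) * ell2_norm X \<psi>"
proof -
  have "ell2_norm X (rep_extend U f \<psi>) \<le> (\<Sum>g\<in>supp f. cmod (f g) * ell2_norm X (U g \<psi>))"
    unfolding rep_extend_def using assms
    by (intro ell2_sum[THEN conjunct2]) (auto simp: group_algebra_carrier)
  also have "\<dots> = (\<Sum>g\<in>supp f. cmod (f g) * ell2_norm X \<psi>)"
    using f by (intro sum.cong refl) (auto simp: group_algebra_carrier U_norm[OF _ psi])
  finally show ?thesis by (simp add: sum_distrib_right)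
qed

lemma rep_extend_add:
  assumes "f \<in> carrier \<C>" "h \<in> carrier \<C>"
  shows "rep_extend U (f \<oplus>\<^bsub>\<C>\<^esub> h) \<psi> = (\<lambda>x. rep_extend U f \<psi> x + rep_extend U h \<psi> x)"
proof -
  have fin: "finite (supp f \<union> supp h)" using assms by (simp add: group_algebra_carrier)
  have 1: "rep_extend U (f \<oplus>\<^bsub>\<C>\<^esub> h) \<psi> = (\<lambda>x. \<Sum>g\<in>supp f \<union> supp h. (f \<oplus>\<^bsub>\<C>\<^esub> h) g * U g \<psi> x)"
    by (rule rep_extend_superset[OF fin]) (auto simp: group_algebra_simps)
  show ?thesis
    unfolding 1 rep_extend_superset[OF fin, of f, OF Un_upper1] rep_extend_superset[OF fin, of h, OF Un_upper2]
    by (simp add: group_algebra_simps distrib_right sum.distrib)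
qed

lemma rep_extend_smult:
  assumes "f \<in> carrier \<C>"
  shows "rep_extend U (c \<odot>\<^bsub>\<C>\<^esub> f) \<psi> = (\<lambda>x. c * rep_extend U f \<psi> x)"
proof -
  have fin: "finite (supp f)" using assms by (simp add: group_algebra_carrier)
  have 1: "rep_extend U (c \<odot>\<^bsub>\<C>\<^esub> f) \<psi> = (\<lambda>x. \<Sum>g\<in>supp f. (c \<odot>\<^bsub>\<C>\<^esub> f) g * U g \<psi> x)"
    by (rule rep_extend_superset[OF fin]) (auto simp: group_algebra_simps)
  show ?thesis
    by (subst 1) (simp add: rep_extend_def group_algebra_simps sum_distrib_left mult.assoc)
qed

lemma rep_extend_mult:
  assumes f: "f \<in> carrier \<C>" and h: "h \<in> carrier \<C>" and psi: "\<psi> \<in> ell2 X"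
  shows "rep_extend U (f \<otimes>\<^bsub>\<C>\<^esub> h) \<psi> = rep_extend U f (rep_extend U h \<psi>)"
proof
  fix x
  let ?P = "(\<lambda>(y, z). y \<otimes> z) ` (supp f \<times> supp h)"
  have fin: "finite (supp f)" "finite (supp h)" "supp f \<subseteq> carrier G" "supp h \<subseteq> carrier G"
    using f h by (auto simp: group_algebra_carrier)
  have finP: "finite ?P" using fin by simp
  have P: "z \<in> carrier G" if "z \<in> ?P" for z using that fin by auto
  have "rep_extend U (f \<otimes>\<^bsub>\<C>\<^esub> h) \<psi> x = (\<Sum>z\<in>?P. (f \<otimes>\<^bsub>\<C>\<^esub> h) z * U z \<psi> x)"
    using rep_extend_superset[OF finP supp_mult[OF f]] by simp
  also have "\<dots> = (\<Sum>z\<in>?P. \<Sum>y\<in>supp f. f y * h (inv y \<otimes> z) * U z \<psi> x)"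
    using P by (intro sum.cong refl) (simp add: group_algebra_mult[OF fin(1) order_refl] sum_distrib_right)
  also have "\<dots> = (\<Sum>y\<in>supp f. \<Sum>z\<in>?P. f y * h (inv y \<otimes> z) * U z \<psi> x)"
    by (rule sum.swap)
  also have "\<dots> = (\<Sum>y\<in>supp f. f y * U y (rep_extend U h \<psi>) x)"
  proof (rule sum.cong[OF refl])
    fix y assume y: "y \<in> supp f"
    hence yG: "y \<in> carrier G" using fin by auto
    have "(\<Sum>z\<in>?P. f y * h (inv y \<otimes> z) * U z \<psi> x)
        = (\<Sum>z\<in>(\<lambda>w. y \<otimes> w) ` supp h. f y * h (inv y \<otimes> z) * U z \<psi> x)"
    proof (rule sum.mono_neutral_right[OF finP])
      show "\<forall>z\<in>?P - (\<lambda>w. y \<otimes> w) ` supp h. f y * h (inv y \<otimes> z) * U z \<psi> x = 0"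
      proof
        fix z assume z: "z \<in> ?P - (\<lambda>w. y \<otimes> w) ` supp h"
        have "z = y \<otimes> (inv y \<otimes> z)" using P[of z] z yG by (simp add: m_assoc[symmetric])
        hence "h (inv y \<otimes> z) = 0" using z by blast
        thus "f y * h (inv y \<otimes> z) * U z \<psi> x = 0" by simp
      qed
    qed (use y in auto)
    also have "\<dots> = (\<Sum>w\<in>supp h. f y * h (inv y \<otimes> (y \<otimes> w)) * U (y \<otimes> w) \<psi> x)"
      by (subst sum.reindex[OF inj_on_mult_left[OF yG fin(4)]]) simp
    also have "\<dots> = (\<Sum>w\<in>supp h. f y * (h w * U y (U w \<psi>) x))"
      using fin yG by (intro sum.cong refl) (auto simp: subset_iff m_assoc[symmetric] U_mult[OF _ _ psi])
    also have "\<dots> = f y * (\<Sum>w\<in>supp h. h w * U y (U w \<psi>) x)" by (simp add: sum_distrib_left)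
    also have "(\<Sum>w\<in>supp h. h w * U y (U w \<psi>) x) = U y (rep_extend U h \<psi>) x"
      unfolding rep_extend_def using fin psi by (subst U_sum[OF yG]) auto
    finally show "(\<Sum>z\<in>?P. f y * h (inv y \<otimes> z) * U z \<psi> x) = f y * U y (rep_extend U h \<psi>) x" .
  qed
  also have "\<dots> = rep_extend U f (rep_extend U h \<psi>) x" by (simp add: rep_extend_def)
  finally show "rep_extend U (f \<otimes>\<^bsub>\<C>\<^esub> h) \<psi> x = rep_extend U f (rep_extend U h \<psi>) x" .
qed

lemma rep_extend_adjoint:
  assumes f: "f \<in> carrier \<C>" and phi: "\<phi> \<in> ell2 X" and psi: "\<psi> \<in> ell2 X"
  shows "ell2_inner X (rep_extend U f \<phi>) \<psi> = ell2_inner X \<phi> (rep_extend U (star \<C> f) \<psi>)"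
proof -
  have fin: "finite (supp f)" "supp f \<subseteq> carrier G" using f by (auto simp: group_algebra_carrier)
  have inj: "inj_on (\<lambda>g. inv g) (supp f)" using fin(2) inv_inj by (rule inj_on_subset[rotated])
  have 1: "rep_extend U (star \<C> f) \<psi> = (\<lambda>x. \<Sum>g\<in>(\<lambda>g. inv g) ` supp f. star \<C> f g * U g \<psi> x)"
  proof (rule rep_extend_superset)
    show "supp (star \<C> f) \<subseteq> (\<lambda>g. inv g) ` supp f"
    proof
      fix x assume x: "x \<in> supp (star \<C> f)"
      hence xG: "x \<in> carrier G" and "f (inv x) \<noteq> 0" by (auto simp: group_algebra_simps split: if_splits)
      moreover have "x = inv (inv x)" using xG by simp
      ultimately show "x \<in> (\<lambda>g. inv g) ` supp f" by blast
    qed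
  qed (use fin in simp)
  have 2: "rep_extend U (star \<C> f) \<psi> = (\<lambda>x. \<Sum>g\<in>supp f. cnj (f g) * U (inv g) \<psi> x)"
    unfolding 1 by (subst sum.reindex[OF inj])
      (use fin in \<open>auto intro!: ext sum.cong simp: group_algebra_simps subset_iff\<close>)
  have "ell2_inner X (rep_extend U f \<phi>) \<psi> = (\<Sum>g\<in>supp f. cnj (f g) * ell2_inner X (U g \<phi>) \<psi>)"
    unfolding rep_extend_def by (rule ell2_inner_sum_left[OF psi fin(1)]) (use fin phi in auto)
  also have "\<dots> = (\<Sum>g\<in>supp f. cnj (f g) * ell2_inner X \<phi> (U (inv g) \<psi>))"
    using fin by (intro sum.cong refl) (auto simp: U_adjoint[OF _ phi psi])
  also have "\<dots> = ell2_inner X \<phi> (rep_extend U (star \<C> f) \<psi>)"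
    unfolding 2 by (rule ell2_inner_sum_right[OF phi fin(1), symmetric]) (use fin psi in auto)
  finally show ?thesis .
qed

lemma rep_extend_scale:
  assumes "f \<in> carrier \<C>" "\<psi> \<in> ell2 X"
  shows "rep_extend U f (\<lambda>x. c * \<psi> x) = (\<lambda>x. c * rep_extend U f \<psi> x)"
proof -
  have "U g (\<lambda>x. c * \<psi> x) = (\<lambda>x. c * U g \<psi> x)" if "g \<in> supp f" for g
    using that assms by (intro U_scale) (auto simp: group_algebra_carrier)
  hence "(\<Sum>g\<in>supp f. f g * U g (\<lambda>x. c * \<psi> x) x) = (\<Sum>g\<in>supp f. c * (f g * U g \<psi> x))" for x
    by (intro sum.cong refl) simp
  thus ?thesis unfolding rep_extend_def by (simp only: sum_distrib_left)
qed

lemma op_norm_le: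
  assumes "0 \<le> c" "\<And>\<psi>. \<psi> \<in> ell2 X \<Longrightarrow> ell2_norm X (T \<psi>) \<le> c * ell2_norm X \<psi>"
  shows "op_norm X T \<le> c"
  unfolding op_norm_def
proof (rule cSup_least)
  show "{ell2_norm X (T \<psi>) |\<psi>. \<psi> \<in> ell2 X \<and> ell2_norm X \<psi> \<le> 1} \<noteq> {}"
  proof -
    have "ell2_norm X (T (\<lambda>x. 0)) \<in> {ell2_norm X (T \<psi>) |\<psi>. \<psi> \<in> ell2 X \<and> ell2_norm X \<psi> \<le> 1}"
      by (intro CollectI exI[of _ "\<lambda>x. 0"]) simp
    thus ?thesis by blast
  qed
  fix r assume "r \<in> {ell2_norm X (T \<psi>) |\<psi>. \<psi> \<in> ell2 X \<and> ell2_norm X \<psi> \<le> 1}"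
  then obtain \<psi> where "\<psi> \<in> ell2 X" "ell2_norm X \<psi> \<le> 1" "r = ell2_norm X (T \<psi>)" by blast
  thus "r \<le> c" using assms(2)[of \<psi>] mult_left_mono[of "ell2_norm X \<psi>" 1 c] assms(1) by simp
qed

text \<open>
  The supremum defining the operator norm is finite because the sum of the absolute values of the
  coefficients bounds it; the estimate then follows by scaling \<open>\<psi>\<close> to a unit vector.
\<close>

lemma norm_rep_extend_le_op_norm:
  assumes f: "f \<in> carrier \<C>" and psi: "\<psi> \<in> ell2 X"
  shows "ell2_norm X (rep_extend U f \<psi>) \<le> op_norm X (rep_extend U f) * ell2_norm X \<psi>"
proof (cases "ell2_norm X \<psi> = 0")
  case True thus ?thesis using rep_extend_bound[OF f psi] by simp
next
  case False
  hence pos: "0 < ell2_norm X \<psi>" using ell2_norm_nonneg[of X \<psi>] by linarith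
  let ?c = "complex_of_real (inverse (ell2_norm X \<psi>))"
  let ?phi = "\<lambda>x. ?c * \<psi> x"
  have phi: "?phi \<in> ell2 X" by (rule ell2_scale[OF psi])
  have n: "ell2_norm X ?phi \<le> 1" using pos by (simp add: ell2_norm_scale[OF psi] norm_inverse)
  have "bdd_above {ell2_norm X (rep_extend U f \<psi>) |\<psi>. \<psi> \<in> ell2 X \<and> ell2_norm X \<psi> \<le> 1}"
  proof (rule bdd_aboveI[of _ "\<Sum>g\<in>supp f. cmod (f g)"])
    fix r assume "r \<in> {ell2_norm X (rep_extend U f \<psi>) |\<psi>. \<psi> \<in> ell2 X \<and> ell2_norm X \<psi> \<le> 1}"
    then obtain \<psi>' where p: "\<psi>' \<in> ell2 X" "ell2_norm X \<psi>' \<le> 1" "r = ell2_norm X (rep_extend U f \<psi>')" by blast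
    have "(\<Sum>g\<in>supp f. cmod (f g)) * ell2_norm X \<psi>' \<le> (\<Sum>g\<in>supp f. cmod (f g)) * 1"
      by (rule mult_left_mono[OF p(2)]) (simp add: sum_nonneg)
    thus "r \<le> (\<Sum>g\<in>supp f. cmod (f g))" using rep_extend_bound[OF f p(1)] p(3) by simp
  qed
  hence "ell2_norm X (rep_extend U f ?phi) \<le> op_norm X (rep_extend U f)"
    unfolding op_norm_def by (rule cSup_upper[rotated]) (use phi n in blast)
  hence "inverse (ell2_norm X \<psi>) * ell2_norm X (rep_extend U f \<psi>) \<le> op_norm X (rep_extend U f)"
    using pos ell2_norm_scale[OF rep_extend_closed[OF f psi], of ?c]
    by (simp add: rep_extend_scale[OF f psi] norm_inverse)
  thus ?thesis using pos by (simp add: field_simps)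
qed

end

section \<open>The universal norm\<close>

context group
begin

abbreviation regular_basis :: "('a \<times> nat) set" where "regular_basis \<equiv> carrier G \<times> {0}"

text \<open>
  The left regular representation; the second component \<open>0\<close> places its basis in the type over which the
  universal norm ranges.
\<close>

definition regular_rep :: "'a \<Rightarrow> ('a \<times> nat \<Rightarrow> complex) \<Rightarrow> 'a \<times> nat \<Rightarrow> complex" where
  "regular_rep g \<psi> = (\<lambda>p. if p \<in> regular_basis then \<psi> (inv g \<otimes> fst p, snd p) else 0)"

lemma bij_betw_regular_basis:
  assumes g: "g \<in> carrier G"
  shows "bij_betw (\<lambda>p. (g \<otimes> fst p, snd p)) regular_basis regular_basis"
proof (rule bij_betwI[where g = "\<lambda>p. (inv g \<otimes> fst p, snd p)"])
qed (use g in \<open>auto simp: m_assoc[symmetric]\<close>)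

lemma regular_rep_unitary: "unitary_rep G regular_basis regular_rep"
proof -
  let ?X = regular_basis
  have closed: "regular_rep g \<psi> \<in> ell2 ?X" if g: "g \<in> carrier G" and psi: "\<psi> \<in> ell2 ?X" for g \<psi>
  proof -
    let ?h = "\<lambda>p. (inv g \<otimes> fst p, snd p)"
    have "(\<lambda>p. (cmod (\<psi> (?h p)))\<^sup>2) summable_on ?X"
      using summable_on_reindex_bij_betw[OF bij_betw_regular_basis, of "inv g" "\<lambda>p. (cmod (\<psi> p))\<^sup>2"] g psi
      by (simp add: ell2_def)
    also have "?this \<longleftrightarrow> (\<lambda>p. (cmod (regular_rep g \<psi> p))\<^sup>2) summable_on ?X"
      by (rule summable_on_cong) (simp add: regular_rep_def)
    finally show ?thesis by (auto simp: ell2_def regular_rep_def)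
  qed
  have inverse: "regular_rep g (regular_rep h \<psi>) = regular_rep (g \<otimes> h) \<psi>"
    if "g \<in> carrier G" "h \<in> carrier G" for g h \<psi>
    using that by (auto simp: regular_rep_def fun_eq_iff inv_mult_group m_assoc)
  have one: "regular_rep \<one> \<psi> = \<psi>" if "\<psi> \<in> ell2 ?X" for \<psi>
    using that by (auto simp: regular_rep_def fun_eq_iff ell2_def)
  have inner: "ell2_inner ?X (regular_rep g \<phi>) (regular_rep g \<psi>) = ell2_inner ?X \<phi> \<psi>"
    if g: "g \<in> carrier G" for g \<phi> \<psi>
  proof -
    let ?h = "\<lambda>p. (inv g \<otimes> fst p, snd p)"
    have "ell2_inner ?X (regular_rep g \<phi>) (regular_rep g \<psi>) = (\<Sum>\<^sub>\<infinity>p\<in>?X. cnj (\<phi> (?h p)) * \<psi> (?h p))"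
      unfolding ell2_inner_def by (rule infsum_cong) (simp add: regular_rep_def)
    also have "\<dots> = ell2_inner ?X \<phi> \<psi>"
      unfolding ell2_inner_def
      using infsum_reindex_bij_betw[OF bij_betw_regular_basis, of "inv g" "\<lambda>p. cnj (\<phi> p) * \<psi> p"] g by simp
    finally show ?thesis .
  qed
  have "unitary_op ?X (regular_rep g)" if g: "g \<in> carrier G" for g
    unfolding unitary_op_def
  proof (intro conjI ballI allI)
    show "regular_rep g ` ell2 ?X = ell2 ?X"
    proof
      show "ell2 ?X \<subseteq> regular_rep g ` ell2 ?X"
      proof
        fix \<psi> assume psi: "\<psi> \<in> ell2 ?X"
        have "\<psi> = regular_rep g (regular_rep (inv g) \<psi>)" using g psi by (simp add: inverse one)
        thus "\<psi> \<in> regular_rep g ` ell2 ?X" using closed[of "inv g" \<psi>] g psi by blast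
      qed
    qed (use closed g in blast)
  qed (use g inner in \<open>auto simp: regular_rep_def fun_eq_iff\<close>)
  thus ?thesis unfolding unitary_rep_def using inverse by simp
qed

text \<open>
  Together with \<open>norm_rep_extend_le_full_norm\<close> this describes the universal norm as the least uniform
  bound for the operators of \<open>f\<close>.  All its properties are derived from these two facts.
\<close>

lemma full_norm_le:
  assumes c: "0 \<le> c"
    and le: "\<And>(X :: ('a \<times> nat) set) U \<psi>. unitary_rep G X U \<Longrightarrow> \<psi> \<in> ell2 X \<Longrightarrow>
      ell2_norm X (rep_extend U f \<psi>) \<le> c * ell2_norm X \<psi>"
  shows "full_norm G f \<le> c"
  unfolding full_norm_def
proof (rule cSup_least)
  show "{op_norm X (rep_extend U f) |(X :: ('a \<times> nat) set) U. unitary_rep G X U} \<noteq> {}"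
    using regular_rep_unitary by blast
  fix r assume "r \<in> {op_norm X (rep_extend U f) |(X :: ('a \<times> nat) set) U. unitary_rep G X U}"
  then obtain X :: "('a \<times> nat) set" and U where XU: "unitary_rep G X U" "r = op_norm X (rep_extend U f)"
    by blast
  interpret unitary_representation G X U by unfold_locales (rule XU)
  show "r \<le> c" unfolding XU using c le[OF XU(1)] by (rule op_norm_le)
qed

lemma norm_rep_extend_le_full_norm:
  fixes X :: "('a \<times> nat) set"
  assumes U: "unitary_rep G X U" and f: "f \<in> carrier \<C>" and psi: "\<psi> \<in> ell2 X"
  shows "ell2_norm X (rep_extend U f \<psi>) \<le> full_norm G f * ell2_norm X \<psi>"
proof -
  interpret unitary_representation G X U by unfold_locales (rule U)
  have "bdd_above {op_norm X (rep_extend U f) |(X :: ('a \<times> nat) set) U. unitary_rep G X U}"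
  proof (rule bdd_aboveI[of _ "\<Sum>g\<in>supp f. cmod (f g)"])
    fix r assume "r \<in> {op_norm X (rep_extend U f) |(X :: ('a \<times> nat) set) U. unitary_rep G X U}"
    then obtain Y :: "('a \<times> nat) set" and V where YV: "unitary_rep G Y V" "r = op_norm Y (rep_extend V f)"
      by blast
    interpret V: unitary_representation G Y V by unfold_locales (rule YV)
    show "r \<le> (\<Sum>g\<in>supp f. cmod (f g))"
      unfolding YV by (rule V.op_norm_le) (auto intro: sum_nonneg V.rep_extend_bound[OF f])
  qed
  hence "op_norm X (rep_extend U f) \<le> full_norm G f"
    unfolding full_norm_def by (rule cSup_upper[rotated]) (use U in blast)
  hence "op_norm X (rep_extend U f) * ell2_norm X \<psi> \<le> full_norm G f * ell2_norm X \<psi>"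
    by (rule mult_right_mono) simp
  thus ?thesis using norm_rep_extend_le_op_norm[OF f psi] by linarith
qed

lemma full_norm_le_sum:
  assumes f: "f \<in> carrier \<C>" shows "full_norm G f \<le> (\<Sum>g\<in>supp f. cmod (f g))"
proof (rule full_norm_le)
  fix X :: "('a \<times> nat) set" and U \<psi> assume U: "unitary_rep G X U" and psi: "\<psi> \<in> ell2 X"
  interpret unitary_representation G X U by unfold_locales (rule U)
  show "ell2_norm X (rep_extend U f \<psi>) \<le> (\<Sum>g\<in>supp f. cmod (f g)) * ell2_norm X \<psi>"
    by (rule rep_extend_bound[OF f psi])
qed (simp add: sum_nonneg)

text \<open>
  The regular representation maps the basis vector at \<open>\<one>\<close>, which has norm one, to \<open>f\<close>.
\<close>

lemma coeff_le_full_norm: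
  assumes f: "f \<in> carrier \<C>" and g: "g \<in> carrier G" shows "cmod (f g) \<le> full_norm G f"
proof -
  let ?d = "\<lambda>p. if p = (\<one>, 0) then 1 else 0 :: complex"
  have le1: "L2_set (\<lambda>p. cmod (?d p)) F \<le> 1" if "finite F" for F :: "('a \<times> nat) set"
  proof -
    have "(\<Sum>p\<in>F. (cmod (?d p))\<^sup>2) = (\<Sum>p\<in>F. if p = (\<one>, 0) then 1 else 0)"
      by (rule sum.cong) auto
    also have "\<dots> \<le> 1" using that by simp
    finally show ?thesis by (simp add: L2_set_def)
  qed
  have d: "?d \<in> ell2 regular_basis" "ell2_norm regular_basis ?d \<le> 1"
    by (rule ell2I_L2_set[of regular_basis ?d 1]; use le1 in auto)+
  interpret unitary_representation G regular_basis regular_rep by unfold_locales (rule regular_rep_unitary)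
  have fin: "finite (insert g (supp f))" using f by (simp add: group_algebra_carrier)
  have "rep_extend regular_rep f ?d (g, 0) = (\<Sum>h\<in>insert g (supp f). f h * regular_rep h ?d (g, 0))"
    using rep_extend_superset[OF fin subset_insertI] by simp
  also have "\<dots> = (\<Sum>h\<in>insert g (supp f). if h = g then f g else 0)"
  proof (rule sum.cong[OF refl])
    fix h assume "h \<in> insert g (supp f)"
    hence h: "h \<in> carrier G" using g f by (auto simp: group_algebra_carrier)
    have "inv h \<otimes> g = \<one> \<longleftrightarrow> h = g" using inv_solve_left[of \<one> h g] h g by auto
    thus "f h * regular_rep h ?d (g, 0) = (if h = g then f g else 0)"
      using g by (simp add: regular_rep_def)
  qed
  also have "\<dots> = f g" using fin by (simp only: sum.delta) simp
  finally have eq: "rep_extend regular_rep f ?d (g, 0) = f g" .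
  have "cmod (f g) \<le> ell2_norm regular_basis (rep_extend regular_rep f ?d)"
    using L2_set_le_ell2_norm[OF rep_extend_closed[OF f d(1)], of "{(g, 0)}"] g eq by simp
  also have "\<dots> \<le> full_norm G f * ell2_norm regular_basis ?d"
    by (rule norm_rep_extend_le_full_norm[OF regular_rep_unitary f d(1)])
  finally have le: "cmod (f g) \<le> full_norm G f * ell2_norm regular_basis ?d" .
  have "ell2_norm regular_basis ?d = 1"
    using L2_set_le_ell2_norm[OF d(1), of "{(\<one>, 0)}"] d(2) by simp
  thus ?thesis using le by simp
qed

lemma full_norm_nonneg: "f \<in> carrier \<C> \<Longrightarrow> 0 \<le> full_norm G f"
  using coeff_le_full_norm[of f \<one>] norm_ge_zero[of "f \<one>"] by (simp del: norm_ge_zero)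

lemma full_norm_triangle:
  assumes f: "f \<in> carrier \<C>" and h: "h \<in> carrier \<C>"
  shows "full_norm G (f \<oplus>\<^bsub>\<C>\<^esub> h) \<le> full_norm G f + full_norm G h"
proof (rule full_norm_le)
  fix X :: "('a \<times> nat) set" and U \<psi> assume U: "unitary_rep G X U" and psi: "\<psi> \<in> ell2 X"
  interpret unitary_representation G X U by unfold_locales (rule U)
  have "ell2_norm X (rep_extend U (f \<oplus>\<^bsub>\<C>\<^esub> h) \<psi>)
      \<le> ell2_norm X (rep_extend U f \<psi>) + ell2_norm X (rep_extend U h \<psi>)"
    unfolding rep_extend_add[OF f h]
    by (rule ell2_norm_triangle[OF rep_extend_closed[OF f psi] rep_extend_closed[OF h psi]])
  also have "\<dots> \<le> full_norm G f * ell2_norm X \<psi> + full_norm G h * ell2_norm X \<psi>"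
    by (intro add_mono norm_rep_extend_le_full_norm U f h psi)
  finally show "ell2_norm X (rep_extend U (f \<oplus>\<^bsub>\<C>\<^esub> h) \<psi>) \<le> (full_norm G f + full_norm G h) * ell2_norm X \<psi>"
    by (simp add: distrib_right)
qed (use f h full_norm_nonneg in simp)

lemma full_norm_mult:
  assumes f: "f \<in> carrier \<C>" and h: "h \<in> carrier \<C>"
  shows "full_norm G (f \<otimes>\<^bsub>\<C>\<^esub> h) \<le> full_norm G f * full_norm G h"
proof (rule full_norm_le)
  fix X :: "('a \<times> nat) set" and U \<psi> assume U: "unitary_rep G X U" and psi: "\<psi> \<in> ell2 X"
  interpret unitary_representation G X U by unfold_locales (rule U)
  have "ell2_norm X (rep_extend U (f \<otimes>\<^bsub>\<C>\<^esub> h) \<psi>) \<le> full_norm G f * ell2_norm X (rep_extend U h \<psi>)"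
    unfolding rep_extend_mult[OF f h psi]
    by (rule norm_rep_extend_le_full_norm[OF U f rep_extend_closed[OF h psi]])
  also have "\<dots> \<le> full_norm G f * (full_norm G h * ell2_norm X \<psi>)"
    by (intro mult_left_mono norm_rep_extend_le_full_norm U h psi full_norm_nonneg f)
  finally show "ell2_norm X (rep_extend U (f \<otimes>\<^bsub>\<C>\<^esub> h) \<psi>) \<le> full_norm G f * full_norm G h * ell2_norm X \<psi>"
    by (simp add: mult.assoc)
qed (use f h full_norm_nonneg in simp)

lemma full_norm_smult:
  assumes f: "f \<in> carrier \<C>" shows "full_norm G (c \<odot>\<^bsub>\<C>\<^esub> f) = cmod c * full_norm G f"
proof -
  have le: "full_norm G (c \<odot>\<^bsub>\<C>\<^esub> f) \<le> cmod c * full_norm G f" if f: "f \<in> carrier \<C>" for c f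
  proof (rule full_norm_le)
    fix X :: "('a \<times> nat) set" and U \<psi> assume U: "unitary_rep G X U" and psi: "\<psi> \<in> ell2 X"
    interpret unitary_representation G X U by unfold_locales (rule U)
    have "ell2_norm X (rep_extend U (c \<odot>\<^bsub>\<C>\<^esub> f) \<psi>) = cmod c * ell2_norm X (rep_extend U f \<psi>)"
      unfolding rep_extend_smult[OF f] by (rule ell2_norm_scale[OF rep_extend_closed[OF f psi]])
    also have "\<dots> \<le> cmod c * (full_norm G f * ell2_norm X \<psi>)"
      by (intro mult_left_mono norm_rep_extend_le_full_norm U f psi) simp
    finally show "ell2_norm X (rep_extend U (c \<odot>\<^bsub>\<C>\<^esub> f) \<psi>) \<le> cmod c * full_norm G f * ell2_norm X \<psi>"
      by (simp add: mult.assoc)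
  qed (use full_norm_nonneg[OF f] in simp)
  show ?thesis
  proof (cases "c = 0")
    case True
    thus ?thesis using le[OF f, of c] full_norm_nonneg[OF group_algebra_smult_closed[OF f, of c]] by simp
  next
    case False
    have "inverse c \<odot>\<^bsub>\<C>\<^esub> (c \<odot>\<^bsub>\<C>\<^esub> f) = f" using False by (simp add: fun_eq_iff group_algebra_simps)
    hence "full_norm G f \<le> inverse (cmod c) * full_norm G (c \<odot>\<^bsub>\<C>\<^esub> f)"
      using le[OF group_algebra_smult_closed[OF f, of c], of "inverse c"] by (simp add: norm_inverse)
    hence "cmod c * full_norm G f \<le> full_norm G (c \<odot>\<^bsub>\<C>\<^esub> f)" using False by (simp add: field_simps)
    thus ?thesis using le[OF f, of c] by simp
  qed
qed

text \<open>
  For every representation \<open>\<parallel>U(f) \<psi>\<parallel>\<^sup>2 = \<langle>\<psi>, U(f\<^sup>* f) \<psi>\<rangle> \<le> \<parallel>U(f\<^sup>* f)\<parallel> \<parallel>\<psi>\<parallel>\<^sup>2\<close> by the Cauchy-Schwarz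
  inequality.
\<close>

lemma full_norm_power2_le:
  assumes f: "f \<in> carrier \<C>"
  shows "(full_norm G f)\<^sup>2 \<le> full_norm G (star \<C> f \<otimes>\<^bsub>\<C>\<^esub> f)"
proof -
  let ?p = "star \<C> f \<otimes>\<^bsub>\<C>\<^esub> f"
  have p: "?p \<in> carrier \<C>" by (intro group_algebra_mult_closed group_algebra_star_closed f)
  have "full_norm G f \<le> sqrt (full_norm G ?p)"
  proof (rule full_norm_le)
    fix X :: "('a \<times> nat) set" and U \<psi> assume U: "unitary_rep G X U" and psi: "\<psi> \<in> ell2 X"
    interpret unitary_representation G X U by unfold_locales (rule U)
    have T: "rep_extend U f \<psi> \<in> ell2 X" "rep_extend U ?p \<psi> \<in> ell2 X"
      using f p psi by (auto intro: rep_extend_closed)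
    have "complex_of_real ((ell2_norm X (rep_extend U f \<psi>))\<^sup>2) = ell2_inner X (rep_extend U f \<psi>) (rep_extend U f \<psi>)"
      by (rule ell2_inner_self[OF T(1), symmetric])
    also have "\<dots> = ell2_inner X \<psi> (rep_extend U ?p \<psi>)"
      unfolding rep_extend_adjoint[OF f psi T(1)] rep_extend_mult[OF group_algebra_star_closed[OF f] f psi] ..
    finally have "cmod (complex_of_real ((ell2_norm X (rep_extend U f \<psi>))\<^sup>2)) = cmod (ell2_inner X \<psi> (rep_extend U ?p \<psi>))"
      by (rule arg_cong)
    hence "(ell2_norm X (rep_extend U f \<psi>))\<^sup>2 = cmod (ell2_inner X \<psi> (rep_extend U ?p \<psi>))"
      unfolding norm_of_real by simp
    also have "\<dots> \<le> ell2_norm X \<psi> * ell2_norm X (rep_extend U ?p \<psi>)"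
      by (rule ell2_Cauchy_Schwarz[OF psi T(2)])
    also have "\<dots> \<le> ell2_norm X \<psi> * (full_norm G ?p * ell2_norm X \<psi>)"
      by (intro mult_left_mono norm_rep_extend_le_full_norm U p psi) simp
    also have "\<dots> = (sqrt (full_norm G ?p) * ell2_norm X \<psi>)\<^sup>2"
      using full_norm_nonneg[OF p] by (simp add: power_mult_distrib power2_eq_square[of "ell2_norm X \<psi>"])
    finally show "ell2_norm X (rep_extend U f \<psi>) \<le> sqrt (full_norm G ?p) * ell2_norm X \<psi>"
      by (rule power2_le_imp_le) (simp add: full_norm_nonneg[OF p])
  qed (simp add: full_norm_nonneg[OF p])
  hence "(full_norm G f)\<^sup>2 \<le> (sqrt (full_norm G ?p))\<^sup>2"
    by (rule power_mono) (rule full_norm_nonneg[OF f])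
  thus ?thesis using full_norm_nonneg[OF p] by simp
qed

lemma group_algebra_star_star: "f \<in> carrier \<C> \<Longrightarrow> star \<C> (star \<C> f) = f"
  by (simp add: fun_eq_iff group_algebra_simps group_algebra_outside)

lemma full_norm_cstar:
  assumes f: "f \<in> carrier \<C>"
  shows "full_norm G (star \<C> f \<otimes>\<^bsub>\<C>\<^esub> f) = (full_norm G f)\<^sup>2"
proof -
  have le: "full_norm G f \<le> full_norm G (star \<C> f)" if f: "f \<in> carrier \<C>" for f
  proof (cases "full_norm G f = 0")
    case False
    have "full_norm G f * full_norm G f \<le> full_norm G (star \<C> f) * full_norm G f"
      using full_norm_power2_le[OF f] full_norm_mult[OF group_algebra_star_closed[OF f] f]
      by (simp add: power2_eq_square)
    thus ?thesis using False full_norm_nonneg[OF f] by simp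
  qed (simp add: full_norm_nonneg[OF group_algebra_star_closed[OF f]])
  have "full_norm G (star \<C> f) = full_norm G f"
    using le[OF f] le[OF group_algebra_star_closed[OF f]] by (simp add: group_algebra_star_star[OF f])
  thus ?thesis
    using full_norm_power2_le[OF f] full_norm_mult[OF group_algebra_star_closed[OF f] f]
    by (simp add: power2_eq_square)
qed

lemma group_algebra_smult_mult:
  assumes "f \<in> carrier \<C>" "h \<in> carrier \<C>"
  shows "(c \<odot>\<^bsub>\<C>\<^esub> f) \<otimes>\<^bsub>\<C>\<^esub> h = c \<odot>\<^bsub>\<C>\<^esub> (f \<otimes>\<^bsub>\<C>\<^esub> h)"
    and "f \<otimes>\<^bsub>\<C>\<^esub> (c \<odot>\<^bsub>\<C>\<^esub> h) = c \<odot>\<^bsub>\<C>\<^esub> (f \<otimes>\<^bsub>\<C>\<^esub> h)"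
proof -
  have fin: "finite (supp f)" using assms by (simp add: group_algebra_carrier)
  have s: "supp (c \<odot>\<^bsub>\<C>\<^esub> f) \<subseteq> supp f" by (auto simp: group_algebra_simps)
  show "(c \<odot>\<^bsub>\<C>\<^esub> f) \<otimes>\<^bsub>\<C>\<^esub> h = c \<odot>\<^bsub>\<C>\<^esub> (f \<otimes>\<^bsub>\<C>\<^esub> h)"
  proof
    fix x show "((c \<odot>\<^bsub>\<C>\<^esub> f) \<otimes>\<^bsub>\<C>\<^esub> h) x = (c \<odot>\<^bsub>\<C>\<^esub> (f \<otimes>\<^bsub>\<C>\<^esub> h)) x"
      by (cases "x \<in> carrier G")
        (simp_all add: group_algebra_mult[OF fin s] group_algebra_mult[OF fin order_refl]
          group_algebra_simps(3) group_algebra_mult_outside sum_distrib_left mult.assoc)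
  qed
  show "f \<otimes>\<^bsub>\<C>\<^esub> (c \<odot>\<^bsub>\<C>\<^esub> h) = c \<odot>\<^bsub>\<C>\<^esub> (f \<otimes>\<^bsub>\<C>\<^esub> h)"
  proof
    fix x show "(f \<otimes>\<^bsub>\<C>\<^esub> (c \<odot>\<^bsub>\<C>\<^esub> h)) x = (c \<odot>\<^bsub>\<C>\<^esub> (f \<otimes>\<^bsub>\<C>\<^esub> h)) x"
      by (cases "x \<in> carrier G")
        (simp_all add: group_algebra_mult[OF fin order_refl]
          group_algebra_simps(3) group_algebra_mult_outside sum_distrib_left mult.left_commute)
  qed
qed

theorem group_algebra_pre_cstar: "pre_cstar_algebra \<C>"
proof -
  interpret R: ring \<C> by (rule group_algebra_ring)
  interpret M: Module.module complex_ring \<C> by (rule group_algebra_module)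
  show ?thesis
  proof
    show "star \<C> (f \<oplus>\<^bsub>\<C>\<^esub> h) = star \<C> f \<oplus>\<^bsub>\<C>\<^esub> star \<C> h" for f h
      by (simp add: fun_eq_iff group_algebra_simps)
    show "star \<C> (c \<odot>\<^bsub>\<C>\<^esub> f) = cnj c \<odot>\<^bsub>\<C>\<^esub> star \<C> f" for c f
      by (simp add: fun_eq_iff group_algebra_simps)
  qed (simp_all add: group_algebra_smult_mult group_algebra_star_closed group_algebra_star_star
      group_algebra_star_mult group_algebra_simps(6) full_norm_nonneg full_norm_triangle
      full_norm_smult full_norm_mult full_norm_cstar)
qed

text \<open>
  Fell absorption for a finite group \<open>F\<close>.  Mapping \<open>\<psi>\<close> to the function \<open>g \<mapsto> U(g\<^sup>-\<^sup>1) \<psi>\<close> on \<open>F\<close> multiplies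
  norms by the square root of \<open>|F|\<close> and turns \<open>U(a)\<close> into left convolution by \<open>a\<close>, coordinate by
  coordinate.  So the norm of \<open>a\<close> in every representation is bounded by its norm in the regular
  representation of \<open>F\<close>.
\<close>

lemma full_norm_le_finite_subgroup:
  assumes F: "subgroup F G" "finite F" and a: "a \<in> carrier \<C>" "supp a \<subseteq> F" and c: "0 \<le> c"
    and le: "\<And>\<xi>. \<xi> \<in> carrier \<C> \<Longrightarrow> supp \<xi> \<subseteq> F \<Longrightarrow>
      (\<Sum>g\<in>F. (cmod ((a \<otimes>\<^bsub>\<C>\<^esub> \<xi>) g))\<^sup>2) \<le> c\<^sup>2 * (\<Sum>g\<in>F. (cmod (\<xi> g))\<^sup>2)"
  shows "full_norm G a \<le> c"
proof (rule full_norm_le[OF c])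
  fix X :: "('a \<times> nat) set" and U \<psi> assume U: "unitary_rep G X U" and psi: "\<psi> \<in> ell2 X"
  interpret unitary_representation G X U by unfold_locales (rule U)
  let ?\<phi> = "rep_extend U a \<psi>"
  have phi: "?\<phi> \<in> ell2 X" by (rule rep_extend_closed[OF a(1) psi])
  have FG: "g \<in> carrier G" if "g \<in> F" for g using that F(1) subgroup.subset by blast
  have invF: "inv g \<otimes> h \<in> F" if "g \<in> F" "h \<in> F" for g h
    using F(1) that by (simp add: subgroup.m_closed subgroup.m_inv_closed)
  have coord: "(\<Sum>g\<in>F. (cmod (U (inv g) ?\<phi> x))\<^sup>2) \<le> c\<^sup>2 * (\<Sum>g\<in>F. (cmod (U (inv g) \<psi> x))\<^sup>2)" for x
  proof -
    let ?\<xi> = "\<lambda>g. if g \<in> F then U (inv g) \<psi> x else 0"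
    have xi: "?\<xi> \<in> carrier \<C>" "supp ?\<xi> \<subseteq> F"
      using F FG by (auto simp: group_algebra_carrier intro: finite_subset[of _ F])
    have "(a \<otimes>\<^bsub>\<C>\<^esub> ?\<xi>) g = U (inv g) ?\<phi> x" if g: "g \<in> F" for g
    proof -
      have "(a \<otimes>\<^bsub>\<C>\<^esub> ?\<xi>) g = (\<Sum>h\<in>F. a h * ?\<xi> (inv h \<otimes> g))"
        by (rule group_algebra_mult[OF F(2) a(2) FG[OF g]])
      also have "\<dots> = (\<Sum>h\<in>F. a h * U (inv g) (U h \<psi>) x)"
        using FG g psi by (intro sum.cong refl) (simp add: invF inv_mult_group U_mult[symmetric])
      also have "\<dots> = U (inv g) ?\<phi> x"
        unfolding rep_extend_superset[OF F(2) a(2)] using FG g psi F(2) by (subst U_sum) auto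
      finally show ?thesis .
    qed
    thus ?thesis using le[OF xi] by simp
  qed
  \<comment> \<open>Summing over \<open>F\<close> counts the square of the norm of each vector \<open>|F|\<close> times.\<close>
  have tot: "((\<lambda>x. \<Sum>g\<in>F. (cmod (U (inv g) \<phi> x))\<^sup>2) summable_on X) \<and>
      (\<Sum>\<^sub>\<infinity>x\<in>X. \<Sum>g\<in>F. (cmod (U (inv g) \<phi> x))\<^sup>2) = real (card F) * (ell2_norm X \<phi>)\<^sup>2"
    if phi: "\<phi> \<in> ell2 X" for \<phi>
  proof -
    have s: "(\<lambda>x. (cmod (U (inv g) \<phi> x))\<^sup>2) summable_on X" if "g \<in> F" for g
      by (rule ell2_summable) (use FG[OF that] phi in auto)
    have e: "(\<Sum>\<^sub>\<infinity>x\<in>X. (cmod (U (inv g) \<phi> x))\<^sup>2) = (ell2_norm X \<phi>)\<^sup>2" if "g \<in> F" for g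
      unfolding ell2_norm_power2[symmetric] using FG[OF that] phi by (simp add: U_norm)
    have "(\<Sum>g\<in>F. \<Sum>\<^sub>\<infinity>x\<in>X. (cmod (U (inv g) \<phi> x))\<^sup>2) = (\<Sum>g\<in>F. (ell2_norm X \<phi>)\<^sup>2)"
      by (rule sum.cong[OF refl e])
    thus ?thesis using infsum_finite_sum[OF F(2) s] by simp
  qed
  have "real (card F) * (ell2_norm X ?\<phi>)\<^sup>2 \<le> (\<Sum>\<^sub>\<infinity>x\<in>X. c\<^sup>2 * (\<Sum>g\<in>F. (cmod (U (inv g) \<psi> x))\<^sup>2))"
    unfolding tot[OF phi, THEN conjunct2, symmetric]
    by (rule infsum_mono) (use tot[OF phi] tot[OF psi] coord in \<open>auto intro: summable_on_cmult_right\<close>)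
  also have "\<dots> = c\<^sup>2 * (real (card F) * (ell2_norm X \<psi>)\<^sup>2)"
    using tot[OF psi] by (subst infsum_cmult_right) auto
  finally have "real (card F) * (ell2_norm X ?\<phi>)\<^sup>2 \<le> real (card F) * (c * ell2_norm X \<psi>)\<^sup>2"
    by (simp add: power_mult_distrib mult.left_commute)
  moreover have "0 < card F" using F subgroup.one_closed[OF F(1)] by (auto simp: card_gt_0_iff)
  ultimately have "(ell2_norm X ?\<phi>)\<^sup>2 \<le> (c * ell2_norm X \<psi>)\<^sup>2" by simp
  thus "ell2_norm X ?\<phi> \<le> c * ell2_norm X \<psi>" by (rule power2_le_imp_le) (simp add: c)
qed

end

section \<open>Idempotents of characters with trivial stabiliser\<close>

context group
begin

definition delta :: "'a \<Rightarrow> 'a \<Rightarrow> complex" where "delta g = (\<lambda>x. if x = g then 1 else 0)"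

lemma delta_closed [simp, intro]: "g \<in> carrier G \<Longrightarrow> delta g \<in> carrier \<C>"
  by (auto simp: delta_def group_algebra_carrier)

lemma delta_mult_left:
  assumes "g \<in> carrier G" "x \<in> carrier G" shows "(delta g \<otimes>\<^bsub>\<C>\<^esub> f) x = f (inv g \<otimes> x)"
  by (subst group_algebra_mult[of "{g}"]) (use assms in \<open>auto simp: delta_def\<close>)

lemma delta_mult_right:
  assumes f: "f \<in> carrier \<C>" and g: "g \<in> carrier G" and x: "x \<in> carrier G"
  shows "(f \<otimes>\<^bsub>\<C>\<^esub> delta g) x = f (x \<otimes> inv g)"
proof -
  let ?S = "insert (x \<otimes> inv g) (supp f)"
  have fin: "finite ?S" using f by (simp add: group_algebra_carrier)
  have "(f \<otimes>\<^bsub>\<C>\<^esub> delta g) x = (\<Sum>y\<in>?S. f y * delta g (inv y \<otimes> x))"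
    by (rule group_algebra_mult[OF fin subset_insertI x])
  also have "\<dots> = (\<Sum>y\<in>?S. if y = x \<otimes> inv g then f (x \<otimes> inv g) else 0)"
  proof (rule sum.cong[OF refl])
    fix y assume "y \<in> ?S"
    hence y: "y \<in> carrier G" using f g x by (auto simp: group_algebra_carrier)
    have "inv y \<otimes> x = g \<longleftrightarrow> x = y \<otimes> g" by (rule inv_solve_left'[OF g y x])
    moreover have "y = x \<otimes> inv g \<longleftrightarrow> x = y \<otimes> g" by (rule inv_solve_right[OF y x g])
    ultimately have "inv y \<otimes> x = g \<longleftrightarrow> y = x \<otimes> inv g" by blast
    thus "f y * delta g (inv y \<otimes> x) = (if y = x \<otimes> inv g then f (x \<otimes> inv g) else 0)"
      by (simp add: delta_def)
  qed
  also have "\<dots> = f (x \<otimes> inv g)" using fin by (simp only: sum.delta) simp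
  finally show ?thesis .
qed

lemma delta_mult_delta:
  assumes g: "g \<in> carrier G" and h: "h \<in> carrier G" shows "delta g \<otimes>\<^bsub>\<C>\<^esub> delta h = delta (g \<otimes> h)"
proof
  fix x show "(delta g \<otimes>\<^bsub>\<C>\<^esub> delta h) x = delta (g \<otimes> h) x"
  proof (cases "x \<in> carrier G")
    case True
    have "inv g \<otimes> x = h \<longleftrightarrow> x = g \<otimes> h" using inv_solve_left[of h g x] assms True by auto
    thus ?thesis using True g by (simp add: delta_mult_left) (simp add: delta_def)
  qed (use assms in \<open>auto simp: group_algebra_mult_outside delta_def\<close>)
qed

lemma supp_mult_subgroup:
  assumes F: "subgroup F G" and a: "a \<in> carrier \<C>" "supp a \<subseteq> F" and b: "supp b \<subseteq> F"
  shows "supp (a \<otimes>\<^bsub>\<C>\<^esub> b) \<subseteq> F"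
proof -
  have "(\<lambda>(y, z). y \<otimes> z) ` (supp a \<times> supp b) \<subseteq> F"
  proof clarify
    fix y z assume "a y \<noteq> 0" "b z \<noteq> 0"
    hence "y \<in> F" "z \<in> F" using a(2) b by blast+
    thus "y \<otimes> z \<in> F" by (rule subgroup.m_closed[OF F])
  qed
  thus ?thesis by (rule order_trans[OF supp_mult[OF a(1)]])
qed

lemma supp_star_subgroup:
  assumes F: "subgroup F G" and a: "supp a \<subseteq> F" shows "supp (star \<C> a) \<subseteq> F"
proof
  fix x assume "x \<in> supp (star \<C> a)"
  hence x: "x \<in> carrier G" "a (inv x) \<noteq> 0" by (auto simp: group_algebra_simps split: if_splits)
  hence "inv x \<in> F" using a by blast
  hence "inv (inv x) \<in> F" by (rule subgroup.m_inv_closed[OF F])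
  thus "x \<in> F" using x by simp
qed

text \<open>
  The trace of \<open>a\<^sup>* a\<close> is the square of the \<open>\<ell>\<^sup>2\<close>-norm of \<open>a\<close>.
\<close>

lemma star_mult_self_one:
  assumes F: "subgroup F G" "finite F" and a: "a \<in> carrier \<C>" "supp a \<subseteq> F"
  shows "(star \<C> a \<otimes>\<^bsub>\<C>\<^esub> a) \<one> = of_real (\<Sum>g\<in>F. (cmod (a g))\<^sup>2)"
proof -
  have FG: "g \<in> carrier G" if "g \<in> F" for g using that F(1) subgroup.subset by blast
  have bij: "bij_betw (\<lambda>g. inv g) F F"
    by (rule bij_betwI[where g = "\<lambda>g. inv g"]) (use F(1) FG in \<open>auto simp: subgroup.m_inv_closed\<close>)
  have "(star \<C> a \<otimes>\<^bsub>\<C>\<^esub> a) \<one> = (\<Sum>y\<in>F. star \<C> a y * a (inv y \<otimes> \<one>))"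
    by (rule group_algebra_mult[OF F(2) supp_star_subgroup[OF F(1) a(2)] one_closed])
  also have "\<dots> = (\<Sum>y\<in>F. of_real ((cmod (a (inv y)))\<^sup>2))"
  proof (rule sum.cong[OF refl])
    fix y assume "y \<in> F"
    hence "y \<in> carrier G" by (rule FG)
    thus "star \<C> a y * a (inv y \<otimes> \<one>) = of_real ((cmod (a (inv y)))\<^sup>2)"
      unfolding complex_norm_square by (simp add: group_algebra_simps)
  qed
  also have "\<dots> = (\<Sum>y\<in>F. of_real ((cmod (a y))\<^sup>2))"
    by (rule sum.reindex_bij_betw[OF bij])
  finally show ?thesis by simp
qed

text \<open>
  The set is the kernel of the homomorphism from \<open>G\<close> to the units of the group algebra modulo \<open>J\<close>.
\<close>

lemma augmentation_normal:
  assumes J: "ideal J \<C>"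
  shows "{u \<in> carrier G. delta u \<ominus>\<^bsub>\<C>\<^esub> delta \<one> \<in> J} \<lhd> G"
proof -
  interpret J: ideal J \<C> by (rule J)
  let ?H = "{u \<in> carrier G. delta u \<ominus>\<^bsub>\<C>\<^esub> delta \<one> \<in> J}"
  have one: "\<one>\<^bsub>\<C>\<^esub> = delta \<one>" by (simp add: delta_def group_algebra_simps)
  have one': "f \<otimes>\<^bsub>\<C>\<^esub> delta \<one> = f" if "f \<in> carrier \<C>" for f
    using J.r_one[OF that] by (simp add: one)
  have lmul: "delta (g \<otimes> u) \<ominus>\<^bsub>\<C>\<^esub> delta g = delta g \<otimes>\<^bsub>\<C>\<^esub> (delta u \<ominus>\<^bsub>\<C>\<^esub> delta \<one>)"
    if "g \<in> carrier G" "u \<in> carrier G" for g u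
    using that by (simp add: J.minus_eq J.r_distr J.r_minus delta_mult_delta)
  have tr: "delta g \<ominus>\<^bsub>\<C>\<^esub> delta k \<in> J"
    if "delta g \<ominus>\<^bsub>\<C>\<^esub> delta h \<in> J" "delta h \<ominus>\<^bsub>\<C>\<^esub> delta k \<in> J"
      "g \<in> carrier G" "h \<in> carrier G" "k \<in> carrier G" for g h k
  proof -
    have "delta g \<ominus>\<^bsub>\<C>\<^esub> delta k = (delta g \<ominus>\<^bsub>\<C>\<^esub> delta h) \<oplus>\<^bsub>\<C>\<^esub> (delta h \<ominus>\<^bsub>\<C>\<^esub> delta k)"
      using that by (simp add: J.minus_eq J.a_assoc J.r_neg1)
    thus ?thesis using that by simp
  qed
  have sub: "subgroup ?H G"
  proof (rule subgroupI)
    have "delta \<one> \<ominus>\<^bsub>\<C>\<^esub> delta \<one> = \<zero>\<^bsub>\<C>\<^esub>" by (simp add: J.minus_eq J.r_neg)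
    hence "\<one> \<in> ?H" by simp
    thus "?H \<noteq> {}" by blast
  next
    fix u assume u: "u \<in> ?H"
    hence uG: "u \<in> carrier G" and uJ: "delta u \<ominus>\<^bsub>\<C>\<^esub> delta \<one> \<in> J" by auto
    have "\<ominus>\<^bsub>\<C>\<^esub> (delta (inv u) \<otimes>\<^bsub>\<C>\<^esub> (delta u \<ominus>\<^bsub>\<C>\<^esub> delta \<one>)) \<in> J"
      by (rule additive_subgroup.a_inv_closed[OF J.additive_subgroup_axioms], rule J.I_l_closed[OF uJ])
         (use uG in simp)
    also have "\<ominus>\<^bsub>\<C>\<^esub> (delta (inv u) \<otimes>\<^bsub>\<C>\<^esub> (delta u \<ominus>\<^bsub>\<C>\<^esub> delta \<one>)) = delta (inv u) \<ominus>\<^bsub>\<C>\<^esub> delta \<one>"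
      unfolding lmul[OF inv_closed[OF uG] uG, symmetric]
      using uG by (simp add: J.minus_eq J.minus_add J.a_comm)
    finally show "inv u \<in> ?H" using u by simp
  next
    fix u w assume u: "u \<in> ?H" and w: "w \<in> ?H"
    hence G: "u \<in> carrier G" "w \<in> carrier G" by auto
    have "delta (u \<otimes> w) \<ominus>\<^bsub>\<C>\<^esub> delta u \<in> J"
      unfolding lmul[OF G] by (rule J.I_l_closed) (use w G in auto)
    hence "delta (u \<otimes> w) \<ominus>\<^bsub>\<C>\<^esub> delta \<one> \<in> J"
      by (rule tr) (use u G in auto)
    thus "u \<otimes> w \<in> ?H" using G by simp
  qed auto
  show ?thesis
    unfolding normal_inv_iff
  proof (intro conjI sub ballI)
    fix g u assume g: "g \<in> carrier G" and u: "u \<in> ?H"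
    have "delta g \<otimes>\<^bsub>\<C>\<^esub> (delta u \<ominus>\<^bsub>\<C>\<^esub> delta \<one>) \<otimes>\<^bsub>\<C>\<^esub> delta (inv g) \<in> J"
      by (rule J.I_r_closed[OF J.I_l_closed]) (use g u in auto)
    also have "delta g \<otimes>\<^bsub>\<C>\<^esub> (delta u \<ominus>\<^bsub>\<C>\<^esub> delta \<one>) \<otimes>\<^bsub>\<C>\<^esub> delta (inv g) = delta (g \<otimes> u \<otimes> inv g) \<ominus>\<^bsub>\<C>\<^esub> delta \<one>"
      using g u by (simp add: J.minus_eq J.l_distr J.l_minus J.r_distr J.r_minus delta_mult_delta)
    finally show "g \<otimes> u \<otimes> inv g \<in> ?H" using g u by simp
  qed
qed

end

text \<open>
  The finite group \<open>V\<close> is normalised by \<open>F\<close>, its sign characters \<open>\<kappa> i\<close> are all conjugate in \<open>G\<close>, and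
  the distinguished one has trivial stabiliser in \<open>F\<close>.  The conditions on the sum of the \<open>\<kappa> i\<close> and on
  their number are those satisfied by the nontrivial characters of an elementary abelian
  \<open>2\<close>-group: they say that the idempotents of the \<open>\<kappa> i\<close> add up to \<open>1\<close> minus the average over \<open>V\<close>.
\<close>

locale free_character = group G for G (structure) +
  fixes F V :: "'a set" and I :: "'i set" and \<kappa> :: "'i \<Rightarrow> 'a \<Rightarrow> complex" and i0 :: 'i
  assumes F: "subgroup F G"
    and V: "subgroup V G" and finite_V: "finite V"
    and finite_I: "finite I" and i0: "i0 \<in> I"
    and chi_mult: "\<lbrakk>i \<in> I; v \<in> V; w \<in> V\<rbrakk> \<Longrightarrow> \<kappa> i (v \<otimes> w) = \<kappa> i v * \<kappa> i w"
    and chi_sign: "\<lbrakk>i \<in> I; v \<in> V\<rbrakk> \<Longrightarrow> \<kappa> i v = 1 \<or> \<kappa> i v = -1"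
    and F_conj: "\<lbrakk>f \<in> F; v \<in> V\<rbrakk> \<Longrightarrow> f \<otimes> v \<otimes> inv f \<in> V"
    and F_free: "\<lbrakk>f \<in> F; f \<noteq> \<one>\<rbrakk> \<Longrightarrow> \<exists>v\<in>V. \<kappa> i0 (f \<otimes> v \<otimes> inv f) \<noteq> \<kappa> i0 v"
    and transitive: "i \<in> I \<Longrightarrow> \<exists>g\<in>carrier G. \<forall>v\<in>V. g \<otimes> v \<otimes> inv g \<in> V \<and> \<kappa> i (g \<otimes> v \<otimes> inv g) = \<kappa> i0 v"
    and sum_chi: "\<lbrakk>v \<in> V; v \<noteq> \<one>\<rbrakk> \<Longrightarrow> (\<Sum>i\<in>I. \<kappa> i v) = -1"
    and card_I: "card V = Suc (card I)"
begin

text \<open>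
  The idempotent that projects onto the vectors on which \<open>V\<close> acts through \<open>\<kappa> i\<close>.  Since \<open>\<kappa> i\<close> takes
  the values \<open>1\<close> and \<open>-1\<close>, conjugation and inversion do not show in the formula.
\<close>

definition proj :: "'i \<Rightarrow> 'a \<Rightarrow> complex" where
  "proj i = (\<lambda>x. if x \<in> V then \<kappa> i x / of_nat (card V) else 0)"

lemma VG: "v \<in> V \<Longrightarrow> v \<in> carrier G" using V subgroup.subset by blast
lemma FG: "f \<in> F \<Longrightarrow> f \<in> carrier G" using F subgroup.subset by blast

lemma V_closed [simp]: "v \<in> V \<Longrightarrow> w \<in> V \<Longrightarrow> v \<otimes> w \<in> V" "v \<in> V \<Longrightarrow> inv v \<in> V" "\<one> \<in> V"
  using V by (simp_all add: subgroup.m_closed subgroup.m_inv_closed subgroup.one_closed)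

lemma card_V: "card V \<noteq> 0" by (simp add: card_I)

lemma supp_e: "supp (proj i) \<subseteq> V" by (auto simp: proj_def)

lemma e_closed [simp, intro]: "proj i \<in> carrier \<C>"
  using supp_e[of i] finite_V VG by (auto simp: group_algebra_carrier intro: finite_subset)

lemma chi_square: "i \<in> I \<Longrightarrow> v \<in> V \<Longrightarrow> \<kappa> i v * \<kappa> i v = 1"
  using chi_sign by fastforce

lemma chi_one: "i \<in> I \<Longrightarrow> \<kappa> i \<one> = 1"
  using chi_mult[of i \<one> \<one>] chi_square[of i \<one>] by simp

lemma chi_inv: assumes "i \<in> I" "v \<in> V" shows "\<kappa> i (inv v) = \<kappa> i v"
proof -
  have "\<kappa> i v * \<kappa> i (inv v) = \<kappa> i v * \<kappa> i v"
    using chi_mult[of i v "inv v"] assms VG by (simp add: chi_square chi_one)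
  thus ?thesis using chi_sign[OF assms] by auto
qed

lemma V_mult_iff:
  assumes "v \<in> V" "x \<in> carrier G"
  shows "inv v \<otimes> x \<in> V \<longleftrightarrow> x \<in> V" "x \<otimes> inv v \<in> V \<longleftrightarrow> x \<in> V"
proof -
  have "x \<in> V" if "inv v \<otimes> x \<in> V"
    using V_closed(1)[OF assms(1) that] assms VG by (simp add: m_assoc[symmetric])
  thus "inv v \<otimes> x \<in> V \<longleftrightarrow> x \<in> V" using assms by auto
  have "x \<in> V" if "x \<otimes> inv v \<in> V"
    using V_closed(1)[OF that assms(1)] assms VG by (simp add: m_assoc)
  thus "x \<otimes> inv v \<in> V \<longleftrightarrow> x \<in> V" using assms by auto
qed

lemma delta_e:
  assumes i: "i \<in> I" and v: "v \<in> V"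
  shows "delta v \<otimes>\<^bsub>\<C>\<^esub> proj i = \<kappa> i v \<odot>\<^bsub>\<C>\<^esub> proj i" "proj i \<otimes>\<^bsub>\<C>\<^esub> delta v = \<kappa> i v \<odot>\<^bsub>\<C>\<^esub> proj i"
proof -
  show "delta v \<otimes>\<^bsub>\<C>\<^esub> proj i = \<kappa> i v \<odot>\<^bsub>\<C>\<^esub> proj i"
  proof
    fix x show "(delta v \<otimes>\<^bsub>\<C>\<^esub> proj i) x = (\<kappa> i v \<odot>\<^bsub>\<C>\<^esub> proj i) x"
    proof (cases "x \<in> carrier G")
      case True thus ?thesis using i v VG
        by (simp add: delta_mult_left group_algebra_simps proj_def V_mult_iff chi_mult chi_inv)
    qed (auto simp: group_algebra_mult_outside group_algebra_simps proj_def VG)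
  qed
  show "proj i \<otimes>\<^bsub>\<C>\<^esub> delta v = \<kappa> i v \<odot>\<^bsub>\<C>\<^esub> proj i"
  proof
    fix x show "(proj i \<otimes>\<^bsub>\<C>\<^esub> delta v) x = (\<kappa> i v \<odot>\<^bsub>\<C>\<^esub> proj i) x"
    proof (cases "x \<in> carrier G")
      case True thus ?thesis using i v VG
        by (simp add: delta_mult_right group_algebra_simps) (simp add: proj_def V_mult_iff chi_mult chi_inv)
    qed (auto simp: group_algebra_mult_outside group_algebra_simps proj_def VG)
  qed
qed

lemma e_idem: assumes i: "i \<in> I" shows "proj i \<otimes>\<^bsub>\<C>\<^esub> proj i = proj i"
proof
  fix x show "(proj i \<otimes>\<^bsub>\<C>\<^esub> proj i) x = proj i x"
  proof (cases "x \<in> carrier G")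
    case x: True
    have "(proj i \<otimes>\<^bsub>\<C>\<^esub> proj i) x = (\<Sum>v\<in>V. proj i v * (delta v \<otimes>\<^bsub>\<C>\<^esub> proj i) x)"
      using x VG by (simp add: group_algebra_mult[OF finite_V supp_e] delta_mult_left)
    also have "\<dots> = (\<Sum>v\<in>V. proj i x / of_nat (card V))"
    proof (rule sum.cong[OF refl])
      fix v assume v: "v \<in> V"
      have "proj i v * (delta v \<otimes>\<^bsub>\<C>\<^esub> proj i) x = (\<kappa> i v * \<kappa> i v) * proj i x / of_nat (card V)"
        using v i by (simp add: delta_e group_algebra_simps) (simp add: proj_def)
      thus "proj i v * (delta v \<otimes>\<^bsub>\<C>\<^esub> proj i) x = proj i x / of_nat (card V)" using chi_square[OF i v] by simp
    qed
    also have "\<dots> = proj i x" using card_V by simp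
    finally show ?thesis .
  qed (auto simp: group_algebra_mult_outside proj_def VG)
qed

lemma e_star: assumes i: "i \<in> I" shows "star \<C> (proj i) = proj i"
proof
  fix x
  have "inv x \<in> V \<longleftrightarrow> x \<in> V" if "x \<in> carrier G" using that V_closed(2)[of "inv x"] V_closed(2)[of x] by auto
  moreover have "cnj (\<kappa> i x) = \<kappa> i x" if "x \<in> V" using chi_sign[OF i that] by auto
  ultimately show "star \<C> (proj i) x = proj i x"
    using VG by (auto simp: group_algebra_simps proj_def chi_inv[OF i])
qed

lemma full_norm_e: assumes i: "i \<in> I" shows "full_norm G (proj i) \<le> 1"
proof -
  have "full_norm G (proj i) \<le> (\<Sum>g\<in>supp (proj i). cmod (proj i g))" by (rule full_norm_le_sum) simp
  also have "\<dots> \<le> (\<Sum>g\<in>V. cmod (proj i g))" by (rule sum_mono2[OF finite_V supp_e]) simp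
  also have "\<dots> = (\<Sum>g\<in>V. 1 / real (card V))"
  proof (rule sum.cong[OF refl])
    fix g assume "g \<in> V"
    thus "cmod (proj i g) = 1 / real (card V)" using chi_sign[OF i, of g] by (auto simp: proj_def norm_divide)
  qed
  also have "\<dots> = 1" using card_V by simp
  finally show ?thesis .
qed

text \<open>
  Moving \<open>v\<close> past \<open>f\<close> multiplies the product by \<open>\<kappa> i0 v\<close> on one side and by \<open>\<kappa> i0 (f v f\<^sup>-\<^sup>1)\<close> on the other,
  and freeness provides a \<open>v\<close> for which the two differ.
\<close>

lemma e_delta_e: assumes f: "f \<in> F" "f \<noteq> \<one>" shows "proj i0 \<otimes>\<^bsub>\<C>\<^esub> delta f \<otimes>\<^bsub>\<C>\<^esub> proj i0 = \<zero>\<^bsub>\<C>\<^esub>"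
proof -
  interpret pre_cstar_algebra \<C> by (rule group_algebra_pre_cstar)
  obtain v where v: "v \<in> V" "\<kappa> i0 (f \<otimes> v \<otimes> inv f) \<noteq> \<kappa> i0 v" using F_free[OF f] by blast
  let ?w = "f \<otimes> v \<otimes> inv f" and ?E = "proj i0 \<otimes>\<^bsub>\<C>\<^esub> delta f \<otimes>\<^bsub>\<C>\<^esub> proj i0"
  have w: "?w \<in> V" by (rule F_conj[OF f(1) v(1)])
  note G = FG[OF f(1)] VG[OF v(1)] VG[OF w]
  have "\<kappa> i0 ?w \<odot>\<^bsub>\<C>\<^esub> ?E = (proj i0 \<otimes>\<^bsub>\<C>\<^esub> delta ?w) \<otimes>\<^bsub>\<C>\<^esub> delta f \<otimes>\<^bsub>\<C>\<^esub> proj i0"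
    using G by (simp add: delta_e(2)[OF i0 w] smult_mult_left)
  also have "\<dots> = proj i0 \<otimes>\<^bsub>\<C>\<^esub> (delta ?w \<otimes>\<^bsub>\<C>\<^esub> delta f) \<otimes>\<^bsub>\<C>\<^esub> proj i0" using G by (simp add: m_assoc)
  also have "delta ?w \<otimes>\<^bsub>\<C>\<^esub> delta f = delta f \<otimes>\<^bsub>\<C>\<^esub> delta v"
    using G by (simp add: delta_mult_delta group.is_monoid monoid.m_assoc[OF group.is_monoid, OF is_group])
  also have "proj i0 \<otimes>\<^bsub>\<C>\<^esub> (delta f \<otimes>\<^bsub>\<C>\<^esub> delta v) \<otimes>\<^bsub>\<C>\<^esub> proj i0 = proj i0 \<otimes>\<^bsub>\<C>\<^esub> delta f \<otimes>\<^bsub>\<C>\<^esub> (delta v \<otimes>\<^bsub>\<C>\<^esub> proj i0)"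
    using G by (simp add: m_assoc)
  also have "\<dots> = \<kappa> i0 v \<odot>\<^bsub>\<C>\<^esub> ?E" using G by (simp add: delta_e(1)[OF i0 v(1)] smult_mult_right)
  finally have "\<kappa> i0 ?w * ?E x = \<kappa> i0 v * ?E x" for x by (metis group_algebra_simps(3))
  hence "?E x = 0" for x using v(2) by simp
  thus ?thesis by (simp add: group_algebra_simps fun_eq_iff)
qed

text \<open>
  By \<open>e_delta_e\<close> only the coefficient at \<open>\<one>\<close> survives: compression by the idempotent computes the trace
  on the group algebra of \<open>F\<close>.
\<close>

lemma e_compress:
  assumes a: "a \<in> carrier \<C>" "supp a \<subseteq> F"
  shows "proj i0 \<otimes>\<^bsub>\<C>\<^esub> (a \<otimes>\<^bsub>\<C>\<^esub> proj i0) = a \<one> \<odot>\<^bsub>\<C>\<^esub> proj i0"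
proof
  interpret R: ring \<C> by (rule group_algebra_ring)
  fix x show "(proj i0 \<otimes>\<^bsub>\<C>\<^esub> (a \<otimes>\<^bsub>\<C>\<^esub> proj i0)) x = (a \<one> \<odot>\<^bsub>\<C>\<^esub> proj i0) x"
  proof (cases "x \<in> carrier G")
    case x: True
    have fin: "finite (insert \<one> (supp a))" and sG: "\<And>y. y \<in> insert \<one> (supp a) \<Longrightarrow> y \<in> carrier G"
      using a by (auto simp: group_algebra_carrier)
    have "(proj i0 \<otimes>\<^bsub>\<C>\<^esub> (a \<otimes>\<^bsub>\<C>\<^esub> proj i0)) x
        = (\<Sum>z\<in>V. proj i0 z * (\<Sum>y\<in>insert \<one> (supp a). a y * proj i0 (inv y \<otimes> (inv z \<otimes> x))))"
      using x VG by (simp add: group_algebra_mult[OF finite_V supp_e] group_algebra_mult[OF fin subset_insertI]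
          del: sum.insert)
    also have "\<dots> = (\<Sum>y\<in>insert \<one> (supp a). a y * (\<Sum>z\<in>V. proj i0 z * proj i0 (inv y \<otimes> (inv z \<otimes> x))))"
      unfolding sum_distrib_left by (subst sum.swap) (simp only: mult.left_commute)
    also have "\<dots> = (\<Sum>y\<in>insert \<one> (supp a). a y * (proj i0 \<otimes>\<^bsub>\<C>\<^esub> delta y \<otimes>\<^bsub>\<C>\<^esub> proj i0) x)"
    proof (rule sum.cong[OF refl])
      fix y assume "y \<in> insert \<one> (supp a)"
      hence y: "y \<in> carrier G" by (rule sG)
      have "(proj i0 \<otimes>\<^bsub>\<C>\<^esub> delta y \<otimes>\<^bsub>\<C>\<^esub> proj i0) x = (proj i0 \<otimes>\<^bsub>\<C>\<^esub> (delta y \<otimes>\<^bsub>\<C>\<^esub> proj i0)) x"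
        using y by (simp add: R.m_assoc)
      also have "\<dots> = (\<Sum>z\<in>V. proj i0 z * proj i0 (inv y \<otimes> (inv z \<otimes> x)))"
        using x y VG by (simp add: group_algebra_mult[OF finite_V supp_e] delta_mult_left)
      finally show "a y * (\<Sum>z\<in>V. proj i0 z * proj i0 (inv y \<otimes> (inv z \<otimes> x))) = a y * (proj i0 \<otimes>\<^bsub>\<C>\<^esub> delta y \<otimes>\<^bsub>\<C>\<^esub> proj i0) x"
        by simp
    qed
    also have "\<dots> = (\<Sum>y\<in>insert \<one> (supp a). if y = \<one> then a \<one> * proj i0 x else 0)"
    proof (rule sum.cong[OF refl])
      fix y assume y: "y \<in> insert \<one> (supp a)"
      show "a y * (proj i0 \<otimes>\<^bsub>\<C>\<^esub> delta y \<otimes>\<^bsub>\<C>\<^esub> proj i0) x = (if y = \<one> then a \<one> * proj i0 x else 0)"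
      proof (cases "y = \<one>")
        case True
        have "delta \<one> = \<one>\<^bsub>\<C>\<^esub>" by (simp add: delta_def group_algebra_simps)
        thus ?thesis using True by (simp add: e_idem[OF i0])
      next
        case False
        hence "y \<in> F" using y a by auto
        thus ?thesis using False by (simp add: e_delta_e) (simp add: group_algebra_simps)
      qed
    qed
    also have "\<dots> = a \<one> * proj i0 x" using fin by (simp only: sum.delta) simp
    finally show ?thesis by (simp add: group_algebra_simps)
  qed (auto simp: group_algebra_mult_outside group_algebra_simps proj_def VG)
qed

text \<open>
  So \<open>b \<mapsto> b e\<close> embeds \<open>\<ell>\<^sup>2(F)\<close> isometrically, with inner products in the one-dimensional corner of \<open>e\<close>.
\<close>

lemma star_mult_e:
  assumes fin: "finite F" and b: "b \<in> carrier \<C>" "supp b \<subseteq> F"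
  shows "star \<C> (b \<otimes>\<^bsub>\<C>\<^esub> proj i0) \<otimes>\<^bsub>\<C>\<^esub> (b \<otimes>\<^bsub>\<C>\<^esub> proj i0)
    = of_real (\<Sum>g\<in>F. (cmod (b g))\<^sup>2) \<odot>\<^bsub>\<C>\<^esub> proj i0"
proof -
  interpret R: ring \<C> by (rule group_algebra_ring)
  note bs = group_algebra_star_closed[OF b(1)]
  have "star \<C> (b \<otimes>\<^bsub>\<C>\<^esub> proj i0) \<otimes>\<^bsub>\<C>\<^esub> (b \<otimes>\<^bsub>\<C>\<^esub> proj i0) = proj i0 \<otimes>\<^bsub>\<C>\<^esub> ((star \<C> b \<otimes>\<^bsub>\<C>\<^esub> b) \<otimes>\<^bsub>\<C>\<^esub> proj i0)"
    using b(1) bs by (simp add: group_algebra_star_mult e_star[OF i0] R.m_assoc)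
  also have "\<dots> = (star \<C> b \<otimes>\<^bsub>\<C>\<^esub> b) \<one> \<odot>\<^bsub>\<C>\<^esub> proj i0"
    by (rule e_compress[OF R.m_closed[OF bs b(1)] supp_mult_subgroup[OF F bs supp_star_subgroup[OF F b(2)] b(2)]])
  finally show ?thesis unfolding star_mult_self_one[OF F fin b] .
qed

lemma full_norm_mult_e:
  assumes fin: "finite F" and b: "b \<in> carrier \<C>" "supp b \<subseteq> F"
  shows "(full_norm G (b \<otimes>\<^bsub>\<C>\<^esub> proj i0))\<^sup>2 \<le> (\<Sum>g\<in>F. (cmod (b g))\<^sup>2)"
proof -
  interpret R: ring \<C> by (rule group_algebra_ring)
  have "(full_norm G (b \<otimes>\<^bsub>\<C>\<^esub> proj i0))\<^sup>2 = full_norm G (of_real (\<Sum>g\<in>F. (cmod (b g))\<^sup>2) \<odot>\<^bsub>\<C>\<^esub> proj i0)"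
    unfolding star_mult_e[OF assms, symmetric]
    by (rule full_norm_cstar[symmetric]) (simp add: b)
  also have "\<dots> = (\<Sum>g\<in>F. (cmod (b g))\<^sup>2) * full_norm G (proj i0)"
    by (subst full_norm_smult[OF e_closed]) (simp add: norm_of_real sum_nonneg del: of_real_sum)
  also have "\<dots> \<le> (\<Sum>g\<in>F. (cmod (b g))\<^sup>2) * 1"
    by (intro mult_left_mono full_norm_e i0 sum_nonneg) simp
  finally show ?thesis by simp
qed

text \<open>
  Conjugation by a suitable group element carries the distinguished character to \<open>\<kappa> i\<close>; as \<open>V\<close> is finite,
  an element that conjugates \<open>V\<close> into itself conjugates it onto itself.
\<close>

lemma e_conj:
  assumes i: "i \<in> I" and J: "ideal J \<C>" and e: "proj i0 \<in> J"
  shows "proj i \<in> J"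
proof -
  interpret J: ideal J \<C> by (rule J)
  obtain g where g: "g \<in> carrier G" and gv: "\<And>v. v \<in> V \<Longrightarrow> g \<otimes> v \<otimes> inv g \<in> V"
    "\<And>v. v \<in> V \<Longrightarrow> \<kappa> i (g \<otimes> v \<otimes> inv g) = \<kappa> i0 v" using transitive[OF i] by blast
  let ?c = "\<lambda>v. g \<otimes> v \<otimes> inv g"
  have conj_inv: "?c (inv g \<otimes> x \<otimes> g) = x" if "x \<in> carrier G" for x
  proof -
    have "?c (inv g \<otimes> x \<otimes> g) = (g \<otimes> inv g) \<otimes> x \<otimes> (g \<otimes> inv g)"
      using that g by (simp only: m_assoc m_closed inv_closed)
    thus ?thesis using that g by simp
  qed
  have inv_conj: "inv g \<otimes> ?c v \<otimes> g = v" if "v \<in> carrier G" for v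
  proof -
    have "inv g \<otimes> ?c v \<otimes> g = (inv g \<otimes> g) \<otimes> v \<otimes> (inv g \<otimes> g)"
      using that g by (simp only: m_assoc m_closed inv_closed)
    thus ?thesis using that g by simp
  qed
  have "inj_on ?c V" by (rule inj_on_inverseI[where g = "\<lambda>x. inv g \<otimes> x \<otimes> g"]) (rule inv_conj[OF VG])
  hence surj: "?c ` V = V" using gv(1) finite_V by (intro endo_inj_surj) auto
  have "delta g \<otimes>\<^bsub>\<C>\<^esub> proj i0 \<otimes>\<^bsub>\<C>\<^esub> delta (inv g) \<in> J"
    using g e by (intro J.I_r_closed J.I_l_closed) auto
  also have "delta g \<otimes>\<^bsub>\<C>\<^esub> proj i0 \<otimes>\<^bsub>\<C>\<^esub> delta (inv g) = proj i"
  proof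
    fix x show "(delta g \<otimes>\<^bsub>\<C>\<^esub> proj i0 \<otimes>\<^bsub>\<C>\<^esub> delta (inv g)) x = proj i x"
    proof (cases "x \<in> carrier G")
      case x: True
      have "(delta g \<otimes>\<^bsub>\<C>\<^esub> proj i0 \<otimes>\<^bsub>\<C>\<^esub> delta (inv g)) x = proj i0 (inv g \<otimes> x \<otimes> g)"
        using x g by (simp add: delta_mult_right delta_mult_left m_assoc)
      also have "\<dots> = proj i x"
      proof (cases "x \<in> V")
        case True
        then obtain v where v: "v \<in> V" "x = ?c v" using surj by blast
        thus ?thesis using True gv(2)[OF v(1)] inv_conj[OF VG[OF v(1)]] by (simp add: proj_def)
      next
        case False
        have "inv g \<otimes> x \<otimes> g \<notin> V"
        proof
          assume "inv g \<otimes> x \<otimes> g \<in> V"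
          from gv(1)[OF this] show False using False unfolding conj_inv[OF x] by contradiction
        qed
        thus ?thesis using False by (simp add: proj_def)
      qed
      finally show ?thesis .
    qed (auto simp: group_algebra_mult_outside proj_def VG)
  qed
  finally show ?thesis .
qed

text \<open>
  The sum \<open>s\<close> of the idempotents is \<open>1\<close> minus the average over \<open>V\<close>.  Multiplication by \<open>v\<close> fixes the
  average, hence \<open>v s - s = v - 1\<close>.
\<close>

lemma V_augmentation:
  assumes J: "ideal J \<C>" and e: "proj i0 \<in> J" and v: "v \<in> V"
  shows "delta v \<ominus>\<^bsub>\<C>\<^esub> delta \<one> \<in> J"
proof -
  interpret J: ideal J \<C> by (rule J)
  interpret P: pre_cstar_algebra \<C> by (rule group_algebra_pre_cstar)
  define s where "s = (\<lambda>x. \<Sum>i\<in>I. proj i x)"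
  have "(\<lambda>x. \<Sum>i\<in>I'. proj i x) \<in> J" if "I' \<subseteq> I" for I'
    using finite_subset[OF that finite_I] that
  proof (induction rule: finite_induct)
    case empty
    have "(\<lambda>x. \<Sum>i\<in>{}. proj i x) = \<zero>\<^bsub>\<C>\<^esub>" by (simp add: group_algebra_simps)
    thus ?case by simp
  next
    case (insert i I')
    have "(\<lambda>x. \<Sum>i\<in>insert i I'. proj i x) = proj i \<oplus>\<^bsub>\<C>\<^esub> (\<lambda>x. \<Sum>i\<in>I'. proj i x)"
      using insert.hyps by (simp add: fun_eq_iff group_algebra_simps)
    thus ?case using insert e_conj[OF _ J e] by simp
  qed
  hence sJ: "s \<in> J" by (simp add: s_def)
  hence sC: "s \<in> carrier \<C>" by (rule J.a_Hcarr)
  have s_eq: "s x = (if x \<in> V then (if x = \<one> then 1 else 0) - 1 / of_nat (card V) else 0)" for x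
  proof (cases "x \<in> V")
    case True
    have "s x = (\<Sum>i\<in>I. \<kappa> i x) / of_nat (card V)"
      using True by (simp add: s_def proj_def sum_divide_distrib)
    also have "(\<Sum>i\<in>I. \<kappa> i x) = (if x = \<one> then of_nat (card V) else 0) - 1"
      using sum_chi[OF True] chi_one by (simp add: card_I)
    finally show ?thesis using True card_V by (simp add: diff_divide_distrib)
  qed (simp add: s_def proj_def)
  have "delta v \<otimes>\<^bsub>\<C>\<^esub> s \<ominus>\<^bsub>\<C>\<^esub> s \<in> J"
    unfolding J.minus_eq
    by (rule additive_subgroup.a_closed[OF J.additive_subgroup_axioms J.I_l_closed[OF sJ delta_closed[OF VG[OF v]]]
          additive_subgroup.a_inv_closed[OF J.additive_subgroup_axioms sJ]])
  also have "delta v \<otimes>\<^bsub>\<C>\<^esub> s \<ominus>\<^bsub>\<C>\<^esub> s = delta v \<ominus>\<^bsub>\<C>\<^esub> delta \<one>"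
  proof
    fix x
    have m: "(f \<ominus>\<^bsub>\<C>\<^esub> h) x = f x - h x" if "f \<in> carrier \<C>" "h \<in> carrier \<C>" for f h
      using that by (simp add: J.minus_eq P.a_inv_smult group_algebra_simps)
    have "(delta v \<otimes>\<^bsub>\<C>\<^esub> s) x - s x = delta v x - delta \<one> x"
    proof (cases "x \<in> carrier G")
      case x: True
      have 1: "inv v \<otimes> x = \<one> \<longleftrightarrow> x = v"
        using inv_solve_left[OF one_closed VG[OF v] x] VG[OF v] by auto
      have 2: "(delta v \<otimes>\<^bsub>\<C>\<^esub> s) x = s (inv v \<otimes> x)"
        by (rule delta_mult_left[OF VG[OF v] x])
      show ?thesis
      proof (cases "x \<in> V")
        case True
        thus ?thesis unfolding 2 by (simp add: s_eq 1 V_mult_iff(1)[OF v x] delta_def)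
      next
        case False
        hence "x \<noteq> v" "x \<noteq> \<one>" using v V_closed(3) by blast+
        thus ?thesis using False unfolding 2 by (simp add: s_eq V_mult_iff(1)[OF v x] delta_def)
      qed
    qed (use v VG in \<open>auto simp: group_algebra_mult_outside s_eq delta_def\<close>)
    thus "(delta v \<otimes>\<^bsub>\<C>\<^esub> s \<ominus>\<^bsub>\<C>\<^esub> s) x = (delta v \<ominus>\<^bsub>\<C>\<^esub> delta \<one>) x"
      using VG[OF v] sC by (simp add: m group_algebra_mult_closed)
  qed
  finally show ?thesis .
qed

end

section \<open>Closed ideals and closed subspaces\<close>

context pre_cstar_algebra
begin

lemma smult_1 [simp]: "x \<in> carrier A \<Longrightarrow> 1 \<odot> x = x"
  using smult_one[of x] by simp

definition closed_subspace :: "'a set \<Rightarrow> bool" where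
  "closed_subspace Y \<longleftrightarrow> Y \<subseteq> carrier A \<and> \<zero> \<in> Y \<and> (\<forall>x\<in>Y. \<forall>y\<in>Y. x \<oplus> y \<in> Y) \<and>
     (\<forall>c. \<forall>x\<in>Y. c \<odot> x \<in> Y) \<and>
     (\<forall>s a. (\<forall>n. s n \<in> Y) \<and> a \<in> carrier A \<and> tends_to_in A s a \<longrightarrow> a \<in> Y)"

lemma closed_subspaceD:
  assumes "closed_subspace Y"
  shows "x \<in> Y \<Longrightarrow> x \<in> carrier A" "\<zero> \<in> Y" "x \<in> Y \<Longrightarrow> y \<in> Y \<Longrightarrow> x \<oplus> y \<in> Y" "x \<in> Y \<Longrightarrow> c \<odot> x \<in> Y"
    "(\<And>n. s n \<in> Y) \<Longrightarrow> a \<in> carrier A \<Longrightarrow> tends_to_in A s a \<Longrightarrow> a \<in> Y"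
  using assms unfolding closed_subspace_def by blast+

lemma closed_ideal_subspace:
  assumes "closed_ideal I A" shows "closed_subspace I"
proof -
  have id: "ideal I A" using assms unfolding closed_ideal_def by (rule conjunct1)
  have sm: "\<forall>c. \<forall>x\<in>I. c \<odot> x \<in> I"
    using assms unfolding closed_ideal_def by (rule conjunct1[OF conjunct2])
  have cl: "\<forall>s a. (\<forall>n. s n \<in> I) \<and> a \<in> carrier A \<and> tends_to_in A s a \<longrightarrow> a \<in> I"
    using assms unfolding closed_ideal_def by (rule conjunct2[OF conjunct2])
  note sub = ideal.axioms(1)[OF id]
  have "I \<subseteq> carrier A" "\<zero> \<in> I" "\<forall>x\<in>I. \<forall>y\<in>I. x \<oplus> y \<in> I"
    using additive_subgroup.a_subset[OF sub] additive_subgroup.zero_closed[OF sub]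
      additive_subgroup.a_closed[OF sub] by simp_all
  thus ?thesis unfolding closed_subspace_def using sm cl by (intro conjI)
qed

text \<open>
  A Neumann series in the corner of \<open>e\<close>: for \<open>w = e - z\<close> the elements \<open>e - w\<^sup>n\<close> lie in the ideal generated
  by \<open>z\<close>, and they converge to \<open>e\<close>.
\<close>

lemma closed_ideal_idempotent:
  assumes I: "closed_ideal I A" and z: "z \<in> I" and e: "e \<in> carrier A" "e \<otimes> e = e"
    and ze: "z \<otimes> e = z" and close: "nrm A (e \<ominus> z) < 1"
  shows "e \<in> I"
proof -
  interpret I: ideal I A using I by (simp add: closed_ideal_def)
  have zA [simp]: "z \<in> carrier A" using z by (rule I.a_Hcarr)
  note [simp] = e
  define w where "w = e \<ominus> z"
  have wA [simp]: "w \<in> carrier A" by (simp add: w_def)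
  define p where "p n = ((\<lambda>x. x \<otimes> w) ^^ n) e" for n
  have p0: "p 0 = e" and pS: "p (Suc n) = p n \<otimes> w" for n by (simp_all add: p_def)
  have pA [simp]: "p n \<in> carrier A" for n by (induction n) (simp_all add: p0 pS)
  have we: "w \<otimes> e = w" by (simp add: w_def minus_eq l_distr l_minus ze)
  have pe: "p n \<otimes> e = p n" for n by (cases n) (simp_all add: p0 pS m_assoc we)
  have step: "p n \<ominus> p (Suc n) = p n \<otimes> z" for n
  proof -
    have "p n \<ominus> p (Suc n) = p n \<otimes> e \<ominus> p n \<otimes> w" by (simp add: pe pS)
    also have "\<dots> = p n \<otimes> (e \<ominus> w)" by (simp add: minus_eq r_distr r_minus)
    also have "e \<ominus> w = z" by (simp add: w_def minus_eq minus_add r_neg2)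
    finally show ?thesis .
  qed
  have inI: "e \<ominus> p n \<in> I" for n
  proof (induction n)
    case 0 show ?case by (simp add: p0 minus_eq r_neg)
  next
    case (Suc n)
    have "e \<ominus> p (Suc n) = (e \<ominus> p n) \<oplus> (p n \<ominus> p (Suc n))" by (rule minus_split) simp_all
    also have "p n \<ominus> p (Suc n) = p n \<otimes> z" by (rule step)
    finally show ?case using additive_subgroup.a_closed[OF I.additive_subgroup_axioms Suc I.I_l_closed[OF z pA]] by simp
  qed
  have bound: "nrm A (p n) \<le> nrm A e * nrm A w ^ n" for n
  proof (induction n)
    case (Suc n)
    have "nrm A (p (Suc n)) \<le> nrm A (p n) * nrm A w" unfolding pS by (rule nrm_mult) simp_all
    also have "\<dots> \<le> nrm A e * nrm A w ^ n * nrm A w" by (rule mult_right_mono[OF Suc]) (simp add: nrm_nonneg)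
    finally show ?case by (simp add: mult_ac)
  qed (simp add: p0)
  have "(\<lambda>n. nrm A e * nrm A w ^ n) \<longlonglongrightarrow> 0"
    using close nrm_nonneg[OF wA] by (intro tendsto_mult_right_zero LIMSEQ_power_zero) (simp add: w_def)
  hence "(\<lambda>n. nrm A (p n)) \<longlonglongrightarrow> 0" by (rule null_le[rotated 2]) (simp_all add: nrm_nonneg bound)
  moreover have "nrm A ((e \<ominus> p n) \<ominus> e) = nrm A (p n)" for n
  proof -
    have "(e \<ominus> p n) \<ominus> e = \<ominus> p n \<oplus> (e \<oplus> \<ominus> e)" by (simp add: minus_eq a_ac)
    hence "(e \<ominus> p n) \<ominus> e = \<ominus> p n" by (simp add: r_neg)
    thus ?thesis by (simp add: nrm_a_inv)
  qed
  ultimately have "tends_to_in A (\<lambda>n. e \<ominus> p n) e" by (simp add: tends_to_in_def)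
  thus ?thesis by (rule closed_subspaceD(5)[OF closed_ideal_subspace[OF I] inI e(1)])
qed

text \<open>
  A vector outside a closed subspace has positive distance \<open>\<delta>\<close> from it; scaling gives the general case.
\<close>

lemma closed_subspace_distance:
  assumes Y: "closed_subspace Y" and d: "d \<in> carrier A" "d \<notin> Y"
  obtains \<delta> where "0 < \<delta>" "\<And>y c. y \<in> Y \<Longrightarrow> cmod c * \<delta> \<le> nrm A (y \<oplus> c \<odot> d)"
proof -
  have "\<exists>\<delta>>0. \<forall>y\<in>Y. \<delta> \<le> nrm A (y \<ominus> d)"
  proof (rule ccontr)
    assume neg: "\<not> ?thesis"
    have ex: "\<exists>y\<in>Y. nrm A (y \<ominus> d) < inverse (real (Suc n))" for n
    proof (rule ccontr)
      assume "\<not> ?thesis"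
      hence "\<forall>y\<in>Y. inverse (real (Suc n)) \<le> nrm A (y \<ominus> d)" by (simp add: not_less)
      hence "\<exists>\<delta>>0. \<forall>y\<in>Y. \<delta> \<le> nrm A (y \<ominus> d)"
        by (intro exI[of _ "inverse (real (Suc n))"]) simp
      thus False using neg by contradiction
    qed
    have "\<forall>n. \<exists>y. y \<in> Y \<and> nrm A (y \<ominus> d) < inverse (real (Suc n))" using ex by blast
    then obtain y where y: "\<And>n. y n \<in> Y \<and> nrm A (y n \<ominus> d) < inverse (real (Suc n))"
      by (rule choice[THEN exE]) blast
    have "(\<lambda>n. nrm A (y n \<ominus> d)) \<longlonglongrightarrow> 0"
    proof (rule null_le[OF _ _ LIMSEQ_inverse_real_of_nat])
      fix n show "0 \<le> nrm A (y n \<ominus> d)" using y closed_subspaceD(1)[OF Y] d by (simp add: nrm_nonneg)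
      show "nrm A (y n \<ominus> d) \<le> inverse (real (Suc n))" using y[of n] by linarith
    qed
    hence "tends_to_in A y d" by (simp add: tends_to_in_def)
    hence "d \<in> Y" by (rule closed_subspaceD(5)[OF Y, rotated 2]) (use y d in simp_all)
    thus False using d by blast
  qed
  then obtain \<delta> where \<delta>: "0 < \<delta>" "\<And>y. y \<in> Y \<Longrightarrow> \<delta> \<le> nrm A (y \<ominus> d)" by blast
  show ?thesis
  proof (rule that[OF \<delta>(1)])
    fix y c assume y: "y \<in> Y"
    hence yA: "y \<in> carrier A" by (rule closed_subspaceD(1)[OF Y])
    show "cmod c * \<delta> \<le> nrm A (y \<oplus> c \<odot> d)"
    proof (cases "c = 0")
      case False
      let ?y = "(- inverse c) \<odot> y"
      have "(- c) \<odot> (?y \<ominus> d) = (- c) \<odot> ?y \<ominus> (- c) \<odot> d" using yA d by (simp add: minus_smult)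
      also have "(- c) \<odot> ?y = y" using smult_assoc1[of "- c" "- inverse c" y] False yA by simp
      also have "y \<ominus> (- c) \<odot> d = y \<oplus> c \<odot> d"
        using smult_assoc1[of "-1" "- c" d] d by (simp add: minus_eq a_inv_smult)
      finally have "nrm A (y \<oplus> c \<odot> d) = cmod c * nrm A (?y \<ominus> d)"
        using nrm_smult[of "?y \<ominus> d" "- c"] yA d by simp
      thus ?thesis using \<delta>(2)[OF closed_subspaceD(4)[OF Y y, of "- inverse c"]] by (simp add: mult_left_mono)
    qed (use yA d in \<open>simp add: nrm_nonneg\<close>)
  qed
qed

text \<open>
  By \<open>closed_subspace_distance\<close> the coefficients of \<open>d\<close> in a convergent sequence form a Cauchy sequence
  of complex numbers; subtracting their limit times \<open>d\<close> leaves a limit of elements of \<open>Y\<close>.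
\<close>

lemma closed_subspace_add_line:
  assumes Y: "closed_subspace Y" and d: "d \<in> carrier A"
  shows "closed_subspace {y \<oplus> c \<odot> d |y c. y \<in> Y}"
proof (cases "d \<in> Y")
  case True
  have "{y \<oplus> c \<odot> d |y c. y \<in> Y} = Y"
  proof
    show "{y \<oplus> c \<odot> d |y c. y \<in> Y} \<subseteq> Y" using True closed_subspaceD(3,4)[OF Y] by blast
    show "Y \<subseteq> {y \<oplus> c \<odot> d |y c. y \<in> Y}"
    proof
      fix y assume y: "y \<in> Y"
      hence "y = y \<oplus> 0 \<odot> d" using closed_subspaceD(1)[OF Y] d by simp
      thus "y \<in> {y \<oplus> c \<odot> d |y c. y \<in> Y}" using y by blast
    qed
  qed
  thus ?thesis using Y by simp
next
  case False
  let ?Z = "{y \<oplus> c \<odot> d |y c. y \<in> Y}"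
  note YA = closed_subspaceD(1)[OF Y]
  obtain \<delta> where \<delta>: "0 < \<delta>" "\<And>y c. y \<in> Y \<Longrightarrow> cmod c * \<delta> \<le> nrm A (y \<oplus> c \<odot> d)"
    using closed_subspace_distance[OF Y d False] by blast
  show ?thesis
    unfolding closed_subspace_def
  proof (intro conjI ballI allI impI)
    show "?Z \<subseteq> carrier A" using YA d by blast
    have "\<zero> = \<zero> \<oplus> 0 \<odot> d" using d by simp
    thus "\<zero> \<in> ?Z" using closed_subspaceD(2)[OF Y] by blast
  next
    fix x x' assume "x \<in> ?Z" "x' \<in> ?Z"
    then obtain y c y' c' where x: "x = y \<oplus> c \<odot> d" "y \<in> Y" and x': "x' = y' \<oplus> c' \<odot> d" "y' \<in> Y" by blast
    have "x \<oplus> x' = (y \<oplus> y') \<oplus> (c + c') \<odot> d"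
      using x x' YA[OF x(2)] YA[OF x'(2)] d smult_l_distr[of c c' d] by (simp add: a_ac)
    thus "x \<oplus> x' \<in> ?Z" using closed_subspaceD(3)[OF Y x(2) x'(2)] by blast
  next
    fix k x assume "x \<in> ?Z"
    then obtain y c where x: "x = y \<oplus> c \<odot> d" "y \<in> Y" by blast
    have "k \<odot> x = k \<odot> y \<oplus> (k * c) \<odot> d"
      using x YA[OF x(2)] d smult_r_distr[of k y "c \<odot> d"] smult_assoc1[of k c d] by simp
    thus "k \<odot> x \<in> ?Z" using closed_subspaceD(4)[OF Y x(2)] by blast
  next
    fix s a assume as: "(\<forall>n. s n \<in> ?Z) \<and> a \<in> carrier A \<and> tends_to_in A s a"
    hence aA: "a \<in> carrier A" and lim: "(\<lambda>n. nrm A (s n \<ominus> a)) \<longlonglongrightarrow> 0" by (auto simp: tends_to_in_def)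
    have "\<forall>n. \<exists>yc. fst yc \<in> Y \<and> s n = fst yc \<oplus> snd yc \<odot> d"
    proof
      fix n
      from as obtain y c where "y \<in> Y" "s n = y \<oplus> c \<odot> d" by blast
      thus "\<exists>yc. fst yc \<in> Y \<and> s n = fst yc \<oplus> snd yc \<odot> d" by (intro exI[of _ "(y, c)"]) simp
    qed
    then obtain yc where yc: "\<And>n. fst (yc n) \<in> Y \<and> s n = fst (yc n) \<oplus> snd (yc n) \<odot> d"
      by (rule choice[THEN exE]) blast
    define y c where "y n = fst (yc n)" and "c n = snd (yc n)" for n
    have y: "y n \<in> Y" and s: "s n = y n \<oplus> c n \<odot> d" for n using yc by (simp_all add: y_def c_def)
    have yA [simp]: "y n \<in> carrier A" for n using y YA by blast
    have sA [simp]: "s n \<in> carrier A" for n using d by (simp add: s)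
    have diff: "cmod (c m - c n) * \<delta> \<le> nrm A (s m \<ominus> a) + nrm A (s n \<ominus> a)" for m n
    proof -
      have "s m \<ominus> s n = (y m \<ominus> y n) \<oplus> (c m - c n) \<odot> d"
        using d smult_l_distr[of "c m" "- c n" d] smult_assoc1[of "-1" "c n" d]
        by (simp add: s minus_add_add) (simp add: minus_eq a_inv_smult)
      moreover have "y m \<ominus> y n \<in> Y"
        using closed_subspaceD(3)[OF Y y[of m] closed_subspaceD(4)[OF Y y[of n], of "-1"]]
        by (simp add: minus_eq a_inv_smult)
      ultimately have "cmod (c m - c n) * \<delta> \<le> nrm A (s m \<ominus> s n)" using \<delta>(2) by simp
      also have "\<dots> \<le> nrm A (s m \<ominus> a) + nrm A (s n \<ominus> a)"
        using nrm_minus_triangle[OF sA aA sA, of m n] nrm_minus_commute[OF aA sA, of n] by simp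
      finally show ?thesis .
    qed
    have "Cauchy c"
      unfolding Cauchy_def dist_norm
    proof (intro allI impI)
      fix r :: real assume "0 < r"
      hence "0 < r * \<delta> / 2" using \<delta>(1) by simp
      from order_tendstoD(2)[OF lim this]
      obtain N where N: "\<And>n. n \<ge> N \<Longrightarrow> nrm A (s n \<ominus> a) < r * \<delta> / 2"
        by (auto simp: eventually_sequentially)
      have "cmod (c m - c n) < r" if "m \<ge> N" "n \<ge> N" for m n
      proof -
        have "cmod (c m - c n) * \<delta> < r * \<delta>" using diff[of m n] N[OF that(1)] N[OF that(2)] by simp
        thus ?thesis using \<delta>(1) by simp
      qed
      thus "\<exists>M. \<forall>m\<ge>M. \<forall>n\<ge>M. norm (c m - c n) < r" by blast
    qed
    then obtain k where k: "c \<longlonglongrightarrow> k" using Cauchy_convergent convergent_def by blast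
    have b: "nrm A (y n \<ominus> (a \<ominus> k \<odot> d)) \<le> nrm A (s n \<ominus> a) + cmod (c n - k) * nrm A d" for n
    proof -
      have "y n \<ominus> (a \<ominus> k \<odot> d) = (s n \<ominus> a) \<ominus> (c n - k) \<odot> d"
      proof -
        have "(s n \<ominus> a) \<ominus> (c n - k) \<odot> d = (y n \<oplus> c n \<odot> d \<oplus> (- 1) \<odot> a) \<oplus> (k - c n) \<odot> d"
          using d aA smult_assoc1[of "-1" "c n - k" d] by (simp add: s minus_eq a_inv_smult)
        also have "(k - c n) \<odot> d = k \<odot> d \<oplus> (- c n) \<odot> d" using smult_l_distr[of k "- c n" d] d by simp
        also have "(- c n) \<odot> d = \<ominus> (c n \<odot> d)" using d smult_assoc1[of "-1" "c n" d] by (simp add: a_inv_smult)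
        also have "(y n \<oplus> c n \<odot> d \<oplus> (- 1) \<odot> a) \<oplus> (k \<odot> d \<oplus> \<ominus> (c n \<odot> d)) = y n \<oplus> ((-1) \<odot> a \<oplus> k \<odot> d)"
          using d aA by (simp add: a_ac r_neg r_neg1 r_neg2)
        also have "\<dots> = y n \<ominus> (a \<ominus> k \<odot> d)"
          using d aA by (simp add: minus_eq minus_add a_inv_smult[symmetric])
        finally show ?thesis ..
      qed
      thus ?thesis using nrm_minus_le[of "s n \<ominus> a" "(c n - k) \<odot> d"] d aA by (simp add: nrm_smult)
    qed
    have "(\<lambda>n. nrm A (s n \<ominus> a) + cmod (c n - k) * nrm A d) \<longlonglongrightarrow> 0"
      by (intro tendsto_add_zero lim tendsto_mult_left_zero tendsto_norm_zero)
         (use k in \<open>simp add: LIM_zero_iff\<close>)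
    hence "(\<lambda>n. nrm A (y n \<ominus> (a \<ominus> k \<odot> d))) \<longlonglongrightarrow> 0"
      by (rule null_le[rotated 2]) (use d aA b in \<open>simp_all add: nrm_nonneg\<close>)
    hence "a \<ominus> k \<odot> d \<in> Y"
      using closed_subspaceD(5)[OF Y, of y "a \<ominus> k \<odot> d"] y d aA by (simp add: tends_to_in_def)
    moreover have "a = (a \<ominus> k \<odot> d) \<oplus> k \<odot> d" using d aA by (simp add: minus_eq a_assoc l_neg)
    ultimately show "a \<in> ?Z" by blast
  qed
qed

text \<open>
  For an ideal \<open>Y\<close> and a set \<open>D\<close> whose span is dense modulo \<open>Y\<close>, this makes the quotient
  finite-dimensional: the sum is closed and dense, hence the whole algebra.
\<close>

lemma closed_subspace_add_span:
  assumes Y: "closed_subspace Y" and D: "finite D" "D \<subseteq> carrier A"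
  shows "closed_subspace {y \<oplus> (\<Oplus>b\<in>D. c b \<odot> b) |y c. y \<in> Y}"
  using D
proof (induction rule: finite_induct)
  case empty
  have "{y \<oplus> (\<Oplus>b\<in>{}. c b \<odot> b) |y c. y \<in> Y} = {y \<oplus> \<zero> |y. y \<in> Y}" by (simp only: finsum_empty) blast
  also have "\<dots> = (\<lambda>y. y) ` Y"
    unfolding Setcompr_eq_image by (rule image_cong[OF refl]) (simp add: closed_subspaceD(1)[OF Y])
  finally show ?case using Y by simp
next
  case (insert d D)
  hence d: "d \<in> carrier A" and DA: "D \<subseteq> carrier A" by auto
  let ?Z = "{y \<oplus> (\<Oplus>b\<in>D. c b \<odot> b) |y c. y \<in> Y}"
  have fin: "(\<Oplus>b\<in>D. c b \<odot> b) \<in> carrier A" for c using DA by (intro finsum_closed) auto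
  have ins: "(\<Oplus>b\<in>insert d D. c b \<odot> b) = c d \<odot> d \<oplus> (\<Oplus>b\<in>D. c b \<odot> b)" for c
    using insert.hyps DA d by (intro finsum_insert) auto
  have "{y \<oplus> (\<Oplus>b\<in>insert d D. c b \<odot> b) |y c. y \<in> Y} = {z \<oplus> k \<odot> d |z k. z \<in> ?Z}"
  proof
    show "{y \<oplus> (\<Oplus>b\<in>insert d D. c b \<odot> b) |y c. y \<in> Y} \<subseteq> {z \<oplus> k \<odot> d |z k. z \<in> ?Z}"
    proof
      fix x assume "x \<in> {y \<oplus> (\<Oplus>b\<in>insert d D. c b \<odot> b) |y c. y \<in> Y}"
      then obtain y c where x: "x = y \<oplus> (\<Oplus>b\<in>insert d D. c b \<odot> b)" "y \<in> Y" by blast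
      have "x = (y \<oplus> (\<Oplus>b\<in>D. c b \<odot> b)) \<oplus> c d \<odot> d"
        using x(1) closed_subspaceD(1)[OF Y x(2)] fin[of c] d by (simp add: ins a_ac)
      thus "x \<in> {z \<oplus> k \<odot> d |z k. z \<in> ?Z}" using x(2) by blast
    qed
    show "{z \<oplus> k \<odot> d |z k. z \<in> ?Z} \<subseteq> {y \<oplus> (\<Oplus>b\<in>insert d D. c b \<odot> b) |y c. y \<in> Y}"
    proof
      fix x assume "x \<in> {z \<oplus> k \<odot> d |z k. z \<in> ?Z}"
      then obtain y c k where x: "x = (y \<oplus> (\<Oplus>b\<in>D. c b \<odot> b)) \<oplus> k \<odot> d" "y \<in> Y" by blast
      let ?c = "c(d := k)"
      have "(\<Oplus>b\<in>D. ?c b \<odot> b) = (\<Oplus>b\<in>D. c b \<odot> b)"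
        using insert.hyps DA by (intro finsum_cong') auto
      hence "x = y \<oplus> (\<Oplus>b\<in>insert d D. ?c b \<odot> b)"
        using x(1) closed_subspaceD(1)[OF Y x(2)] fin[of c] d by (simp add: ins a_ac)
      thus "x \<in> {y \<oplus> (\<Oplus>b\<in>insert d D. c b \<odot> b) |y c. y \<in> Y}" using x(2) by blast
    qed
  qed
  thus ?case using closed_subspace_add_line[OF insert.IH[OF DA] d] by simp
qed

end

section \<open>Dimension of the full group C*-algebra and of its quotients\<close>

context pre_cstar_algebra
begin

text \<open>
  Injectivity on \<open>D\<close> keeps the sum over \<open>D\<close> from collapsing when it is mapped to a sum over the set of
  cosets.
\<close>

lemma quotient_finite_dimensional:
  assumes I: "closed_ideal I A" and D: "finite D" "D \<subseteq> carrier A" "inj_on (\<lambda>x. I +> x) D"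
    and span: "\<And>x. x \<in> carrier A \<Longrightarrow> \<exists>y\<in>I. \<exists>c. x = y \<oplus> (\<Oplus>b\<in>D. c b \<odot> b)"
  shows "finite_dimensional (quotient_algebra A I)"
proof -
  let ?Q = "quotient_algebra A I" and ?\<pi> = "\<lambda>x. I +> x"
  have idl: "ideal I A" using I unfolding closed_ideal_def by (rule conjunct1)
  interpret I: ideal I A by (rule idl)
  interpret Q: ring ?Q by (rule quotient_algebra_ring[OF idl])
  have IA: "y \<in> I \<Longrightarrow> y \<in> carrier A" for y by (rule I.a_Hcarr)
  have carr: "carrier ?Q = ?\<pi> ` carrier A"
    by (auto simp: quotient_algebra_def FactRing_def A_RCOSETS_def')
  have add: "?\<pi> x \<oplus>\<^bsub>?Q\<^esub> ?\<pi> y = ?\<pi> (x \<oplus> y)" if "x \<in> carrier A" "y \<in> carrier A" for x y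
    using I.a_rcos_sum[OF that] by (simp add: quotient_algebra_def FactRing_def)
  have zero: "\<zero>\<^bsub>?Q\<^esub> = ?\<pi> \<zero>"
    using a_coset_add_zero[of I] I.a_subset by (simp add: quotient_algebra_def FactRing_def)
  have abs: "?\<pi> (y \<oplus> x) = ?\<pi> x" if "y \<in> I" "x \<in> carrier A" for x y
    using a_coset_add_assoc[OF I.a_subset IA[OF that(1)] that(2)] a_rcos_zero[OF idl that(1)] by simp
  have smult: "c \<odot>\<^bsub>?Q\<^esub> ?\<pi> x = ?\<pi> (c \<odot> x)" if x: "x \<in> carrier A" for c x
  proof -
    have eq: "?\<pi> (c \<odot> a) = ?\<pi> (c \<odot> x)" if "a \<in> ?\<pi> x" for a
    proof -
      from that obtain y where y: "y \<in> I" "a = y \<oplus> x" by (auto simp: a_r_coset_def')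
      have "c \<odot> a = c \<odot> y \<oplus> c \<odot> x" using y x IA[OF y(1)] smult_r_distr[of c y x] by simp
      moreover have "c \<odot> y \<in> I" using closed_subspaceD(4)[OF closed_ideal_subspace[OF I] y(1)] .
      ultimately show ?thesis using abs[of "c \<odot> y" "c \<odot> x"] x by simp
    qed
    have "x \<in> ?\<pi> x" by (rule I.a_rcos_self[OF x])
    hence "(\<Union>a\<in>?\<pi> x. ?\<pi> (c \<odot> x)) = ?\<pi> (c \<odot> x)" by blast
    moreover have "(\<Union>a\<in>?\<pi> x. ?\<pi> (c \<odot> a)) = (\<Union>a\<in>?\<pi> x. ?\<pi> (c \<odot> x))"
      by (rule SUP_cong[OF refl eq])
    ultimately show ?thesis by (simp add: quotient_algebra_def)
  qed
  have closed: "c \<odot>\<^bsub>?Q\<^esub> ?\<pi> x \<in> carrier ?Q" if "x \<in> carrier A" for c x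
    using that by (simp add: smult carr)
  have sum: "?\<pi> (\<Oplus>b\<in>S. c b \<odot> b) = (\<Oplus>\<^bsub>?Q\<^esub>b\<in>S. c b \<odot>\<^bsub>?Q\<^esub> ?\<pi> b)" if "finite S" "S \<subseteq> carrier A" for S c
    using that
  proof (induction rule: finite_induct)
    case empty show ?case by (simp add: zero)
  next
    case (insert b S)
    hence b: "b \<in> carrier A" and S: "S \<subseteq> carrier A" by auto
    have fs: "(\<Oplus>b\<in>S. c b \<odot> b) \<in> carrier A" using S by (intro finsum_closed) auto
    have "(\<Oplus>b\<in>insert b S. c b \<odot> b) = c b \<odot> b \<oplus> (\<Oplus>b\<in>S. c b \<odot> b)"
      using insert.hyps S b by (intro finsum_insert) auto
    hence "?\<pi> (\<Oplus>b\<in>insert b S. c b \<odot> b) = c b \<odot>\<^bsub>?Q\<^esub> ?\<pi> b \<oplus>\<^bsub>?Q\<^esub> (\<Oplus>\<^bsub>?Q\<^esub>b\<in>S. c b \<odot>\<^bsub>?Q\<^esub> ?\<pi> b)"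
      using add[of "c b \<odot> b" "\<Oplus>b\<in>S. c b \<odot> b"] b fs insert.IH[OF S] by (simp add: smult)
    also have "\<dots> = (\<Oplus>\<^bsub>?Q\<^esub>b\<in>insert b S. c b \<odot>\<^bsub>?Q\<^esub> ?\<pi> b)"
      using insert.hyps S b closed by (intro Q.finsum_insert[symmetric]) auto
    finally show ?case .
  qed
  show ?thesis
    unfolding finite_dimensional_def
  proof (intro exI[of _ "?\<pi> ` D"] conjI ballI)
    show "finite (?\<pi> ` D)" using D(1) by simp
    show "?\<pi> ` D \<subseteq> carrier ?Q" using D(2) by (auto simp: carr)
    fix p assume "p \<in> carrier ?Q"
    then obtain x where x: "x \<in> carrier A" "p = ?\<pi> x" by (auto simp: carr)
    from span[OF x(1)] obtain y c where y: "y \<in> I" "x = y \<oplus> (\<Oplus>b\<in>D. c b \<odot> b)" by blast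
    have fs: "(\<Oplus>b\<in>D. c b \<odot> b) \<in> carrier A" using D by (intro finsum_closed) auto
    let ?c = "\<lambda>q. c (the_inv_into D ?\<pi> q)"
    have cl: "(\<lambda>q. ?c q \<odot>\<^bsub>?Q\<^esub> q) \<in> ?\<pi> ` D \<rightarrow> carrier ?Q" using closed D(2) by auto
    have "p = (\<Oplus>\<^bsub>?Q\<^esub>b\<in>D. c b \<odot>\<^bsub>?Q\<^esub> ?\<pi> b)"
      using abs[OF y(1) fs] sum[OF D(1,2), of c] x y by simp
    also have "\<dots> = (\<Oplus>\<^bsub>?Q\<^esub>b\<in>D. ?c (?\<pi> b) \<odot>\<^bsub>?Q\<^esub> ?\<pi> b)"
      using closed D(2) by (intro Q.finsum_cong') (auto simp: the_inv_into_f_f[OF D(3)])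
    also have "\<dots> = (\<Oplus>\<^bsub>?Q\<^esub>q\<in>?\<pi> ` D. ?c q \<odot>\<^bsub>?Q\<^esub> q)"
      by (rule Q.finsum_reindex[OF cl D(3), symmetric])
    finally show "\<exists>c. p = (\<Oplus>\<^bsub>?Q\<^esub>q\<in>?\<pi> ` D. c q \<odot>\<^bsub>?Q\<^esub> q)" by (rule exI[of _ ?c])
  qed
qed

end

text \<open>
  More unknowns than equations: if some unknown occurs in the equation \<open>b\<close>, it is eliminated, and the
  remaining equations are solved by induction.
\<close>

lemma homogeneous_system_nontrivial:
  fixes c :: "'t \<Rightarrow> 'b \<Rightarrow> complex"
  assumes "finite B" "finite T" "card B < card T"
  shows "\<exists>l. (\<exists>t\<in>T. l t \<noteq> 0) \<and> (\<forall>b\<in>B. (\<Sum>t\<in>T. l t * c t b) = 0)"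
  using assms
proof (induction B arbitrary: T c rule: finite_induct)
  case empty
  hence "T \<noteq> {}" by auto
  thus ?case by (intro exI[of _ "\<lambda>_. 1"]) auto
next
  case (insert b B)
  show ?case
  proof (cases "\<forall>t\<in>T. c t b = 0")
    case True
    have "card B < card T" using insert by simp
    from insert.IH[OF insert.prems(1) this, of c] obtain l where
      l: "\<exists>t\<in>T. l t \<noteq> 0" "\<forall>b\<in>B. (\<Sum>t\<in>T. l t * c t b) = 0" by blast
    moreover have "(\<Sum>t\<in>T. l t * c t b) = 0" using True by (simp add: sum.neutral)
    ultimately show ?thesis by (intro exI[of _ l]) simp
  next
    case False
    then obtain s where s: "s \<in> T" "c s b \<noteq> 0" by blast
    \<comment> \<open>Subtracting multiples of the equation of \<open>s\<close> removes \<open>b\<close> from the others.\<close>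
    let ?T = "T - {s}" and ?c = "\<lambda>t b'. c t b' - c t b / c s b * c s b'"
    have "finite ?T" "card B < card ?T" using insert s by simp_all
    from insert.IH[OF this, of ?c] obtain l where
      l: "\<exists>t\<in>?T. l t \<noteq> 0" "\<forall>b'\<in>B. (\<Sum>t\<in>?T. l t * ?c t b') = 0" by blast
    let ?k = "- (\<Sum>t\<in>?T. l t * c t b) / c s b"
    let ?l = "\<lambda>t. if t = s then ?k else l t"
    have tot: "(\<Sum>t\<in>T. ?l t * c t b') = ?k * c s b' + (\<Sum>t\<in>?T. l t * c t b')" for b'
    proof -
      have "(\<Sum>t\<in>T. ?l t * c t b') = ?l s * c s b' + (\<Sum>t\<in>?T. ?l t * c t b')"
        by (rule sum.remove[OF insert.prems(1) s(1)])
      also have "(\<Sum>t\<in>?T. ?l t * c t b') = (\<Sum>t\<in>?T. l t * c t b')" by (rule sum.cong) auto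
      finally show ?thesis by simp
    qed
    have "(\<Sum>t\<in>T. ?l t * c t b') = 0" if "b' \<in> insert b B" for b'
    proof (cases "b' = b")
      case True thus ?thesis using s(2) unfolding tot by simp
    next
      case False
      hence "(\<Sum>t\<in>?T. l t * ?c t b') = 0" using that l(2) by blast
      hence "(\<Sum>t\<in>?T. l t * c t b') - (\<Sum>t\<in>?T. l t * (c t b / c s b * c s b')) = 0"
        unfolding right_diff_distrib sum_subtractf .
      also have "(\<Sum>t\<in>?T. l t * (c t b / c s b * c s b')) = (\<Sum>t\<in>?T. l t * c t b) / c s b * c s b'"
        unfolding sum_divide_distrib sum_distrib_right by (rule sum.cong) simp_all
      finally show ?thesis unfolding tot by simp
    qed
    moreover have "\<exists>t\<in>T. ?l t \<noteq> 0" using l(1) by auto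
    ultimately show ?thesis by (intro exI[of _ ?l]) blast
  qed
qed

text \<open>
  A locale of its own, because the completed group algebra is again a group under addition, so that
  attaching it to every group would produce an endless sequence of interpretations.
\<close>

locale group_cstar = group G for G (structure)

sublocale group_cstar \<subseteq> CG: pre_cstar_algebra "group_algebra G" by (rule group_algebra_pre_cstar)

sublocale group_cstar \<subseteq> A: pre_cstar_algebra "completion (group_algebra G)" by (rule CG.completion_pre_cstar)

context group_cstar
begin

abbreviation CstarG ("\<A>") where "CstarG \<equiv> completion (group_algebra G)"

lemma CG_sum:
  assumes "finite S" "S \<subseteq> carrier G"
  shows "(\<lambda>x. \<Sum>g\<in>S. c g * delta g x) \<in> carrier \<C>"
proof -
  have "(\<Sum>g\<in>S. c g * delta g x) = 0" if "x \<notin> S" for x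
    by (rule sum.neutral) (use that in \<open>auto simp: delta_def\<close>)
  hence "supp (\<lambda>x. \<Sum>g\<in>S. c g * delta g x) \<subseteq> S" by blast
  thus ?thesis using assms by (auto simp: group_algebra_carrier intro: finite_subset)
qed

lemma sum_delta:
  assumes "f \<in> carrier \<C>" shows "f = (\<lambda>x. \<Sum>g\<in>supp f. f g * delta g x)"
proof
  fix x
  have fin: "finite (supp f)" using assms by (simp add: group_algebra_carrier)
  have "(\<Sum>g\<in>supp f. f g * delta g x) = (\<Sum>g\<in>supp f. if g = x then f x else 0)"
    by (rule sum.cong) (auto simp: delta_def)
  also have "\<dots> = f x" using fin by (simp add: sum.delta)
  finally show "f x = (\<Sum>g\<in>supp f. f g * delta g x)" by simp
qed

lemma CG_sum_insert:
  assumes "finite S" "g \<notin> S"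
  shows "(\<lambda>x. \<Sum>h\<in>insert g S. c h * delta h x) = (c g \<odot>\<^bsub>\<C>\<^esub> delta g) \<oplus>\<^bsub>\<C>\<^esub> (\<lambda>x. \<Sum>h\<in>S. c h * delta h x)"
  using assms by (simp add: fun_eq_iff group_algebra_simps)

text \<open>
  The group elements remain linearly independent in the completion, as the universal norm dominates
  every coefficient.
\<close>

theorem not_finite_dimensional:
  assumes inf: "infinite (carrier G)" shows "\<not> finite_dimensional \<A>"
proof
  assume "finite_dimensional \<A>"
  then obtain B where B: "finite B" "B \<subseteq> carrier \<A>"
    and span: "\<forall>a\<in>carrier \<A>. \<exists>c. a = (\<Oplus>\<^bsub>\<A>\<^esub>b\<in>B. c b \<odot>\<^bsub>\<A>\<^esub> b)"
    unfolding finite_dimensional_def by blast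
  let ?S = "\<lambda>c. \<Oplus>\<^bsub>\<A>\<^esub>b\<in>B. c b \<odot>\<^bsub>\<A>\<^esub> b"
  have Bc: "b \<in> carrier \<A>" if "b \<in> B" for b using that B by blast
  have S_closed: "?S c \<in> carrier \<A>" for c using Bc by (intro A.finsum_closed) auto
  have S_add: "?S (\<lambda>b. c b + d b) = ?S c \<oplus>\<^bsub>\<A>\<^esub> ?S d" for c d
  proof -
    have "?S (\<lambda>b. c b + d b) = (\<Oplus>\<^bsub>\<A>\<^esub>b\<in>B. c b \<odot>\<^bsub>\<A>\<^esub> b \<oplus>\<^bsub>\<A>\<^esub> d b \<odot>\<^bsub>\<A>\<^esub> b)"
    proof (rule A.finsum_cong'[OF refl])
      show "(c b + d b) \<odot>\<^bsub>\<A>\<^esub> b = c b \<odot>\<^bsub>\<A>\<^esub> b \<oplus>\<^bsub>\<A>\<^esub> d b \<odot>\<^bsub>\<A>\<^esub> b" if "b \<in> B" for b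
        using A.smult_l_distr[of "c b" "d b" b] Bc[OF that] by simp
    qed (use Bc in simp)
    thus ?thesis using Bc by (subst A.finsum_addf[symmetric]) auto
  qed
  have S_smult: "?S (\<lambda>b. k * c b) = k \<odot>\<^bsub>\<A>\<^esub> ?S c" for k c
  proof -
    have "k \<odot>\<^bsub>\<A>\<^esub> ?S c = (\<Oplus>\<^bsub>\<A>\<^esub>b\<in>B. k \<odot>\<^bsub>\<A>\<^esub> (c b \<odot>\<^bsub>\<A>\<^esub> b))"
      using Bc B(1) by (intro A.finsum_smult_ldistr) auto
    also have "\<dots> = ?S (\<lambda>b. k * c b)"
    proof (rule A.finsum_cong'[OF refl])
      show "k \<odot>\<^bsub>\<A>\<^esub> (c b \<odot>\<^bsub>\<A>\<^esub> b) = (k * c b) \<odot>\<^bsub>\<A>\<^esub> b" if "b \<in> B" for b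
        using A.smult_assoc1[of k "c b" b] Bc[OF that] by simp
    qed (use Bc in simp)
    finally show ?thesis by simp
  qed
  have S_zero: "?S (\<lambda>_. 0) = \<zero>\<^bsub>\<A>\<^esub>" using S_smult[of 0 "\<lambda>_. 0"] S_closed by simp
  obtain T where T: "T \<subseteq> carrier G" "finite T" "card T = Suc (card B)"
    using infinite_arbitrarily_large[OF inf, of "Suc (card B)"] by blast
  have "\<forall>g. \<exists>c. g \<in> carrier G \<longrightarrow> CG.emb (delta g) = ?S c"
  proof
    fix g show "\<exists>c. g \<in> carrier G \<longrightarrow> CG.emb (delta g) = ?S c"
    proof (cases "g \<in> carrier G")
      case True
      from bspec[OF span CG.emb_closed[OF delta_closed[OF True]]] show ?thesis by blast
    qed simp
  qed
  then obtain c where c: "\<And>g. g \<in> carrier G \<Longrightarrow> CG.emb (delta g) = ?S (c g)"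
    by (rule choice[THEN exE]) blast
  have "card B < card T" using T by simp
  from homogeneous_system_nontrivial[OF B(1) T(2) this, of c]
  obtain l where l: "\<exists>t\<in>T. l t \<noteq> 0" "\<forall>b\<in>B. (\<Sum>t\<in>T. l t * c t b) = 0" by blast
  have lin: "CG.emb (\<lambda>x. \<Sum>g\<in>T'. l g * delta g x) = ?S (\<lambda>b. \<Sum>g\<in>T'. l g * c g b)"
    if "finite T'" "T' \<subseteq> carrier G" for T'
    using that
  proof (induction rule: finite_induct)
    case empty
    have "(\<lambda>x. \<Sum>g\<in>{}. l g * delta g x) = \<zero>\<^bsub>\<C>\<^esub>" by (simp add: group_algebra_simps)
    thus ?case by (simp only: sum.empty S_zero CG.emb_simps(6))
  next
    case (insert g T')
    hence g: "g \<in> carrier G" and T': "T' \<subseteq> carrier G" by auto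
    have "CG.emb (\<lambda>x. \<Sum>h\<in>insert g T'. l h * delta h x)
        = l g \<odot>\<^bsub>\<A>\<^esub> CG.emb (delta g) \<oplus>\<^bsub>\<A>\<^esub> CG.emb (\<lambda>x. \<Sum>h\<in>T'. l h * delta h x)"
      unfolding CG_sum_insert[OF insert.hyps] using g CG_sum[OF insert.hyps(1) T', of l]
      by (simp add: CG.emb_simps)
    also have "\<dots> = ?S (\<lambda>b. l g * c g b + (\<Sum>h\<in>T'. l h * c h b))"
      unfolding insert.IH[OF T'] c[OF g] by (simp only: S_add S_smult)
    also have "\<dots> = ?S (\<lambda>b. \<Sum>h\<in>insert g T'. l h * c h b)" using insert.hyps by simp
    finally show ?case .
  qed
  let ?f = "\<lambda>x. \<Sum>g\<in>T. l g * delta g x"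
  have f: "?f \<in> carrier \<C>" by (rule CG_sum[OF T(2,1)])
  have "CG.emb ?f = ?S (\<lambda>b. 0)"
    unfolding lin[OF T(2,1)]
  proof (rule A.finsum_cong'[OF refl])
    show "(\<lambda>b. 0 \<odot>\<^bsub>\<A>\<^esub> b) \<in> B \<rightarrow> carrier \<A>" using Bc by simp
    show "(\<Sum>t\<in>T. l t * c t b) \<odot>\<^bsub>\<A>\<^esub> b = 0 \<odot>\<^bsub>\<A>\<^esub> b" if "b \<in> B" for b using l(2) that by simp
  qed
  hence "full_norm G ?f = 0"
    using CG.emb_nrm[OF f] by (simp add: S_zero group_algebra_simps(6))
  obtain t where t: "t \<in> T" "l t \<noteq> 0" using l(1) by blast
  have "?f t = (\<Sum>g\<in>T. if g = t then l t else 0)" by (rule sum.cong) (auto simp: delta_def)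
  hence "?f t = l t" using t T(2) by (simp add: sum.delta)
  hence "cmod (l t) \<le> full_norm G ?f" using coeff_le_full_norm[OF f, of t] t T by auto
  thus False using t(2) \<open>full_norm G ?f = 0\<close> by simp
qed

lemma closed_subspace_whole:
  assumes Z: "A.closed_subspace Z" and d: "\<And>g. g \<in> carrier G \<Longrightarrow> CG.emb (delta g) \<in> Z"
  shows "carrier \<A> \<subseteq> Z"
proof
  fix b assume b: "b \<in> carrier \<A>"
  note ZA = A.closed_subspaceD[OF Z]
  have emb: "CG.emb f \<in> Z" if f: "f \<in> carrier \<C>" for f
  proof -
    have "CG.emb (\<lambda>x. \<Sum>g\<in>S. f g * delta g x) \<in> Z" if "finite S" "S \<subseteq> carrier G" for S
      using that
    proof (induction rule: finite_induct)
      case empty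
      have "(\<lambda>x. \<Sum>g\<in>{}. f g * delta g x) = \<zero>\<^bsub>\<C>\<^esub>" by (simp add: group_algebra_simps)
      thus ?case using ZA(2) by (simp only: CG.emb_simps(6))
    next
      case (insert g S)
      hence g: "g \<in> carrier G" and S: "S \<subseteq> carrier G" by auto
      have "CG.emb (\<lambda>x. \<Sum>h\<in>insert g S. f h * delta h x)
          = f g \<odot>\<^bsub>\<A>\<^esub> CG.emb (delta g) \<oplus>\<^bsub>\<A>\<^esub> CG.emb (\<lambda>x. \<Sum>h\<in>S. f h * delta h x)"
        unfolding CG_sum_insert[OF insert.hyps] using g CG_sum[OF insert.hyps(1) S, of f]
        by (simp add: CG.emb_simps)
      thus ?case using ZA(3)[OF ZA(4)[OF d[OF g]] insert.IH[OF S]] by simp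
    qed
    hence "CG.emb (\<lambda>x. \<Sum>g\<in>supp f. f g * delta g x) \<in> Z"
      using f by (simp add: group_algebra_carrier)
    thus ?thesis by (subst sum_delta[OF f])
  qed
  have "\<forall>n. \<exists>f. f \<in> carrier \<C> \<and> nrm \<A> (b \<ominus>\<^bsub>\<A>\<^esub> CG.emb f) < inverse (real (Suc n))"
  proof
    fix n
    have "0 < inverse (real (Suc n))" by simp
    from CG.emb_dense[OF b this]
    show "\<exists>f. f \<in> carrier \<C> \<and> nrm \<A> (b \<ominus>\<^bsub>\<A>\<^esub> CG.emb f) < inverse (real (Suc n))" by blast
  qed
  then obtain f where f: "\<And>n. f n \<in> carrier \<C> \<and> nrm \<A> (b \<ominus>\<^bsub>\<A>\<^esub> CG.emb (f n)) < inverse (real (Suc n))"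
    by (rule choice[THEN exE]) blast
  have fA: "CG.emb (f n) \<in> carrier \<A>" for n using f by (simp add: CG.emb_closed)
  have le: "nrm \<A> (CG.emb (f n) \<ominus>\<^bsub>\<A>\<^esub> b) \<le> inverse (real (Suc n))" for n
    using f[of n] A.nrm_minus_commute[OF b fA, of n] by simp
  have nn: "0 \<le> nrm \<A> (CG.emb (f n) \<ominus>\<^bsub>\<A>\<^esub> b)" for n
    by (rule A.nrm_nonneg[OF A.minus_closed[OF fA b]])
  have "tends_to_in \<A> (\<lambda>n. CG.emb (f n)) b"
    unfolding tends_to_in_def by (rule null_le[OF nn le LIMSEQ_inverse_real_of_nat])
  thus "b \<in> Z" by (rule ZA(5)[rotated 2]) (use emb f b in simp_all)
qed

end

section \<open>Towers of finite groups with free characters\<close>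

text \<open>
  The last assumption expresses that \<open>F n\<close> together with the conjugates of \<open>V n\<close> generates
  \<open>F (n + 1)\<close>.  It is applied to the normal subgroup \<open>H\<close> of the group elements that a closed ideal
  identifies with \<open>1\<close>: once \<open>H\<close> contains \<open>V n\<close>, level \<open>n + 1\<close> collapses onto level \<open>n\<close>.
\<close>

locale free_tower = group_cstar G for G (structure) +
  fixes F V :: "nat \<Rightarrow> 'a set" and I :: "nat \<Rightarrow> 'i set" and \<kappa> :: "nat \<Rightarrow> 'i \<Rightarrow> 'a \<Rightarrow> complex"
    and i0 :: "nat \<Rightarrow> 'i"
  assumes free: "free_character G (F n) (V n) (I n) (\<kappa> n) (i0 n)"
    and finite_F: "finite (F n)" and F_Suc: "F n \<subseteq> F (Suc n)" and F_Union: "carrier G = (\<Union>n. F n)"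
    and infinite_carrier: "infinite (carrier G)"
    and F_step: "\<lbrakk>H \<lhd> G; V n \<subseteq> H; g \<in> F (Suc n)\<rbrakk> \<Longrightarrow> \<exists>f\<in>F n. g \<otimes> inv f \<in> H"
begin

lemma F_mono: "m \<le> n \<Longrightarrow> F m \<subseteq> F n"
  by (rule lift_Suc_mono_le[of F, OF F_Suc])

lemma F_subgroup: "subgroup (F n) G" using free[of n] by (simp add: free_character_def free_character_axioms_def)

lemma F_carrier: "g \<in> F n \<Longrightarrow> g \<in> carrier G" using F_Union by blast

lemma finite_subset_F:
  assumes "finite S" "S \<subseteq> carrier G" shows "\<exists>n. S \<subseteq> F n"
  using assms
proof (induction rule: finite_induct)
  case (insert g S)
  then obtain m n where "S \<subseteq> F m" "g \<in> F n" using F_Union by blast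
  hence "insert g S \<subseteq> F (max m n)" using F_mono[of m "max m n"] F_mono[of n "max m n"] by auto
  thus ?case by blast
qed simp

abbreviation e :: "nat \<Rightarrow> 'a \<Rightarrow> complex" where "e n \<equiv> free_character.proj (V n) (\<kappa> n) (i0 n)"

text \<open>
  With \<open>x = \<xi> e\<close> and \<open>y = a x\<close>, the element \<open>y\<^sup>* b x\<close> of \<open>J\<close> differs from \<open>y\<^sup>* a x = y\<^sup>* y = \<parallel>a \<xi>\<parallel>\<^sub>2\<^sup>2 e\<close> by at
  most \<open>\<parallel>y\<parallel> \<epsilon> \<parallel>x\<parallel> \<le> \<parallel>a \<xi>\<parallel>\<^sub>2 \<epsilon> \<parallel>\<xi>\<parallel>\<^sub>2 < \<parallel>a \<xi>\<parallel>\<^sub>2\<^sup>2\<close>.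
\<close>

lemma closed_ideal_contains_e:
  assumes J: "closed_ideal J \<A>" and ne: "J \<noteq> {\<zero>\<^bsub>\<A>\<^esub>}"
  shows "\<exists>n. \<forall>m\<ge>n. CG.emb (e m) \<in> J"
proof -
  have idl: "ideal J \<A>" using J unfolding closed_ideal_def by (rule conjunct1)
  interpret J: ideal J \<A> by (rule idl)
  have "\<zero>\<^bsub>\<A>\<^esub> \<in> J" by (rule additive_subgroup.zero_closed[OF J.additive_subgroup_axioms])
  then obtain b where bJ: "b \<in> J" and b0: "b \<noteq> \<zero>\<^bsub>\<A>\<^esub>" using ne by blast
  have b [simp]: "b \<in> carrier \<A>" using bJ by (rule J.a_Hcarr)
  have unital: "unital_cstar_algebra \<A>" by (rule CG.completion_unital_cstar)
  have "nrm \<A> b \<noteq> 0" using unital b0 b unfolding unital_cstar_algebra_iff by blast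
  hence pos: "0 < nrm \<A> b / 2" using A.nrm_nonneg[OF b] by simp
  \<comment> \<open>Half the norm of \<open>b\<close>: an element within \<open>\<epsilon>\<close> of \<open>b\<close> has norm greater than \<open>\<epsilon>\<close>.\<close>
  define \<epsilon> where "\<epsilon> = nrm \<A> b / 2"
  have eps: "0 < \<epsilon>" using pos by (simp add: \<epsilon>_def)
  obtain a where a [simp]: "a \<in> carrier \<C>" and close: "nrm \<A> (b \<ominus>\<^bsub>\<A>\<^esub> CG.emb a) < \<epsilon>"
    using CG.emb_dense[OF b eps] by blast
  note embA [simp] = CG.emb_closed
  have close': "nrm \<A> (CG.emb a \<ominus>\<^bsub>\<A>\<^esub> b) \<le> \<epsilon>"
    using close A.nrm_minus_commute[OF b embA[OF a]] by simp
  have "nrm \<A> b - nrm \<A> (CG.emb a) < \<epsilon>" using A.nrm_abs_diff[OF b embA[OF a]] close by linarith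
  hence big: "\<epsilon> < full_norm G a"
    unfolding CG.emb_nrm[OF a] group_algebra_simps(6) by (simp add: \<epsilon>_def)
  obtain n where n: "supp a \<subseteq> F n" using finite_subset_F[of "supp a"] a unfolding group_algebra_carrier by blast
  have "CG.emb (e m) \<in> J" if m: "m \<ge> n" for m
  proof -
    interpret fc: free_character G "F m" "V m" "I m" "\<kappa> m" "i0 m" by (rule free)
    note [simp] = CG.m_closed
    have am: "supp a \<subseteq> F m" using n F_mono[OF m] by blast
    have eC [simp]: "e m \<in> carrier \<C>" by (rule fc.e_closed)
    have "\<exists>\<xi>. \<xi> \<in> carrier \<C> \<and> supp \<xi> \<subseteq> F m \<and>
        \<not> (\<Sum>g\<in>F m. (cmod ((a \<otimes>\<^bsub>\<C>\<^esub> \<xi>) g))\<^sup>2) \<le> \<epsilon>\<^sup>2 * (\<Sum>g\<in>F m. (cmod (\<xi> g))\<^sup>2)"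
    proof (rule ccontr)
      assume neg: "\<not> ?thesis"
      have "full_norm G a \<le> \<epsilon>"
        by (rule full_norm_le_finite_subgroup[OF F_subgroup finite_F a am less_imp_le[OF eps]])
           (use neg in blast)
      thus False using big by simp
    qed
    then obtain \<xi> where xi [simp]: "\<xi> \<in> carrier \<C>" and xis: "supp \<xi> \<subseteq> F m"
      and gt: "\<not> (\<Sum>g\<in>F m. (cmod ((a \<otimes>\<^bsub>\<C>\<^esub> \<xi>) g))\<^sup>2) \<le> \<epsilon>\<^sup>2 * (\<Sum>g\<in>F m. (cmod (\<xi> g))\<^sup>2)"
      by blast
    define r2 s2 where "r2 = (\<Sum>g\<in>F m. (cmod ((a \<otimes>\<^bsub>\<C>\<^esub> \<xi>) g))\<^sup>2)" and "s2 = (\<Sum>g\<in>F m. (cmod (\<xi> g))\<^sup>2)"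
    have s2: "0 \<le> s2" by (simp add: s2_def sum_nonneg)
    have r2: "\<epsilon>\<^sup>2 * s2 < r2" using gt by (simp add: r2_def s2_def)
    have "0 \<le> \<epsilon>\<^sup>2 * s2" using s2 by simp
    with r2 have r2pos: "0 < r2" by linarith
    have axis: "supp (a \<otimes>\<^bsub>\<C>\<^esub> \<xi>) \<subseteq> F m" by (rule supp_mult_subgroup[OF F_subgroup a am xis])
    define x y E where "x = CG.emb (\<xi> \<otimes>\<^bsub>\<C>\<^esub> e m)" and "y = CG.emb ((a \<otimes>\<^bsub>\<C>\<^esub> \<xi>) \<otimes>\<^bsub>\<C>\<^esub> e m)" and "E = CG.emb (e m)"
    have xA [simp]: "x \<in> carrier \<A>" and yA [simp]: "y \<in> carrier \<A>" and EA [simp]: "E \<in> carrier \<A>"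
      by (simp_all add: x_def y_def E_def)
    have nx: "nrm \<A> x \<le> sqrt s2"
      using fc.full_norm_mult_e[OF finite_F xi xis] CG.emb_nrm[of "\<xi> \<otimes>\<^bsub>\<C>\<^esub> e m"]
      by (intro real_le_rsqrt) (simp add: x_def s2_def group_algebra_simps(6))
    have ny: "nrm \<A> y \<le> sqrt r2"
      using fc.full_norm_mult_e[OF finite_F CG.m_closed[OF a xi] axis] CG.emb_nrm[of "(a \<otimes>\<^bsub>\<C>\<^esub> \<xi>) \<otimes>\<^bsub>\<C>\<^esub> e m"]
      by (intro real_le_rsqrt) (simp add: y_def r2_def group_algebra_simps(6))
    have yy: "star \<A> y \<otimes>\<^bsub>\<A>\<^esub> y = of_real r2 \<odot>\<^bsub>\<A>\<^esub> E"
    proof -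
      have "star \<A> y \<otimes>\<^bsub>\<A>\<^esub> y
          = CG.emb (star \<C> ((a \<otimes>\<^bsub>\<C>\<^esub> \<xi>) \<otimes>\<^bsub>\<C>\<^esub> e m) \<otimes>\<^bsub>\<C>\<^esub> ((a \<otimes>\<^bsub>\<C>\<^esub> \<xi>) \<otimes>\<^bsub>\<C>\<^esub> e m))"
        by (simp add: y_def CG.emb_simps)
      also have "\<dots> = CG.emb (of_real r2 \<odot>\<^bsub>\<C>\<^esub> e m)"
        unfolding r2_def fc.star_mult_e[OF finite_F CG.m_closed[OF a xi] axis] ..
      finally show ?thesis by (simp add: E_def CG.emb_simps)
    qed
    have ax: "CG.emb a \<otimes>\<^bsub>\<A>\<^esub> x = y" by (simp add: x_def y_def CG.emb_simps CG.m_assoc)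
    have EE: "E \<otimes>\<^bsub>\<A>\<^esub> E = E" by (simp add: E_def CG.emb_simps fc.e_idem[OF fc.i0])
    have xE: "x \<otimes>\<^bsub>\<A>\<^esub> E = x" by (simp add: x_def E_def CG.emb_simps CG.m_assoc fc.e_idem[OF fc.i0])
    define z0 where "z0 = star \<A> y \<otimes>\<^bsub>\<A>\<^esub> (b \<otimes>\<^bsub>\<A>\<^esub> x)"
    have z0A [simp]: "z0 \<in> carrier \<A>" by (simp add: z0_def)
    define k where "k = complex_of_real (inverse r2)"
    have "z0 \<in> J" unfolding z0_def by (intro J.I_l_closed J.I_r_closed bJ xA A.star_closed yA)
    hence zJ: "k \<odot>\<^bsub>\<A>\<^esub> z0 \<in> J" by (rule A.closed_subspaceD(4)[OF A.closed_ideal_subspace[OF J]])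
    have z0E: "z0 \<otimes>\<^bsub>\<A>\<^esub> E = z0" by (simp add: z0_def A.m_assoc xE)
    have diff: "E \<ominus>\<^bsub>\<A>\<^esub> k \<odot>\<^bsub>\<A>\<^esub> z0 = k \<odot>\<^bsub>\<A>\<^esub> (star \<A> y \<otimes>\<^bsub>\<A>\<^esub> ((CG.emb a \<ominus>\<^bsub>\<A>\<^esub> b) \<otimes>\<^bsub>\<A>\<^esub> x))"
    proof -
      have "star \<A> y \<otimes>\<^bsub>\<A>\<^esub> ((CG.emb a \<ominus>\<^bsub>\<A>\<^esub> b) \<otimes>\<^bsub>\<A>\<^esub> x) = star \<A> y \<otimes>\<^bsub>\<A>\<^esub> y \<ominus>\<^bsub>\<A>\<^esub> z0"
        by (simp add: z0_def A.minus_eq A.l_distr A.r_distr A.l_minus A.r_minus ax)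
      hence "k \<odot>\<^bsub>\<A>\<^esub> (star \<A> y \<otimes>\<^bsub>\<A>\<^esub> ((CG.emb a \<ominus>\<^bsub>\<A>\<^esub> b) \<otimes>\<^bsub>\<A>\<^esub> x))
          = k \<odot>\<^bsub>\<A>\<^esub> (of_real r2 \<odot>\<^bsub>\<A>\<^esub> E) \<ominus>\<^bsub>\<A>\<^esub> k \<odot>\<^bsub>\<A>\<^esub> z0"
        by (simp add: yy A.minus_smult)
      moreover have "k \<odot>\<^bsub>\<A>\<^esub> (of_real r2 \<odot>\<^bsub>\<A>\<^esub> E) = E"
        using A.smult_assoc1[of k "of_real r2" E] r2pos by (simp add: k_def of_real_mult[symmetric] del: of_real_mult)
      ultimately show ?thesis by simp
    qed
    have "nrm \<A> (E \<ominus>\<^bsub>\<A>\<^esub> k \<odot>\<^bsub>\<A>\<^esub> z0) < 1"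
    proof -
      have "nrm \<A> (star \<A> y \<otimes>\<^bsub>\<A>\<^esub> ((CG.emb a \<ominus>\<^bsub>\<A>\<^esub> b) \<otimes>\<^bsub>\<A>\<^esub> x))
          \<le> nrm \<A> (star \<A> y) * nrm \<A> ((CG.emb a \<ominus>\<^bsub>\<A>\<^esub> b) \<otimes>\<^bsub>\<A>\<^esub> x)"
        by (rule A.nrm_mult) simp_all
      also have "\<dots> \<le> nrm \<A> (star \<A> y) * (nrm \<A> (CG.emb a \<ominus>\<^bsub>\<A>\<^esub> b) * nrm \<A> x)"
        by (intro mult_left_mono A.nrm_mult) (simp_all add: A.nrm_nonneg)
      also have "\<dots> \<le> sqrt r2 * (\<epsilon> * sqrt s2)"
        using ny nx close' eps s2 r2pos
        by (intro mult_mono) (simp_all add: A.nrm_star A.nrm_nonneg)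
      also have "\<dots> < sqrt r2 * sqrt r2"
      proof (rule mult_strict_left_mono)
        have "\<epsilon> * sqrt s2 = sqrt (\<epsilon>\<^sup>2 * s2)" using eps by (simp add: real_sqrt_mult)
        also have "\<dots> < sqrt r2" using r2 by simp
        finally show "\<epsilon> * sqrt s2 < sqrt r2" .
      qed (use r2pos in simp)
      also have "\<dots> = r2" using r2pos by simp
      finally have lt: "nrm \<A> (star \<A> y \<otimes>\<^bsub>\<A>\<^esub> ((CG.emb a \<ominus>\<^bsub>\<A>\<^esub> b) \<otimes>\<^bsub>\<A>\<^esub> x)) < r2" .
      have "nrm \<A> (E \<ominus>\<^bsub>\<A>\<^esub> k \<odot>\<^bsub>\<A>\<^esub> z0)
          = inverse r2 * nrm \<A> (star \<A> y \<otimes>\<^bsub>\<A>\<^esub> ((CG.emb a \<ominus>\<^bsub>\<A>\<^esub> b) \<otimes>\<^bsub>\<A>\<^esub> x))"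
        unfolding diff by (subst A.nrm_smult) (use r2pos in \<open>simp_all add: k_def norm_inverse\<close>)
      also have "\<dots> < inverse r2 * r2" by (rule mult_strict_left_mono[OF lt]) (use r2pos in simp)
      finally show ?thesis using r2pos by simp
    qed
    moreover have "k \<odot>\<^bsub>\<A>\<^esub> z0 \<otimes>\<^bsub>\<A>\<^esub> E = k \<odot>\<^bsub>\<A>\<^esub> z0" by (simp add: A.smult_mult_left z0E)
    ultimately have "E \<in> J" by (intro A.closed_ideal_idempotent[OF J zJ EA EE])
    thus ?thesis by (simp add: E_def)
  qed
  thus ?thesis by blast
qed

text \<open>
  Some level \<open>n\<close> is such that \<open>J\<close> contains the idempotents of all levels from \<open>n\<close> on.  Descending one
  level at a time, every group element is congruent modulo \<open>J\<close> to an element of the finite group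
  \<open>F n\<close>; as the span of the group elements is dense, \<open>F n\<close> spans the quotient.
\<close>

theorem just_infinite_full_group_cstar_algebra: "just_infinite (full_group_cstar_algebra G)"
  unfolding just_infinite_def full_group_cstar_algebra_def
proof (intro conjI allI impI)
  show "unital_cstar_algebra \<A>" by (rule CG.completion_unital_cstar)
  show "\<not> finite_dimensional \<A>" by (rule not_finite_dimensional[OF infinite_carrier])
  fix J assume J': "closed_ideal J \<A> \<and> J \<noteq> {\<zero>\<^bsub>\<A>\<^esub>}"
  hence J: "closed_ideal J \<A>" ..
  have idl: "ideal J \<A>" using J unfolding closed_ideal_def by (rule conjunct1)
  interpret J: ideal J \<A> by (rule idl)
  note Jadd = additive_subgroup.a_closed[OF J.additive_subgroup_axioms]
  note embA [simp] = CG.emb_closed[OF delta_closed]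
  obtain n where n: "\<And>m. m \<ge> n \<Longrightarrow> CG.emb (e m) \<in> J"
    using closed_ideal_contains_e[OF J conjunct2[OF J']] by blast
  have "ring_hom_ring \<C> \<A> CG.emb"
  proof (rule ring_hom_ringI[OF CG.ring_axioms A.ring_axioms])
    show "CG.emb f \<in> carrier \<A>" if "f \<in> carrier \<C>" for f by (rule CG.emb_closed[OF that])
    show "CG.emb (f \<otimes>\<^bsub>\<C>\<^esub> h) = CG.emb f \<otimes>\<^bsub>\<A>\<^esub> CG.emb h" if "f \<in> carrier \<C>" "h \<in> carrier \<C>" for f h
      by (rule CG.emb_simps(1)[OF that, symmetric])
    show "CG.emb (f \<oplus>\<^bsub>\<C>\<^esub> h) = CG.emb f \<oplus>\<^bsub>\<A>\<^esub> CG.emb h" if "f \<in> carrier \<C>" "h \<in> carrier \<C>" for f h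
      by (rule CG.emb_simps(2)[OF that, symmetric])
    show "CG.emb \<one>\<^bsub>\<C>\<^esub> = \<one>\<^bsub>\<A>\<^esub>" by (rule CG.emb_simps(5)[symmetric])
  qed
  from ring_hom_ring.ideal_vimage[OF this idl]
  have J0: "ideal {f \<in> carrier \<C>. CG.emb f \<in> J} \<C>" .
  define H where "H = {u \<in> carrier G. delta u \<ominus>\<^bsub>\<C>\<^esub> delta \<one> \<in> {f \<in> carrier \<C>. CG.emb f \<in> J}}"
  have H: "H \<lhd> G" unfolding H_def by (rule augmentation_normal[OF J0])
  interpret H: normal H G by (rule H)
  have VH: "V m \<subseteq> H" if m: "m \<ge> n" for m
  proof
    interpret fc: free_character G "F m" "V m" "I m" "\<kappa> m" "i0 m" by (rule free)
    fix v assume v: "v \<in> V m"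
    have "e m \<in> {f \<in> carrier \<C>. CG.emb f \<in> J}" using n[OF m] fc.e_closed[of "i0 m"] by blast
    note aug = fc.V_augmentation[OF J0 this v]
    show "v \<in> H" unfolding H_def by (rule CollectI, rule conjI, rule fc.VG[OF v], rule aug)
  qed
  have red: "\<exists>f\<in>F n. g \<otimes> inv f \<in> H" if "g \<in> F (n + k)" for g k
    using that
  proof (induction k arbitrary: g)
    case 0
    hence "g \<otimes> inv g \<in> H" using F_carrier[of g n] H.one_closed by simp
    moreover have "g \<in> F n" using 0 by simp
    ultimately show ?case by (rule bexI)
  next
    case (Suc k)
    have "g \<in> F (Suc (n + k))" using Suc.prems by simp
    from F_step[OF H VH[OF le_add1] this] obtain h where h: "h \<in> F (n + k)" "g \<otimes> inv h \<in> H" by blast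
    from Suc.IH[OF h(1)] obtain f where f: "f \<in> F n" "h \<otimes> inv f \<in> H" by blast
    have c: "g \<in> carrier G" "h \<in> carrier G" "f \<in> carrier G"
      using F_carrier[OF Suc.prems] F_carrier[OF h(1)] F_carrier[OF f(1)] by simp_all
    have "(g \<otimes> inv h) \<otimes> (h \<otimes> inv f) = g \<otimes> (inv h \<otimes> h) \<otimes> inv f"
      using c by (simp only: m_assoc m_closed inv_closed)
    hence "(g \<otimes> inv h) \<otimes> (h \<otimes> inv f) = g \<otimes> inv f" using c by simp
    hence "g \<otimes> inv f \<in> H" using H.m_closed[OF h(2) f(2)] by simp
    thus ?case using f(1) by (rule bexI)
  qed
  define \<pi> where "\<pi> x = J +>\<^bsub>\<A>\<^esub> x" for x
  let ?D = "(\<lambda>g. CG.emb (delta g)) ` F n"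
  have "\<exists>D. D \<subseteq> ?D \<and> inj_on \<pi> D \<and> \<pi> ` ?D = \<pi> ` D"
    by (rule subset_image_inj[THEN iffD1, OF order_refl])
  \<comment> \<open>One representative for each class modulo \<open>J\<close>.\<close>
  then obtain D where D: "D \<subseteq> ?D" "inj_on \<pi> D" "\<pi> ` ?D = \<pi> ` D" by (elim exE conjE)
  have "?D \<subseteq> carrier \<A>" by (rule image_subsetI) (rule embA[OF F_carrier])
  with D(1) have DA: "D \<subseteq> carrier \<A>" by (rule order_trans)
  have Dfin: "finite D" using finite_subset[OF D(1)] finite_F by simp
  let ?Z = "{y \<oplus>\<^bsub>\<A>\<^esub> (\<Oplus>\<^bsub>\<A>\<^esub>b\<in>D. c b \<odot>\<^bsub>\<A>\<^esub> b) |y c. y \<in> J}"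
  have Z: "A.closed_subspace ?Z"
    by (rule A.closed_subspace_add_span[OF A.closed_ideal_subspace[OF J] Dfin DA])
  have "CG.emb (delta g) \<in> ?Z" if g: "g \<in> carrier G" for g
  proof -
    obtain m where "g \<in> F m" using g F_Union by blast
    hence "g \<in> F (n + m)" by (rule subsetD[OF F_mono[OF le_add2]])
    from red[OF this] obtain f where f: "f \<in> F n" "g \<otimes> inv f \<in> H" by (rule bexE)
    have fG [simp]: "f \<in> carrier G" by (rule F_carrier[OF f(1)])
    define u where "u = g \<otimes> inv f"
    have uG [simp]: "u \<in> carrier G" using g by (simp add: u_def)
    have uf: "u \<otimes> f = g" using g by (simp add: u_def m_assoc)
    have minus: "delta k \<ominus>\<^bsub>\<C>\<^esub> delta l \<in> carrier \<C>" if "k \<in> carrier G" "l \<in> carrier G" for k l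
      by (rule CG.minus_closed[OF delta_closed[OF that(1)] delta_closed[OF that(2)]])
    have "u \<in> H" using f(2) by (simp only: u_def)
    hence "CG.emb (delta u \<ominus>\<^bsub>\<C>\<^esub> delta \<one>) \<in> J" unfolding H_def by blast
    from J.I_r_closed[OF this embA[OF fG]]
    have "CG.emb ((delta u \<ominus>\<^bsub>\<C>\<^esub> delta \<one>) \<otimes>\<^bsub>\<C>\<^esub> delta f) \<in> J"
      unfolding CG.emb_simps(1)[OF minus[OF uG one_closed] delta_closed[OF fG]] .
    moreover have "(delta u \<ominus>\<^bsub>\<C>\<^esub> delta \<one>) \<otimes>\<^bsub>\<C>\<^esub> delta f = delta g \<ominus>\<^bsub>\<C>\<^esub> delta f"
      by (simp add: CG.minus_eq CG.l_distr CG.l_minus delta_mult_delta uf)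
    ultimately have "CG.emb (delta g \<ominus>\<^bsub>\<C>\<^esub> delta f) \<in> J" by (simp only:)
    hence h1: "CG.emb (delta g) \<ominus>\<^bsub>\<A>\<^esub> CG.emb (delta f) \<in> J"
      unfolding CG.emb_minus[OF delta_closed[OF g] delta_closed[OF fG]] .
    have "\<pi> (CG.emb (delta f)) \<in> \<pi> ` D" unfolding D(3)[symmetric] using f(1) by (intro imageI)
    then obtain d where d: "d \<in> D" "\<pi> (CG.emb (delta f)) = \<pi> d" by auto
    have dA: "d \<in> carrier \<A>" using d(1) DA by blast
    have "CG.emb (delta f) \<in> \<pi> (CG.emb (delta f))" unfolding \<pi>_def by (rule J.a_rcos_self) simp
    hence "CG.emb (delta f) \<in> \<pi> d" unfolding d(2) .
    then obtain h where h2: "h \<in> J" "CG.emb (delta f) = h \<oplus>\<^bsub>\<A>\<^esub> d" by (auto simp: \<pi>_def a_r_coset_def')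
    have hA: "h \<in> carrier \<A>" using h2(1) by (rule J.a_Hcarr)
    let ?y = "(CG.emb (delta g) \<ominus>\<^bsub>\<A>\<^esub> CG.emb (delta f)) \<oplus>\<^bsub>\<A>\<^esub> h"
    have yJ: "?y \<in> J" by (rule Jadd[OF h1 h2(1)])
    have "CG.emb (delta g) = (CG.emb (delta g) \<ominus>\<^bsub>\<A>\<^esub> CG.emb (delta f)) \<oplus>\<^bsub>\<A>\<^esub> CG.emb (delta f)"
      using g by (simp add: A.minus_eq A.a_assoc A.l_neg)
    hence eq: "CG.emb (delta g) = ?y \<oplus>\<^bsub>\<A>\<^esub> d"
      using h2(2) g dA hA A.a_assoc[of "CG.emb (delta g) \<ominus>\<^bsub>\<A>\<^esub> CG.emb (delta f)" h d] by simp
    have "d = (\<Oplus>\<^bsub>\<A>\<^esub>b\<in>D. if d = b then b else \<zero>\<^bsub>\<A>\<^esub>)"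
      by (rule A.finsum_singleton[OF d(1) Dfin, symmetric]) (use DA in blast)
    also have "\<dots> = (\<Oplus>\<^bsub>\<A>\<^esub>b\<in>D. (if d = b then 1 else 0) \<odot>\<^bsub>\<A>\<^esub> b)"
    proof (rule A.finsum_cong'[OF refl])
      fix b assume "b \<in> D"
      hence "b \<in> carrier \<A>" using DA by blast
      thus "(if d = b then b else \<zero>\<^bsub>\<A>\<^esub>) = (if d = b then 1 else 0) \<odot>\<^bsub>\<A>\<^esub> b" by simp
    qed (use DA in blast)
    finally have "CG.emb (delta g) = ?y \<oplus>\<^bsub>\<A>\<^esub> (\<Oplus>\<^bsub>\<A>\<^esub>b\<in>D. (if d = b then 1 else 0) \<odot>\<^bsub>\<A>\<^esub> b)"
      using eq by simp
    thus ?thesis using yJ by (intro CollectI exI[of _ ?y] exI[of _ "\<lambda>b. if d = b then 1 else 0"] conjI)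
  qed
  from closed_subspace_whole[OF Z this] have whole: "carrier \<A> \<subseteq> ?Z" .
  show "finite_dimensional (quotient_algebra \<A> J)"
  proof (rule A.quotient_finite_dimensional[OF J Dfin DA])
    show "inj_on (\<lambda>x. J +>\<^bsub>\<A>\<^esub> x) D" using D(2) by (simp add: \<pi>_def[abs_def])
    fix x assume "x \<in> carrier \<A>"
    hence "x \<in> ?Z" using whole by (rule rev_subsetD)
    then obtain y c where "y \<in> J" "x = y \<oplus>\<^bsub>\<A>\<^esub> (\<Oplus>\<^bsub>\<A>\<^esub>b\<in>D. c b \<odot>\<^bsub>\<A>\<^esub> b)" by blast
    thus "\<exists>y\<in>J. \<exists>c. x = y \<oplus>\<^bsub>\<A>\<^esub> (\<Oplus>\<^bsub>\<A>\<^esub>b\<in>D. c b \<odot>\<^bsub>\<A>\<^esub> b)" by blast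
  qed
qed

end

section \<open>Transvections over the field with two elements\<close>

lemma odd_card_sym_diff:
  assumes "finite A" "finite B"
  shows "odd (card (sym_diff A B)) \<longleftrightarrow> odd (card A) \<noteq> odd (card B)"
proof -
  have "card (A - B \<union> (B - A)) = card (A - B) + card (B - A)"
    using assms by (intro card_Un_disjoint) auto
  moreover have "card A = card (A \<inter> B) + card (A - B)"
    using assms(1) by (subst card_Un_disjoint[symmetric]) (auto intro: arg_cong[where f = card])
  moreover have "card B = card (A \<inter> B) + card (B - A)"
    using assms(2) by (subst card_Un_disjoint[symmetric]) (auto intro: arg_cong[where f = card])
  ultimately show ?thesis by presburger
qed

text \<open>
  Sets of natural numbers form a vector space over the field with two elements, with symmetric
  difference as addition; this is its standard bilinear form.
\<close>

definition pairing :: "nat set \<Rightarrow> nat set \<Rightarrow> bool" where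
  "pairing S v \<longleftrightarrow> odd (card (S \<inter> v))"

lemma pairing_sym_diff_right:
  assumes "finite S" shows "pairing S (sym_diff v w) \<longleftrightarrow> pairing S v \<noteq> pairing S w"
proof -
  have "S \<inter> sym_diff v w = sym_diff (S \<inter> v) (S \<inter> w)" by blast
  thus ?thesis using odd_card_sym_diff[of "S \<inter> v" "S \<inter> w"] assms by (simp add: pairing_def)
qed

lemma pairing_commute: "pairing S v \<longleftrightarrow> pairing v S"
  by (simp add: pairing_def Int_commute)

lemma pairing_sym_diff_left:
  assumes "finite R" "finite S" shows "pairing (sym_diff R S) v \<longleftrightarrow> pairing R v \<noteq> pairing S v"
proof -
  have "sym_diff R S \<inter> v = sym_diff (R \<inter> v) (S \<inter> v)" by blast
  thus ?thesis using odd_card_sym_diff[of "R \<inter> v" "S \<inter> v"] assms by (simp add: pairing_def)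
qed

lemma pairing_singleton [simp]: "pairing {a} v \<longleftrightarrow> a \<in> v"
  by (cases "a \<in> v") (simp_all add: pairing_def)

lemma pairing_empty [simp]: "\<not> pairing {} v" "\<not> pairing v {}"
  by (simp_all add: pairing_def)

text \<open>
  The map \<open>v \<mapsto> v + \<langle>S, v\<rangle> w\<close>.
\<close>

definition transvection :: "nat set \<Rightarrow> nat set \<Rightarrow> nat set \<Rightarrow> nat set" where
  "transvection S w v = (if pairing S v then sym_diff v w else v)"

lemma sym_diff_cancel: "sym_diff (sym_diff v w) w = v" by blast

lemma transvection_involution:
  assumes "finite S" "\<not> pairing S w" shows "transvection S w \<circ> transvection S w = id"
proof
  fix v
  have "pairing S (sym_diff v w) \<longleftrightarrow> pairing S v" using pairing_sym_diff_right[OF assms(1), of v w] assms(2) by simp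
  thus "(transvection S w \<circ> transvection S w) v = id v"
    by (simp add: transvection_def sym_diff_cancel)
qed

lemma transvection_add:
  assumes "finite S"
  shows "transvection S w (sym_diff u v) = sym_diff (transvection S w u) (transvection S w v)"
  using pairing_sym_diff_right[OF assms, of u v]
  by (cases "pairing S u"; cases "pairing S v") (simp_all add: transvection_def, blast+)

text \<open>
  Conjugating a transvection transforms its vector by the conjugating map and its linear form by the
  inverse, here the same map.
\<close>

lemma transvection_conj:
  assumes R: "finite R" "\<not> pairing R u" and S: "\<And>v. pairing S' v \<longleftrightarrow> pairing S (transvection R u v)"
  shows "transvection R u \<circ> transvection S w \<circ> transvection R u = transvection S' (transvection R u w)"
proof
  fix v
  have inv: "transvection R u (transvection R u v) = v"
    using transvection_involution[OF R] by (simp add: fun_eq_iff)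
  show "(transvection R u \<circ> transvection S w \<circ> transvection R u) v = transvection S' (transvection R u w) v"
  proof (cases "pairing S' v")
    case True
    hence "(transvection R u \<circ> transvection S w \<circ> transvection R u) v = transvection R u (sym_diff (transvection R u v) w)"
      using S[of v] by (simp add: transvection_def[of S])
    also have "\<dots> = sym_diff v (transvection R u w)" by (simp only: transvection_add[OF R(1)] inv)
    finally show ?thesis using True by (simp add: transvection_def[of S'])
  next
    case False
    thus ?thesis using S[of v] inv by (simp add: transvection_def[of S] transvection_def[of S'])
  qed
qed

text \<open>
  For finite \<open>I\<close> the transvections are involutions, so closure under multiplication by generators makes
  this a group.
\<close>

inductive_set transvection_group :: "nat set \<Rightarrow> (nat set \<Rightarrow> nat set) set" for I :: "nat set" where
  tv_id: "id \<in> transvection_group I"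
| tv_step: "g \<in> transvection_group I \<Longrightarrow> S \<subseteq> I \<Longrightarrow> w \<subseteq> I \<Longrightarrow> \<not> pairing S w \<Longrightarrow> transvection S w \<circ> g \<in> transvection_group I"

lemma tv_transvection: "S \<subseteq> I \<Longrightarrow> w \<subseteq> I \<Longrightarrow> \<not> pairing S w \<Longrightarrow> transvection S w \<in> transvection_group I"
  using tv_step[OF tv_id] by simp

lemma tv_comp: "g \<in> transvection_group I \<Longrightarrow> h \<in> transvection_group I \<Longrightarrow> g \<circ> h \<in> transvection_group I"
proof (induction rule: transvection_group.induct)
  case (tv_step g S w)
  have "transvection S w \<circ> (g \<circ> h) \<in> transvection_group I"
    by (rule transvection_group.tv_step[OF tv_step.IH[OF tv_step.prems] tv_step.hyps(2-4)])
  thus ?case by (simp only: comp_assoc)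
qed simp

lemma tv_inverse:
  assumes I: "finite I" and g: "g \<in> transvection_group I"
  shows "\<exists>h\<in>transvection_group I. h \<circ> g = id \<and> g \<circ> h = id"
  using g
proof (induction rule: transvection_group.induct)
  case tv_id
  show ?case by (rule bexI[OF _ transvection_group.tv_id]) simp
next
  case (tv_step g S w)
  then obtain h where h: "h \<in> transvection_group I" "h \<circ> g = id" "g \<circ> h = id" by blast
  let ?T = "transvection S w"
  have T: "?T \<in> transvection_group I" by (rule tv_transvection) (use tv_step in simp_all)
  have TT: "?T \<circ> ?T = id" by (rule transvection_involution) (use I tv_step in \<open>auto intro: finite_subset\<close>)
  have "(h \<circ> ?T) \<circ> (?T \<circ> g) = h \<circ> (?T \<circ> ?T) \<circ> g" by (simp only: comp_assoc)
  moreover have "(?T \<circ> g) \<circ> (h \<circ> ?T) = ?T \<circ> (g \<circ> h) \<circ> ?T" by (simp only: comp_assoc)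
  ultimately have "(h \<circ> ?T) \<circ> (?T \<circ> g) = id \<and> (?T \<circ> g) \<circ> (h \<circ> ?T) = id" by (simp add: TT h)
  thus ?case using tv_comp[OF h(1) T] by (rule bexI)
qed

lemma tv_bij: assumes "finite I" "g \<in> transvection_group I" shows "bij g"
  using tv_inverse[OF assms] o_bij by blast

lemma tv_inv: assumes "finite I" "g \<in> transvection_group I" shows "inv_into UNIV g \<in> transvection_group I"
proof -
  obtain h where "h \<in> transvection_group I" "h \<circ> g = id" "g \<circ> h = id" using tv_inverse[OF assms] by blast
  thus ?thesis using inv_unique_comp[of g h] by simp
qed

text \<open>
  The maps act on the part of a set inside \<open>I\<close> and leave the part outside alone; so they are determined
  by their values on the finitely many subsets of \<open>I\<close>.
\<close>

lemma tv_support: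
  assumes "g \<in> transvection_group I"
  shows "g (v \<inter> I) \<subseteq> I \<and> g v = g (v \<inter> I) \<union> (v - I)"
  using assms
proof (induction rule: transvection_group.induct)
  case (tv_step g S w)
  let ?a = "g (v \<inter> I)"
  have IH: "?a \<subseteq> I" "g v = ?a \<union> (v - I)" using tv_step.IH by blast+
  have "S \<inter> g v = S \<inter> ?a" using IH tv_step.hyps(2) by blast
  hence "pairing S (g v) \<longleftrightarrow> pairing S ?a" by (simp add: pairing_def)
  moreover have "sym_diff (?a \<union> (v - I)) w = sym_diff ?a w \<union> (v - I)" using IH tv_step.hyps(3) by blast
  moreover have "sym_diff ?a w \<subseteq> I" using IH tv_step.hyps(3) by blast
  ultimately show ?case using IH by (simp add: transvection_def)
qed auto

lemma finite_transvection_group: assumes I: "finite I" shows "finite (transvection_group I)"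
proof (rule inj_on_finite[of "\<lambda>g. restrict g (Pow I)"])
  show "inj_on (\<lambda>g. restrict g (Pow I)) (transvection_group I)"
  proof (rule inj_onI, rule ext)
    fix g h v assume gh: "g \<in> transvection_group I" "h \<in> transvection_group I" "restrict g (Pow I) = restrict h (Pow I)"
    have "g (v \<inter> I) = h (v \<inter> I)" using fun_cong[OF gh(3), of "v \<inter> I"] by simp
    thus "g v = h v" using tv_support[OF gh(1), of v] tv_support[OF gh(2), of v] by simp
  qed
  show "(\<lambda>g. restrict g (Pow I)) ` transvection_group I \<subseteq> Pow I \<rightarrow>\<^sub>E Pow I"
  proof (rule image_subsetI)
    fix g assume g: "g \<in> transvection_group I"
    show "restrict g (Pow I) \<in> Pow I \<rightarrow>\<^sub>E Pow I"
    proof (rule restrict_PiE_iff[THEN iffD2], rule ballI)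
      fix v assume "v \<in> Pow I"
      hence "v \<inter> I = v" by blast
      thus "g v \<in> Pow I" using tv_support[OF g, of v] by simp
    qed
  qed
  show "finite (Pow I \<rightarrow>\<^sub>E Pow I)" using I by (intro finite_PiE) simp_all
qed

text \<open>
  Exchanging two coordinates adds \<open>e\<^sub>a + e\<^sub>b\<close> exactly if the two coordinates differ.
\<close>

lemma image_transpose:
  assumes "a \<noteq> b" shows "(\<lambda>v. Transposition.transpose a b ` v) = transvection {a, b} {a, b}"
proof
  fix v
  have mem: "x \<in> Transposition.transpose a b ` v \<longleftrightarrow> Transposition.transpose a b x \<in> v" for x by (rule in_transpose_image_iff)
  show "Transposition.transpose a b ` v = transvection {a, b} {a, b} v"
  proof (cases "a \<in> v \<longleftrightarrow> b \<in> v")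
    case True
    have "Transposition.transpose a b ` v = v"
    proof (rule Set.set_eqI)
      fix x show "x \<in> Transposition.transpose a b ` v \<longleftrightarrow> x \<in> v"
        unfolding mem using True by (cases "x = a"; cases "x = b") (simp_all add: transpose_apply_other)
    qed
    moreover have "\<not> pairing {a, b} v"
    proof (cases "a \<in> v")
      case a: True
      hence "{a, b} \<inter> v = {a, b}" using True by blast
      thus ?thesis using assms by (simp add: pairing_def)
    next
      case False
      hence "{a, b} \<inter> v = {}" using True by blast
      thus ?thesis by (simp add: pairing_def)
    qed
    ultimately show ?thesis by (simp add: transvection_def)
  next
    case False
    have "Transposition.transpose a b ` v = sym_diff v {a, b}"
    proof (rule Set.set_eqI)
      fix x show "x \<in> Transposition.transpose a b ` v \<longleftrightarrow> x \<in> sym_diff v {a, b}"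
        unfolding mem using False by (cases "x = a"; cases "x = b") (auto simp: transpose_apply_other)
    qed
    moreover have "pairing {a, b} v"
    proof (cases "a \<in> v")
      case True
      hence "{a, b} \<inter> v = {a}" using False by blast
      thus ?thesis by (simp add: pairing_def)
    next
      case a: False
      hence "{a, b} \<inter> v = {b}" using False by blast
      thus ?thesis by (simp add: pairing_def)
    qed
    ultimately show ?thesis by (simp add: transvection_def)
  qed
qed

lemma image_permutes_tv:
  assumes "finite J" "J \<subseteq> I" "p permutes J" shows "(\<lambda>v. p ` v) \<in> transvection_group I"
  using assms(3,1)
proof (induction rule: permutes_induct)
  case id
  have "(\<lambda>v. id ` v) = (id :: nat set \<Rightarrow> nat set)" by (simp add: fun_eq_iff)
  thus ?case using tv_id by simp
next
  case (swap a b p)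
  have "(\<lambda>v. (Transposition.transpose a b \<circ> p) ` v) = (\<lambda>v. Transposition.transpose a b ` v) \<circ> (\<lambda>v. p ` v)"
    by (simp add: fun_eq_iff image_comp)
  also have "\<dots> = transvection {a, b} {a, b} \<circ> (\<lambda>v. p ` v)" by (simp only: image_transpose[OF swap.hyps(3)])
  also have "\<dots> \<in> transvection_group I"
  proof (rule tv_step[OF swap.IH])
    show "{a, b} \<subseteq> I" "{a, b} \<subseteq> I" using swap.hyps(1,2) assms(2) by blast+
    show "\<not> pairing {a, b} {a, b}" using swap.hyps(3) by (simp add: pairing_def)
  qed
  finally show ?case .
qed

lemma image_bij_conj_transvection:
  assumes p: "bij p"
  shows "(\<lambda>v. p ` v) \<circ> transvection S w \<circ> (\<lambda>v. inv_into UNIV p ` v) = transvection (p ` S) (p ` w)"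
proof
  fix v
  have pv: "p ` (inv_into UNIV p ` v) = v" using p by (simp add: image_f_inv_f bij_is_surj)
  have "p ` S \<inter> v = p ` (S \<inter> inv_into UNIV p ` v)"
    using p by (simp add: image_Int bij_is_inj pv)
  hence "card (p ` S \<inter> v) = card (S \<inter> inv_into UNIV p ` v)"
    using p by (simp add: card_image inj_on_subset[OF bij_is_inj])
  hence pr: "pairing (p ` S) v \<longleftrightarrow> pairing S (inv_into UNIV p ` v)" by (simp add: pairing_def)
  have sd: "p ` sym_diff (inv_into UNIV p ` v) w = sym_diff v (p ` w)"
    using p by (simp add: image_Un image_set_diff bij_is_inj pv)
  show "((\<lambda>v. p ` v) \<circ> transvection S w \<circ> (\<lambda>v. inv_into UNIV p ` v)) v = transvection (p ` S) (p ` w) v"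
    by (simp add: transvection_def pr sd pv)
qed

text \<open>
  If the forms given by \<open>S\<close> and \<open>{j}\<close> are distinct and nonzero, some \<open>u\<close> takes the value \<open>1\<close> under both.
  The transvection with vector \<open>u\<close> and form \<open>S + {j}\<close> then exchanges the two forms.  This is the source
  of transitivity, both on characters and on transvections.
\<close>

lemma common_witness:
  assumes "S \<noteq> {}" "S \<noteq> {j}"
  obtains u where "u \<subseteq> insert j S" "finite u" "pairing S u" "j \<in> u"
proof (cases "j \<in> S")
  case True
  have "S \<inter> {j} = {j}" using True by blast
  hence "pairing S {j}" by (simp add: pairing_def)
  thus ?thesis by (intro that[of "{j}"]) simp_all
next
  case False
  then obtain s where s: "s \<in> S" "s \<noteq> j" using assms(1) by blast
  have "S \<inter> {s, j} = {s}" using s False by blast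
  hence "pairing S {s, j}" by (simp add: pairing_def)
  thus ?thesis using s by (intro that[of "{s, j}"]) simp_all
qed

text \<open>
  Adding a fixed element of \<open>w\<close> to \<open>S\<close>, or removing it, reverses the sign.
\<close>

lemma sum_sign_Pow:
  assumes I: "finite I" and w: "w \<subseteq> I" "w \<noteq> {}"
  shows "(\<Sum>S\<in>Pow I. if pairing S w then -1 else 1 :: complex) = 0"
proof -
  obtain i where i: "i \<in> w" using w(2) by blast
  let ?s = "\<lambda>S. if pairing S w then -1 else 1 :: complex"
  have PI: "Pow I = Pow (I - {i}) \<union> insert i ` Pow (I - {i})"
    using Pow_insert[of i "I - {i}"] i w(1) by (simp add: insert_absorb subsetD)
  have inj: "inj_on (insert i) (Pow (I - {i}))" by (rule inj_onI) blast
  have flip: "?s (insert i S) = - ?s S" if "S \<in> Pow (I - {i})" for S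
  proof -
    have fS: "finite S" using that I by (auto intro: finite_subset)
    have "insert i S = sym_diff S {i}" using that by blast
    hence "pairing (insert i S) w \<longleftrightarrow> \<not> pairing S w"
      using pairing_sym_diff_left[OF fS, of "{i}" w] i by simp
    thus ?thesis by simp
  qed
  have "(\<Sum>S\<in>Pow I. ?s S) = (\<Sum>S\<in>Pow (I - {i}). ?s S) + (\<Sum>S\<in>insert i ` Pow (I - {i}). ?s S)"
    unfolding PI using I by (intro sum.union_disjoint) auto
  also have "(\<Sum>S\<in>insert i ` Pow (I - {i}). ?s S) = (\<Sum>S\<in>Pow (I - {i}). ?s (insert i S))"
    using sum.reindex[OF inj, of ?s] by simp
  also have "\<dots> = (\<Sum>S\<in>Pow (I - {i}). - ?s S)" by (rule sum.cong[OF refl flip])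
  finally show ?thesis by (simp add: sum_negf)
qed

section \<open>The tower of transvection groups\<close>

type_synonym seq = "nat \<Rightarrow> nat set \<Rightarrow> nat set"

text \<open>
  The order of the \<open>k\<close>-th group of the chain, which is also the number of coordinates that it permutes in
  the block \<open>k\<close>.
\<close>

primrec block_dim :: "nat \<Rightarrow> nat" where
  "block_dim 0 = 1"
| "block_dim (Suc k) = block_dim k * card (transvection_group {0..block_dim k})"

definition block :: "nat \<Rightarrow> (nat set \<Rightarrow> nat set) set" where "block k = transvection_group {0..block_dim k}"

lemma block_closed:
  "id \<in> block k" "g \<in> block k \<Longrightarrow> h \<in> block k \<Longrightarrow> g \<circ> h \<in> block k" "g \<in> block k \<Longrightarrow> inv_into UNIV g \<in> block k"
  "g \<in> block k \<Longrightarrow> bij g" "finite (block k)"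
  unfolding block_def by (rule tv_id, erule (1) tv_comp, rule tv_inv, simp, assumption,
      rule tv_bij[of "{0..block_dim k}"], simp, assumption, rule finite_transvection_group, simp)

definition one_seq :: seq where "one_seq = (\<lambda>_. id)"
definition mult_seq :: "seq \<Rightarrow> seq \<Rightarrow> seq" where "mult_seq x y = (\<lambda>j. x j \<circ> y j)"
definition inv_seq :: "seq \<Rightarrow> seq" where "inv_seq x = (\<lambda>j. inv_into UNIV (x j))"
definition trunc :: "nat \<Rightarrow> seq \<Rightarrow> seq" where "trunc n x = (\<lambda>j. if j < n then x j else id)"

text \<open>
  The product of the first \<open>n\<close> blocks.  It is isomorphic to the \<open>n\<close>-th group of the chain, but its elements
  are cut off after \<open>n\<close> factors instead of being continued.
\<close>

definition tuples :: "nat \<Rightarrow> seq set" where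
  "tuples n = {x. (\<forall>j<n. x j \<in> block j) \<and> (\<forall>j\<ge>n. x j = id)}"

lemma mult_seq_assoc: "mult_seq (mult_seq x y) z = mult_seq x (mult_seq y z)"
  by (simp add: mult_seq_def comp_assoc)

lemma one_seq_mult [simp]: "mult_seq one_seq x = x" "mult_seq x one_seq = x"
  by (simp_all add: mult_seq_def one_seq_def)

lemma trunc_mult: "trunc n (mult_seq x y) = mult_seq (trunc n x) (trunc n y)"
  by (simp add: trunc_def mult_seq_def fun_eq_iff)

lemma trunc_one [simp]: "trunc n one_seq = one_seq"
  by (simp add: trunc_def one_seq_def fun_eq_iff)

lemma trunc_in_tuples: "(\<And>j. x j \<in> block j) \<Longrightarrow> trunc n x \<in> tuples n"
  by (simp add: tuples_def trunc_def)

lemma tuples_closed: "one_seq \<in> tuples n" "x \<in> tuples n \<Longrightarrow> y \<in> tuples n \<Longrightarrow> mult_seq x y \<in> tuples n"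
  by (auto simp: tuples_def one_seq_def mult_seq_def block_closed)

lemma tuples_block: "x \<in> tuples n \<Longrightarrow> x j \<in> block j"
  by (cases "j < n") (auto simp: tuples_def block_closed)

lemma inv_seq_mult:
  assumes "\<And>j. x j \<in> block j" shows "mult_seq (inv_seq x) x = one_seq" "mult_seq x (inv_seq x) = one_seq"
proof -
  have "bij (x j)" for j using block_closed(4)[OF assms] .
  thus "mult_seq (inv_seq x) x = one_seq" "mult_seq x (inv_seq x) = one_seq"
    by (simp_all add: mult_seq_def inv_seq_def one_seq_def fun_eq_iff bij_is_inj bij_is_surj surj_f_inv_f)
qed

lemma card_tuples: "finite (tuples n) \<and> card (tuples n) = block_dim n"
proof (induction n)
  case 0
  have "tuples 0 = {one_seq}" by (auto simp: tuples_def one_seq_def)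
  thus ?case by simp
next
  case (Suc n)
  let ?f = "\<lambda>(x :: seq, u). x(n := u)"
  have inj: "inj_on ?f (tuples n \<times> block n)"
  proof (rule inj_onI, clarify)
    fix x y :: seq and u v
    assume xy: "x \<in> tuples n" "y \<in> tuples n" and eq: "x(n := u) = y(n := v)"
    have "u = v" using fun_cong[OF eq, of n] by simp
    moreover have "x j = y j" for j
      using fun_cong[OF eq, of j] xy by (cases "j = n") (simp_all add: tuples_def)
    ultimately show "x = y \<and> u = v" by blast
  qed
  have "tuples (Suc n) = ?f ` (tuples n \<times> block n)"
  proof
    show "tuples (Suc n) \<subseteq> ?f ` (tuples n \<times> block n)"
    proof
      fix x assume x: "x \<in> tuples (Suc n)"
      have "x(n := id) \<in> tuples n" using x by (auto simp: tuples_def)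
      moreover have "x n \<in> block n" using x by (simp add: tuples_def)
      moreover have "x = ?f (x(n := id), x n)" by simp
      ultimately show "x \<in> ?f ` (tuples n \<times> block n)" by blast
    qed
    show "?f ` (tuples n \<times> block n) \<subseteq> tuples (Suc n)" by (auto simp: tuples_def)
  qed
  hence "finite (tuples (Suc n)) \<and> card (tuples (Suc n)) = card (tuples n \<times> block n)"
    using Suc block_closed(5)[of n] inj by (simp add: card_image)
  thus ?case using Suc by (simp add: card_cartesian_product block_def)
qed

definition enum :: "nat \<Rightarrow> seq \<Rightarrow> nat" where
  "enum n = (SOME b. bij_betw b (tuples n) {1..block_dim n})"

lemma enum_bij: "bij_betw (enum n) (tuples n) {1..block_dim n}"
proof -
  have "\<exists>b. bij_betw b (tuples n) {1..block_dim n}"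
    by (rule finite_same_card_bij) (use card_tuples[of n] in simp_all)
  thus ?thesis unfolding enum_def by (rule someI_ex)
qed

text \<open>
  Left multiplication of \<open>tuples n\<close> on itself, read as an action on the coordinates \<open>1, \<dots>, block_dim n\<close>
  through the enumeration; the coordinate \<open>0\<close> is fixed.
\<close>

definition act :: "nat \<Rightarrow> seq \<Rightarrow> nat \<Rightarrow> nat" where
  "act n x i = (if i \<in> {1..block_dim n} then enum n (mult_seq x (inv_into (tuples n) (enum n) i)) else i)"

lemma act_enum: "y \<in> tuples n \<Longrightarrow> act n x (enum n y) = enum n (mult_seq x y)"
  using enum_bij[of n] by (auto simp: act_def bij_betw_def inv_into_f_f)

lemma act_outside: "i \<notin> {1..block_dim n} \<Longrightarrow> act n x i = i"
  unfolding act_def by (rule if_not_P)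

lemma enum_cases:
  assumes "i \<in> {1..block_dim n}" obtains y where "y \<in> tuples n" "i = enum n y"
proof -
  have "i \<in> enum n ` tuples n" using assms bij_betw_imp_surj_on[OF enum_bij[of n]] by simp
  thus ?thesis using that by blast
qed

lemma act_mult:
  assumes "x \<in> tuples n" "y \<in> tuples n" shows "act n (mult_seq x y) = act n x \<circ> act n y"
proof
  fix i show "act n (mult_seq x y) i = (act n x \<circ> act n y) i"
  proof (cases "i \<in> {1..block_dim n}")
    case True
    then obtain z where z: "z \<in> tuples n" "i = enum n z" by (rule enum_cases)
    have "act n (mult_seq x y) i = enum n (mult_seq x (mult_seq y z))"
      unfolding z(2) act_enum[OF z(1)] mult_seq_assoc ..
    moreover have "(act n x \<circ> act n y) i = enum n (mult_seq x (mult_seq y z))"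
      unfolding z(2) comp_apply act_enum[OF z(1)] by (rule act_enum[OF tuples_closed(2)[OF assms(2) z(1)]])
    ultimately show ?thesis by simp
  qed (simp add: act_outside)
qed

lemma act_one: "act n one_seq = id"
proof
  fix i show "act n one_seq i = id i"
  proof (cases "i \<in> {1..block_dim n}")
    case True
    then obtain z where z: "z \<in> tuples n" "i = enum n z" by (rule enum_cases)
    show ?thesis unfolding z(2) act_enum[OF z(1)] by simp
  qed (simp add: act_outside)
qed

lemma inv_seq_tuples: assumes "x \<in> tuples n" shows "inv_seq x \<in> tuples n"
  unfolding tuples_def
proof (intro CollectI conjI allI impI)
  fix j
  show "inv_seq x j \<in> block j" by (simp add: inv_seq_def block_closed(3) tuples_block[OF assms])
  assume "n \<le> j"
  thus "inv_seq x j = id" using assms by (simp add: tuples_def inv_seq_def inv_id)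
qed

lemma act_inverse:
  assumes x: "x \<in> tuples n" shows "act n (inv_seq x) \<circ> act n x = id" "act n x \<circ> act n (inv_seq x) = id"
proof -
  have xN: "x j \<in> block j" for j by (rule tuples_block[OF x])
  show "act n (inv_seq x) \<circ> act n x = id" "act n x \<circ> act n (inv_seq x) = id"
    using act_mult[OF inv_seq_tuples[OF x] x] act_mult[OF x inv_seq_tuples[OF x]]
    by (simp_all add: inv_seq_mult[of x, OF xN] act_one)
qed

lemma act_permutes: assumes x: "x \<in> tuples n" shows "act n x permutes {1..block_dim n}"
proof -
  have "bij (act n x)" using act_inverse[OF x] o_bij by blast
  hence "\<forall>y. \<exists>!z. act n x z = y" by (simp add: bij_iff)
  thus ?thesis unfolding permutes_def using act_outside[of _ n x] by blast
qed

definition rho :: "nat \<Rightarrow> seq \<Rightarrow> nat set \<Rightarrow> nat set" where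
  "rho n x = (\<lambda>v. act n x ` v)"

lemma rho_block: "x \<in> tuples n \<Longrightarrow> rho n x \<in> block n"
  unfolding rho_def block_def by (rule image_permutes_tv[OF _ _ act_permutes]) auto

lemma rho_mult: "x \<in> tuples n \<Longrightarrow> y \<in> tuples n \<Longrightarrow> rho n (mult_seq x y) = rho n x \<circ> rho n y"
  by (simp add: rho_def act_mult image_comp fun_eq_iff)

lemma rho_one: "rho n one_seq = id"
  by (simp add: rho_def act_one fun_eq_iff)

lemma rho_inv: assumes x: "x \<in> tuples n" shows "rho n (inv_seq x) = inv_into UNIV (rho n x)"
proof -
  have xN: "x j \<in> block j" for j by (rule tuples_block[OF x])
  have "rho n x \<circ> rho n (inv_seq x) = id" "rho n (inv_seq x) \<circ> rho n x = id"
    using rho_mult[OF inv_seq_tuples[OF x] x] rho_mult[OF x inv_seq_tuples[OF x]]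
    by (simp_all add: inv_seq_mult[of x, OF xN] rho_one)
  thus ?thesis by (rule inv_unique_comp[symmetric])
qed

text \<open>
  From the \<open>n\<close>-th factor on, every factor is determined by the preceding ones.  Such sequences form the
  \<open>n\<close>-th group of the chain; the levels increase with \<open>n\<close> because the condition weakens.
\<close>

definition level :: "nat \<Rightarrow> seq set" where
  "level n = {x. (\<forall>k. x k \<in> block k) \<and> (\<forall>k\<ge>n. x k = rho k (trunc k x))}"

definition tower :: "seq monoid" where
  "tower = \<lparr>carrier = (\<Union>n. level n), mult = mult_seq, one = one_seq\<rparr>"

lemma levelD: "x \<in> level n \<Longrightarrow> x k \<in> block k" "x \<in> level n \<Longrightarrow> n \<le> k \<Longrightarrow> x k = rho k (trunc k x)"
  by (simp_all add: level_def)

lemma level_trunc: "x \<in> level n \<Longrightarrow> trunc k x \<in> tuples k"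
  by (rule trunc_in_tuples) (rule levelD(1))

lemma level_mono: "m \<le> n \<Longrightarrow> level m \<subseteq> level n"
  by (auto simp: level_def)

lemma level_one: "one_seq \<in> level n"
  by (simp add: level_def rho_one) (simp add: one_seq_def block_closed)

lemma level_mult: assumes x: "x \<in> level n" and y: "y \<in> level n" shows "mult_seq x y \<in> level n"
  unfolding level_def
proof (intro CollectI conjI allI impI)
  fix k
  show "mult_seq x y k \<in> block k" unfolding mult_seq_def by (rule block_closed(2)[OF levelD(1)[OF x] levelD(1)[OF y]])
  assume k: "n \<le> k"
  have "mult_seq x y k = rho k (trunc k x) \<circ> rho k (trunc k y)"
    unfolding mult_seq_def by (subst levelD(2)[OF x k], subst levelD(2)[OF y k]) (rule refl)
  thus "mult_seq x y k = rho k (trunc k (mult_seq x y))"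
    by (simp add: trunc_mult rho_mult level_trunc[OF x] level_trunc[OF y])
qed

lemma trunc_inv: "trunc k (inv_seq x) = inv_seq (trunc k x)"
  by (auto simp: trunc_def inv_seq_def fun_eq_iff inv_id)

lemma level_inv: assumes x: "x \<in> level n" shows "inv_seq x \<in> level n"
  unfolding level_def
proof (intro CollectI conjI allI impI)
  fix k
  show "inv_seq x k \<in> block k" unfolding inv_seq_def by (rule block_closed(3)[OF levelD(1)[OF x]])
  assume k: "n \<le> k"
  have "inv_seq x k = inv_into UNIV (rho k (trunc k x))"
    unfolding inv_seq_def by (subst levelD(2)[OF x k]) (rule refl)
  thus "inv_seq x k = rho k (trunc k (inv_seq x))"
    by (simp add: trunc_inv rho_inv[OF level_trunc[OF x]])
qed

text \<open>
  The factors beyond the first \<open>n\<close> are determined recursively by the earlier ones.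
\<close>

lemma level_eqI:
  assumes x: "x \<in> level n" and y: "y \<in> level n" and eq: "\<And>j. j < n \<Longrightarrow> x j = y j"
  shows "x = y"
proof
  fix k show "x k = y k"
  proof (induction k rule: less_induct)
    case (less k)
    show ?case
    proof (cases "k < n")
      case False
      hence k: "n \<le> k" by simp
      have "trunc k x = trunc k y" using less.IH by (simp add: trunc_def fun_eq_iff)
      thus ?thesis using levelD(2)[OF x k] levelD(2)[OF y k] by simp
    qed (rule eq)
  qed
qed

fun extend :: "nat \<Rightarrow> seq \<Rightarrow> seq" where
  "extend n y k = (if k < n then y k else rho k (\<lambda>j. if j < k then extend n y j else id))"

declare extend.simps [simp del]

lemma extend_below: "k < n \<Longrightarrow> extend n y k = y k"
  by (simp add: extend.simps)

lemma extend_above: "n \<le> k \<Longrightarrow> extend n y k = rho k (trunc k (extend n y))"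
  by (subst extend.simps) (simp add: trunc_def)

lemma extend_level: assumes y: "y \<in> tuples n" shows "extend n y \<in> level n"
proof -
  have "extend n y k \<in> block k" for k
  proof (induction k rule: less_induct)
    case (less k)
    show ?case
    proof (cases "k < n")
      case True thus ?thesis by (simp add: extend_below tuples_block[OF y])
    next
      case False
      have "trunc k (extend n y) \<in> tuples k" using less.IH by (simp add: tuples_def trunc_def)
      thus ?thesis using False by (simp add: extend_above rho_block)
    qed
  qed
  thus ?thesis by (simp add: level_def extend_above)
qed

lemma tower_simps [simp]:
  "carrier tower = (\<Union>n. level n)" "mult tower = mult_seq" "one tower = one_seq"
  by (simp_all add: tower_def)

lemma tower_common_level:
  assumes "x \<in> carrier tower" "y \<in> carrier tower" obtains n where "x \<in> level n" "y \<in> level n"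
proof -
  from assms obtain m n where mn: "x \<in> level m" "y \<in> level n" by auto
  show ?thesis
    by (rule that[of "max m n"])
       (use mn level_mono[of m "max m n"] level_mono[of n "max m n"] in auto)
qed

lemma tower_group: "group tower"
proof (rule groupI)
  fix x y assume "x \<in> carrier tower" "y \<in> carrier tower"
  then obtain n where n: "x \<in> level n" "y \<in> level n" by (rule tower_common_level)
  show "x \<otimes>\<^bsub>tower\<^esub> y \<in> carrier tower" using level_mult[OF n] by auto
next
  fix x assume "x \<in> carrier tower"
  then obtain n where n: "x \<in> level n" by auto
  have "inv_seq x \<in> carrier tower" using level_inv[OF n] by auto
  moreover have "inv_seq x \<otimes>\<^bsub>tower\<^esub> x = \<one>\<^bsub>tower\<^esub>" using inv_seq_mult(1)[of x] levelD(1)[OF n] by simp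
  ultimately show "\<exists>y\<in>carrier tower. y \<otimes>\<^bsub>tower\<^esub> x = \<one>\<^bsub>tower\<^esub>"
    by (intro bexI[of _ "inv_seq x"])
qed (use level_one in \<open>auto simp: mult_seq_assoc\<close>)

lemma tower_inv: assumes "x \<in> carrier tower" shows "inv\<^bsub>tower\<^esub> x = inv_seq x"
proof -
  from assms obtain n where n: "x \<in> level n" by auto
  show ?thesis
  proof (rule group.inv_equality[OF tower_group])
    show "inv_seq x \<otimes>\<^bsub>tower\<^esub> x = \<one>\<^bsub>tower\<^esub>" using inv_seq_mult(1)[of x] levelD(1)[OF n] by simp
    show "inv_seq x \<in> carrier tower" using level_inv[OF n] by auto
  qed (rule assms)
qed

lemma level_subgroup: "subgroup (level n) tower"
proof (rule subgroup.intro)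
  show "level n \<subseteq> carrier tower" by auto
  show "inv\<^bsub>tower\<^esub> x \<in> level n" if "x \<in> level n" for x
  proof -
    have "x \<in> carrier tower" using that by auto
    from tower_inv[OF this] show ?thesis using level_inv[OF that] by simp
  qed
qed (simp_all add: level_mult level_one)

lemma finite_level: "finite (level n)"
proof (rule inj_on_finite[of "trunc n"])
  show "inj_on (trunc n) (level n)"
  proof (rule inj_onI)
    fix x y assume xy: "x \<in> level n" "y \<in> level n" and eq: "trunc n x = trunc n y"
    show "x = y"
    proof (rule level_eqI[OF xy])
      fix j assume "j < n" thus "x j = y j" using fun_cong[OF eq, of j] by (simp add: trunc_def)
    qed
  qed
  show "trunc n ` level n \<subseteq> tuples n" using level_trunc by blast
  show "finite (tuples n)" using card_tuples by blast
qed

section \<open>Free characters in the tower\<close>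

definition single :: "nat \<Rightarrow> (nat set \<Rightarrow> nat set) \<Rightarrow> seq" where
  "single n u = (\<lambda>j. if j = n then u else id)"

text \<open>
  The block \<open>n\<close> as a subgroup of the tower: trivial in the factors below \<open>n\<close> and continued beyond.
\<close>

definition insert_at :: "nat \<Rightarrow> (nat set \<Rightarrow> nat set) \<Rightarrow> seq" where
  "insert_at n u = extend (Suc n) (single n u)"

lemma insert_at_at: "insert_at n u n = u"
  by (simp add: insert_at_def extend_below single_def)

lemma insert_at_trunc: "trunc n (insert_at n u) = one_seq"
  by (simp add: fun_eq_iff trunc_def insert_at_def extend_below single_def one_seq_def)

lemma insert_at_level: "u \<in> block n \<Longrightarrow> insert_at n u \<in> level (Suc n)"
  unfolding insert_at_def by (rule extend_level) (simp add: tuples_def single_def block_closed)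

lemma level_mem_carrier: "x \<in> level n \<Longrightarrow> x \<in> carrier tower"
  by auto

lemmas insert_at_carrier = level_mem_carrier[OF insert_at_level]

text \<open>
  The subgroup \<open>block n\<close> is the kernel of forgetting the factor \<open>n\<close> on the level \<open>n + 1\<close>.  Products and
  conjugates in it can therefore be computed in the factor \<open>n\<close> alone.
\<close>

lemma insert_at_unique:
  assumes x: "x \<in> level (Suc n)" and t: "trunc n x = one_seq" shows "x = insert_at n (x n)"
proof (rule level_eqI[OF x insert_at_level[OF levelD(1)[OF x]]])
  fix j assume "j < Suc n"
  show "x j = insert_at n (x n) j"
  proof (cases "j = n")
    case False
    hence j: "j < n" using \<open>j < Suc n\<close> by simp
    have "x j = id" using fun_cong[OF t, of j] j by (simp add: trunc_def one_seq_def)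
    moreover have "insert_at n (x n) j = id" using fun_cong[OF insert_at_trunc, of n "x n" j] j by (simp add: trunc_def one_seq_def)
    ultimately show ?thesis by simp
  qed (simp add: insert_at_at)
qed

lemma insert_at_mult:
  assumes "u \<in> block n" "v \<in> block n" shows "mult_seq (insert_at n u) (insert_at n v) = insert_at n (u \<circ> v)"
proof -
  have "mult_seq (insert_at n u) (insert_at n v) = insert_at n (mult_seq (insert_at n u) (insert_at n v) n)"
    by (rule insert_at_unique[OF level_mult[OF insert_at_level insert_at_level]]) (simp_all add: assms trunc_mult insert_at_trunc)
  thus ?thesis by (simp add: mult_seq_def insert_at_at)
qed

lemma insert_at_id: "insert_at n id = one_seq"
  using insert_at_unique[OF level_one, of n] by (simp add: one_seq_def) (simp add: one_seq_def[symmetric])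

lemma insert_at_conj:
  assumes f: "f \<in> level (Suc n)" and u: "u \<in> block n"
  shows "f \<otimes>\<^bsub>tower\<^esub> insert_at n u \<otimes>\<^bsub>tower\<^esub> inv\<^bsub>tower\<^esub> f = insert_at n (f n \<circ> u \<circ> inv_into UNIV (f n))"
proof -
  let ?x = "mult_seq (mult_seq f (insert_at n u)) (inv_seq f)"
  have "trunc n ?x = trunc n (mult_seq f (inv_seq f))"
    by (simp add: trunc_mult insert_at_trunc)
  hence "trunc n ?x = one_seq" using inv_seq_mult(2)[of f] levelD(1)[OF f] by simp
  hence "?x = insert_at n (?x n)"
    by (rule insert_at_unique[OF level_mult[OF level_mult[OF f insert_at_level[OF u]] level_inv[OF f]]])
  also have "?x n = f n \<circ> u \<circ> inv_into UNIV (f n)" by (simp add: mult_seq_def inv_seq_def insert_at_at)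
  finally show ?thesis by (simp add: tower_inv[OF level_mem_carrier[OF f]] comp_def)
qed

text \<open>
  The map \<open>v \<mapsto> v + v\<^sub>0 w\<close> in the block \<open>n\<close>.
\<close>

definition shear :: "nat \<Rightarrow> nat set \<Rightarrow> seq" where "shear n w = insert_at n (transvection {0} w)"
definition shears :: "nat \<Rightarrow> seq set" where "shears n = shear n ` Pow {1..block_dim n}"
definition labels :: "nat \<Rightarrow> nat set set" where "labels n = Pow {1..block_dim n} - {{}}"
text \<open>
  A shear with vector \<open>w\<close> maps \<open>{0}\<close> to \<open>{0} + w\<close>.  Evaluating at \<open>{0}\<close> thus reads off \<open>w\<close>, and for \<open>S\<close> not
  containing \<open>0\<close> the value is the sign of the pairing of \<open>S\<close> with \<open>w\<close>.
\<close>

definition sign_char :: "nat \<Rightarrow> nat set \<Rightarrow> seq \<Rightarrow> complex" where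
  "sign_char n S x = (if pairing S (x n {0}) then -1 else 1)"
text \<open>
  The coordinate that corresponds to the identity under the enumeration; its stabiliser is trivial because the
  action is regular.
\<close>

definition base_point :: "nat \<Rightarrow> nat" where "base_point n = enum n one_seq"

lemma base_point_in: "base_point n \<in> {1..block_dim n}"
  unfolding base_point_def using bij_betw_imp_surj_on[OF enum_bij[of n]] tuples_closed(1) by blast

lemma positive_coordinates: "w \<subseteq> {1..block_dim n} \<Longrightarrow> w \<subseteq> {0..block_dim n}" "w \<subseteq> {1..block_dim n} \<Longrightarrow> 0 \<notin> w" "w \<subseteq> {1..block_dim n} \<Longrightarrow> finite w"
  by (auto intro: finite_subset)

lemma shear_block: "w \<subseteq> {1..block_dim n} \<Longrightarrow> transvection {0} w \<in> block n"
  unfolding block_def by (rule tv_transvection) (use positive_coordinates[of w n] in auto)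

lemma shear_carrier: "w \<subseteq> {1..block_dim n} \<Longrightarrow> shear n w \<in> carrier tower"
  unfolding shear_def by (rule insert_at_carrier[OF shear_block])

lemma shears_cases: assumes "v \<in> shears n" obtains w where "w \<subseteq> {1..block_dim n}" "v = shear n w"
  using assms unfolding shears_def by blast

lemma shears_I: "w \<subseteq> {1..block_dim n} \<Longrightarrow> shear n w \<in> shears n"
  unfolding shears_def by blast

lemma transvection_zero_comp:
  assumes "0 \<notin> w" "0 \<notin> w'"
  shows "transvection {0} w \<circ> transvection {0} w' = transvection {0} (sym_diff w w')"
proof
  fix v
  have "sym_diff (sym_diff v w') w = sym_diff v (sym_diff w w')" by blast
  moreover have "0 \<in> sym_diff v w' \<longleftrightarrow> 0 \<in> v" using assms by blast
  ultimately show "(transvection {0} w \<circ> transvection {0} w') v = transvection {0} (sym_diff w w') v"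
    by (simp add: transvection_def del: Un_iff)
qed

lemma shear_mult:
  assumes "w \<subseteq> {1..block_dim n}" "w' \<subseteq> {1..block_dim n}"
  shows "mult_seq (shear n w) (shear n w') = shear n (sym_diff w w')"
  unfolding shear_def using insert_at_mult[OF shear_block[OF assms(1)] shear_block[OF assms(2)]]
  by (simp only: transvection_zero_comp[OF positive_coordinates(2)[OF assms(1)] positive_coordinates(2)[OF assms(2)]])

lemma shear_empty: "shear n {} = one_seq"
proof -
  have "transvection {0} {} = id" by (simp add: fun_eq_iff transvection_def)
  thus ?thesis by (simp add: shear_def insert_at_id)
qed

lemma shear_at: "shear n w n {0} = sym_diff {0} w"
  by (simp add: shear_def insert_at_at transvection_def)

lemma sign_char_shear: assumes "S \<subseteq> {1..block_dim n}" shows "sign_char n S (shear n w) = (if pairing S w then -1 else 1)"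
proof -
  have "pairing S (sym_diff {0} w) \<longleftrightarrow> pairing S {0} \<noteq> pairing S w"
    by (rule pairing_sym_diff_right[OF positive_coordinates(3)[OF assms]])
  moreover have "\<not> pairing S {0}" using positive_coordinates(2)[OF assms] by (simp add: pairing_commute[of S])
  ultimately show ?thesis unfolding sign_char_def shear_at by simp
qed

lemma shear_inj: "inj_on (shear n) (Pow {1..block_dim n})"
proof (rule inj_onI)
  fix w w' assume w: "w \<in> Pow {1..block_dim n}" "w' \<in> Pow {1..block_dim n}" and eq: "shear n w = shear n w'"
  have "sym_diff {0} w = sym_diff {0} w'" unfolding shear_at[symmetric, of _ n] eq ..
  moreover have "0 \<notin> w" "0 \<notin> w'" using w positive_coordinates(2) by blast+
  ultimately show "w = w'" by blast
qed

lemma card_shears: "finite (shears n)" "card (shears n) = Suc (card (labels n))"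
proof -
  show "finite (shears n)" by (simp add: shears_def)
  have "card (shears n) = card (Pow {1..block_dim n})" unfolding shears_def by (rule card_image[OF shear_inj])
  also have "\<dots> = Suc (card (labels n))"
    unfolding labels_def by (rule card.remove) auto
  finally show "card (shears n) = Suc (card (labels n))" .
qed

lemma shears_subgroup: "subgroup (shears n) tower"
proof (rule group.subgroupI[OF tower_group])
  show "shears n \<subseteq> carrier tower" using shear_carrier shears_cases by (metis subsetI)
  show "shears n \<noteq> {}" unfolding shears_def by blast
  show "inv\<^bsub>tower\<^esub> v \<in> shears n" if v: "v \<in> shears n" for v
  proof -
    obtain w where w: "w \<subseteq> {1..block_dim n}" "v = shear n w" using v by (rule shears_cases)
    have "v \<otimes>\<^bsub>tower\<^esub> v = \<one>\<^bsub>tower\<^esub>" using shear_mult[OF w(1) w(1)] w(2) by (simp add: shear_empty)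
    hence "inv\<^bsub>tower\<^esub> v = v" using group.inv_equality[OF tower_group _ shear_carrier shear_carrier] w by simp
    thus ?thesis using v by simp
  qed
  show "v \<otimes>\<^bsub>tower\<^esub> v' \<in> shears n" if v: "v \<in> shears n" "v' \<in> shears n" for v v'
  proof -
    obtain w where w: "w \<subseteq> {1..block_dim n}" "v = shear n w" using v(1) by (rule shears_cases)
    obtain w' where w': "w' \<subseteq> {1..block_dim n}" "v' = shear n w'" using v(2) by (rule shears_cases)
    have "sym_diff w w' \<subseteq> {1..block_dim n}" using w(1) w'(1) by blast
    thus ?thesis using shear_mult[OF w(1) w'(1)] w(2) w'(2) shears_I by simp
  qed
qed

text \<open>
  The level \<open>n\<close> acts on the block \<open>n\<close> by permutations of coordinates that fix \<open>0\<close>, which permute the shears.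
\<close>

lemma shear_conj_level:
  assumes f: "f \<in> level n" and w: "w \<subseteq> {1..block_dim n}"
  shows "act n (trunc n f) ` w \<subseteq> {1..block_dim n}"
    and "f \<otimes>\<^bsub>tower\<^esub> shear n w \<otimes>\<^bsub>tower\<^esub> inv\<^bsub>tower\<^esub> f = shear n (act n (trunc n f) ` w)"
proof -
  let ?p = "act n (trunc n f)"
  have perm: "?p permutes {1..block_dim n}" by (rule act_permutes[OF level_trunc[OF f]])
  show "?p ` w \<subseteq> {1..block_dim n}" using permutes_image[OF perm] w by blast
  have f': "f \<in> level (Suc n)" using f level_mono[of n "Suc n"] by auto
  have fn: "f n = (\<lambda>v. ?p ` v)" using levelD(2)[OF f order_refl] by (simp add: rho_def)
  have bij: "bij ?p" by (rule permutes_bij[OF perm])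
  have "inv_into UNIV (\<lambda>v. ?p ` v) = (\<lambda>v. inv_into UNIV ?p ` v)"
  proof (rule inv_unique_comp)
    show "(\<lambda>v. ?p ` v) \<circ> (\<lambda>v. inv_into UNIV ?p ` v) = id"
      using bij by (simp add: fun_eq_iff image_f_inv_f bij_is_surj)
    show "(\<lambda>v. inv_into UNIV ?p ` v) \<circ> (\<lambda>v. ?p ` v) = id"
      using bij by (simp add: fun_eq_iff image_inv_f_f bij_is_inj)
  qed
  hence "f n \<circ> transvection {0} w \<circ> inv_into UNIV (f n) = transvection (?p ` {0}) (?p ` w)"
    unfolding fn using image_bij_conj_transvection[OF bij, of "{0}" w] by simp
  moreover have "?p ` {0} = {0}" by (simp add: act_outside)
  ultimately show "f \<otimes>\<^bsub>tower\<^esub> shear n w \<otimes>\<^bsub>tower\<^esub> inv\<^bsub>tower\<^esub> f = shear n (?p ` w)"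
    unfolding shear_def insert_at_conj[OF f' shear_block[OF w]] by simp
qed

text \<open>
  The transvection exchanging the forms of \<open>S\<close> and of the base point has a vector without coordinate \<open>0\<close>, so
  it preserves the form \<open>v \<mapsto> v\<^sub>0\<close> and hence normalises the shears.
\<close>

lemma label_transitive:
  assumes S: "S \<in> labels n"
  shows "\<exists>g\<in>carrier tower. \<forall>v\<in>shears n. g \<otimes>\<^bsub>tower\<^esub> v \<otimes>\<^bsub>tower\<^esub> inv\<^bsub>tower\<^esub> g \<in> shears n \<and>
    sign_char n S (g \<otimes>\<^bsub>tower\<^esub> v \<otimes>\<^bsub>tower\<^esub> inv\<^bsub>tower\<^esub> g) = sign_char n {base_point n} v"
proof (cases "S = {base_point n}")
  case True
  interpret T: group tower by (rule tower_group)
  have VT: "v \<in> carrier tower" if "v \<in> shears n" for v using that shears_subgroup subgroup.subset by blast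
  show ?thesis
  proof (rule bexI[OF _ T.one_closed], rule ballI)
    fix v assume v: "v \<in> shears n"
    have "\<one>\<^bsub>tower\<^esub> \<otimes>\<^bsub>tower\<^esub> v \<otimes>\<^bsub>tower\<^esub> inv\<^bsub>tower\<^esub> \<one>\<^bsub>tower\<^esub> = v"
      using T.l_one[OF VT[OF v]] T.r_one[OF VT[OF v]] T.inv_one by metis
    thus "\<one>\<^bsub>tower\<^esub> \<otimes>\<^bsub>tower\<^esub> v \<otimes>\<^bsub>tower\<^esub> inv\<^bsub>tower\<^esub> \<one>\<^bsub>tower\<^esub> \<in> shears n \<and>
        sign_char n S (\<one>\<^bsub>tower\<^esub> \<otimes>\<^bsub>tower\<^esub> v \<otimes>\<^bsub>tower\<^esub> inv\<^bsub>tower\<^esub> \<one>\<^bsub>tower\<^esub>) = sign_char n {base_point n} v"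
      using v True by (simp only: simp_thms)
  qed
next
  case False
  have SI: "S \<subseteq> {1..block_dim n}" "S \<noteq> {}" using S by (simp_all add: labels_def)
  obtain u where u: "u \<subseteq> insert (base_point n) S" "finite u" "pairing S u" "base_point n \<in> u"
    using common_witness[OF SI(2) False] by blast
  have uI: "u \<subseteq> {1..block_dim n}" using u(1) SI(1) base_point_in by blast
  \<comment> \<open>The form \<open>R\<close> vanishes on \<open>u\<close>, and adding it exchanges the two forms.\<close>
  define R where "R = sym_diff S {base_point n}"
  have RI: "R \<subseteq> {1..block_dim n}" using SI(1) base_point_in unfolding R_def by blast
  have pR: "pairing R v \<longleftrightarrow> pairing S v \<noteq> (base_point n \<in> v)" for v
    unfolding R_def using pairing_sym_diff_left[OF positive_coordinates(3)[OF SI(1)], of "{base_point n}" v] by simp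
  have nR: "\<not> pairing R u" using pR[of u] u(3,4) by simp
  let ?g = "transvection R u"
  have gN: "?g \<in> block n" unfolding block_def by (rule tv_transvection[OF positive_coordinates(1)[OF RI] positive_coordinates(1)[OF uI] nR])
  have gg: "?g \<circ> ?g = id" by (rule transvection_involution[OF positive_coordinates(3)[OF RI] nR])
  hence inv_g: "inv_into UNIV ?g = ?g" by (intro inv_unique_comp)
  show ?thesis
  proof (rule bexI[OF _ insert_at_carrier[OF gN]], rule ballI)
    fix v assume "v \<in> shears n"
    then obtain w where w: "w \<subseteq> {1..block_dim n}" "v = shear n w" by (rule shears_cases)
    have gw: "?g w \<subseteq> {1..block_dim n}" using w(1) uI by (auto simp: transvection_def)
    have "?g \<circ> transvection {0} w \<circ> ?g = transvection {0} (?g w)"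
    proof (rule transvection_conj[OF positive_coordinates(3)[OF RI] nR])
      show "pairing {0} v \<longleftrightarrow> pairing {0} (?g v)" for v
        using positive_coordinates(2)[OF uI] by (auto simp: transvection_def)
    qed
    hence eq: "insert_at n ?g \<otimes>\<^bsub>tower\<^esub> v \<otimes>\<^bsub>tower\<^esub> inv\<^bsub>tower\<^esub> insert_at n ?g = shear n (?g w)"
      unfolding w(2) shear_def insert_at_conj[OF insert_at_level[OF gN] shear_block[OF w(1)]] insert_at_at inv_g by simp
    have "pairing S (?g w) \<longleftrightarrow> base_point n \<in> w"
    proof (cases "pairing R w")
      case True
      hence "pairing S (?g w) \<longleftrightarrow> \<not> pairing S w"
        using pairing_sym_diff_right[OF positive_coordinates(3)[OF SI(1)], of w u] u(3) by (simp add: transvection_def)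
      thus ?thesis using True pR[of w] by simp
    next
      case False
      thus ?thesis using pR[of w] by (simp add: transvection_def)
    qed
    moreover have "{base_point n} \<subseteq> {1..block_dim n}" using base_point_in by simp
    ultimately have "sign_char n S (shear n (?g w)) = sign_char n {base_point n} v"
      unfolding w(2) sign_char_shear[OF SI(1)] by (subst sign_char_shear) simp_all
    thus "insert_at n ?g \<otimes>\<^bsub>tower\<^esub> v \<otimes>\<^bsub>tower\<^esub> inv\<^bsub>tower\<^esub> insert_at n ?g \<in> shears n \<and>
        sign_char n S (insert_at n ?g \<otimes>\<^bsub>tower\<^esub> v \<otimes>\<^bsub>tower\<^esub> inv\<^bsub>tower\<^esub> insert_at n ?g) = sign_char n {base_point n} v"
      unfolding eq using shears_I[OF gw] by simp
  qed
qed

lemma tower_free_character: "free_character tower (level n) (shears n) (labels n) (sign_char n) {base_point n}"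
proof (rule free_character.intro[OF tower_group], rule free_character_axioms.intro)
  have base: "{base_point n} \<subseteq> {1..block_dim n}" using base_point_in by simp
  have lab: "S \<subseteq> {1..block_dim n}" if "S \<in> labels n" for S using that by (simp add: labels_def)
  show "subgroup (level n) tower" by (rule level_subgroup)
  show "subgroup (shears n) tower" by (rule shears_subgroup)
  show "finite (shears n)" by (rule card_shears(1))
  show "finite (labels n)" by (simp add: labels_def)
  show "{base_point n} \<in> labels n" using base by (simp add: labels_def)
  show "card (shears n) = Suc (card (labels n))" by (rule card_shears(2))
  show "sign_char n S (v \<otimes>\<^bsub>tower\<^esub> v') = sign_char n S v * sign_char n S v'" if S: "S \<in> labels n" and v: "v \<in> shears n" and v': "v' \<in> shears n" for S v v'
  proof -
    obtain w where w: "w \<subseteq> {1..block_dim n}" "v = shear n w" using v by (rule shears_cases)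
    obtain w' where w': "w' \<subseteq> {1..block_dim n}" "v' = shear n w'" using v' by (rule shears_cases)
    have "v \<otimes>\<^bsub>tower\<^esub> v' = shear n (sym_diff w w')" using shear_mult[OF w(1) w'(1)] w(2) w'(2) by simp
    thus ?thesis
      unfolding w(2) w'(2) using pairing_sym_diff_right[OF positive_coordinates(3)[OF lab[OF S]], of w w']
      by (simp add: sign_char_shear[OF lab[OF S]])
  qed
  show "sign_char n S v = 1 \<or> sign_char n S v = -1" if "S \<in> labels n" "v \<in> shears n" for S v
    by (simp add: sign_char_def)
  show "f \<otimes>\<^bsub>tower\<^esub> v \<otimes>\<^bsub>tower\<^esub> inv\<^bsub>tower\<^esub> f \<in> shears n" if f: "f \<in> level n" and "v \<in> shears n" for f v
  proof -
    obtain w where w: "w \<subseteq> {1..block_dim n}" "v = shear n w" using \<open>v \<in> shears n\<close> by (rule shears_cases)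
    show ?thesis unfolding w(2) shear_conj_level(2)[OF f w(1)] by (rule shears_I[OF shear_conj_level(1)[OF f w(1)]])
  qed
  show "\<exists>v\<in>shears n. sign_char n {base_point n} (f \<otimes>\<^bsub>tower\<^esub> v \<otimes>\<^bsub>tower\<^esub> inv\<^bsub>tower\<^esub> f) \<noteq> sign_char n {base_point n} v"
    if f: "f \<in> level n" and ne: "f \<noteq> \<one>\<^bsub>tower\<^esub>" for f
  proof -
    let ?t = "trunc n f"
    have "?t \<noteq> one_seq"
    proof
      assume t: "?t = one_seq"
      have "f = one_seq"
      proof (rule level_eqI[OF f level_one])
        fix j assume "j < n" thus "f j = one_seq j" using fun_cong[OF t, of j] by (simp add: trunc_def)
      qed
      thus False using ne by simp
    qed
    moreover have "act n ?t (base_point n) = enum n ?t"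
      unfolding base_point_def act_enum[OF tuples_closed(1)] by simp
    ultimately have nb: "act n ?t (base_point n) \<noteq> base_point n"
      using bij_betw_imp_inj_on[OF enum_bij[of n]] level_trunc[OF f, of n] tuples_closed(1)[of n]
      unfolding base_point_def inj_on_def by metis
    have "sign_char n {base_point n} (f \<otimes>\<^bsub>tower\<^esub> shear n {base_point n} \<otimes>\<^bsub>tower\<^esub> inv\<^bsub>tower\<^esub> f) \<noteq> sign_char n {base_point n} (shear n {base_point n})"
      unfolding shear_conj_level(2)[OF f base] sign_char_shear[OF base] using nb by simp
    thus ?thesis using shears_I[OF base] by (rule bexI)
  qed
  show "\<exists>g\<in>carrier tower. \<forall>v\<in>shears n. g \<otimes>\<^bsub>tower\<^esub> v \<otimes>\<^bsub>tower\<^esub> inv\<^bsub>tower\<^esub> g \<in> shears n \<and>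
      sign_char n S (g \<otimes>\<^bsub>tower\<^esub> v \<otimes>\<^bsub>tower\<^esub> inv\<^bsub>tower\<^esub> g) = sign_char n {base_point n} v" if "S \<in> labels n" for S
    by (rule label_transitive[OF that])
  show "(\<Sum>S\<in>labels n. sign_char n S v) = -1" if v: "v \<in> shears n" and ne: "v \<noteq> \<one>\<^bsub>tower\<^esub>" for v
  proof -
    obtain w where w: "w \<subseteq> {1..block_dim n}" "v = shear n w" using v by (rule shears_cases)
    have w0: "w \<noteq> {}" using ne w(2) by (auto simp: shear_empty)
    let ?s = "\<lambda>S. if pairing S w then -1 else 1 :: complex"
    have "0 = (\<Sum>S\<in>Pow {1..block_dim n}. ?s S)" by (rule sum_sign_Pow[OF _ w(1) w0, symmetric]) simp
    also have "\<dots> = ?s {} + (\<Sum>S\<in>labels n. ?s S)" unfolding labels_def by (rule sum.remove) auto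
    also have "(\<Sum>S\<in>labels n. ?s S) = (\<Sum>S\<in>labels n. sign_char n S v)"
      unfolding w(2) by (rule sum.cong[OF refl]) (simp add: sign_char_shear[OF lab])
    finally show ?thesis by (simp add: eq_neg_iff_add_eq_0 add.commute)
  qed
qed

lemma drop_zero:
  assumes "w \<subseteq> {0..n :: nat}" "0 \<notin> w" shows "w \<subseteq> {1..n}"
proof
  fix x assume x: "x \<in> w"
  hence "x \<noteq> 0" using assms(2) by (intro notI) simp
  moreover have "x \<le> n" using x assms(1) by auto
  ultimately show "x \<in> {1..n}" by simp
qed

text \<open>
  The form \<open>v \<mapsto> v\<^sub>0\<close> of the shears can be exchanged with any other nonzero form by a transvection; so all
  transvections are conjugate to shears.
\<close>

lemma insert_at_in_normal:
  assumes H: "H \<lhd> tower" and VH: "shears n \<subseteq> H" and u: "u \<in> block n" shows "insert_at n u \<in> H"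
proof -
  interpret H: normal H tower by (rule H)
  have T: "insert_at n (transvection S w) \<in> H" if S: "S \<subseteq> {0..block_dim n}" and w: "w \<subseteq> {0..block_dim n}" and p: "\<not> pairing S w" for S w
  proof (cases "S = {}")
    case True
    hence "transvection S w = id" by (simp add: fun_eq_iff transvection_def)
    thus ?thesis using subgroup.one_closed[OF H.subgroup_axioms] by (simp add: insert_at_id)
  next
    case False
    have fS: "finite S" using S by (rule finite_subset) simp
    show ?thesis
    proof (cases "S = {0}")
      case True
      have "w \<subseteq> {1..block_dim n}" by (rule drop_zero[OF w]) (use p True in simp)
      thus ?thesis using VH shears_I[of w n] True by (auto simp: shear_def)
    next
      case S0: False
      obtain r where r: "r \<subseteq> insert 0 S" "finite r" "pairing S r" "0 \<in> r"
        using common_witness[OF False S0] by blast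
      define R where "R = sym_diff S {0}"
      have RI: "R \<subseteq> {0..block_dim n}" "finite R" using S fS unfolding R_def by auto
      have rI: "r \<subseteq> {0..block_dim n}" using r(1) S by auto
      have pR: "pairing R v \<longleftrightarrow> pairing S v \<noteq> (0 \<in> v)" for v
        unfolding R_def using pairing_sym_diff_left[OF fS, of "{0}" v] by simp
      have nR: "\<not> pairing R r" using pR[of r] r(3,4) by simp
      let ?g = "transvection R r"
      have gN: "?g \<in> block n" unfolding block_def by (rule tv_transvection[OF RI(1) rI nR])
      have gg: "?g \<circ> ?g = id" by (rule transvection_involution[OF RI(2) nR])
      hence inv_g: "inv_into UNIV ?g = ?g" by (intro inv_unique_comp)
      have zero: "0 \<in> ?g v \<longleftrightarrow> pairing S v" for v
        using pR[of v] r(4) by (simp add: transvection_def)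
      have "?g w \<subseteq> {0..block_dim n}" using w rI by (auto simp: transvection_def)
      moreover have "0 \<notin> ?g w" using zero[of w] p by simp
      ultimately have gw: "?g w \<subseteq> {1..block_dim n}" by (rule drop_zero)
      have "?g \<circ> transvection {0} (?g w) \<circ> ?g = transvection S (?g (?g w))"
        by (rule transvection_conj[OF RI(2) nR]) (simp add: zero)
      also have "?g (?g w) = w" using fun_cong[OF gg, of w] by simp
      finally have conj: "?g \<circ> transvection {0} (?g w) \<circ> ?g = transvection S w" .
      have "insert_at n (transvection S w) = insert_at n ?g \<otimes>\<^bsub>tower\<^esub> shear n (?g w) \<otimes>\<^bsub>tower\<^esub> inv\<^bsub>tower\<^esub> insert_at n ?g"
        unfolding shear_def insert_at_conj[OF insert_at_level[OF gN] shear_block[OF gw]] insert_at_at inv_g conj ..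
      also have "\<dots> \<in> H"
        using H VH shears_I[OF gw] insert_at_carrier[OF gN] unfolding group.normal_inv_iff[OF tower_group] by blast
      finally show ?thesis .
    qed
  qed
  from u show ?thesis unfolding block_def
  proof (induction rule: transvection_group.induct)
    case tv_id
    show ?case unfolding insert_at_id using subgroup.one_closed[OF H.subgroup_axioms] by simp
  next
    case (tv_step g S w)
    have "transvection S w \<in> block n" "g \<in> block n" using tv_step.hyps unfolding block_def by (auto intro: tv_transvection)
    note eq = insert_at_mult[OF this]
    from subgroup.m_closed[OF H.subgroup_axioms T[OF tv_step.hyps(2-4)] tv_step.IH]
    show ?case by (simp only: tower_simps eq)
  qed
qed

text \<open>
  The blocks contribute nontrivial elements that are first visible in pairwise different factors.
\<close>

lemma infinite_tower: "infinite (carrier tower)"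
proof -
  let ?t = "\<lambda>n. shear n {base_point n}"
  have b: "{base_point n} \<subseteq> {1..block_dim n}" for n using base_point_in by simp
  have "?t n n \<noteq> id" for n
  proof
    assume "?t n n = id"
    hence "sym_diff {0} {base_point n} = {0}" using shear_at[of n "{base_point n}"] by simp
    thus False using base_point_in[of n] by auto
  qed
  moreover have "?t n m = id" if "m < n" for m n
    using fun_cong[OF insert_at_trunc[of n "transvection {0} {base_point n}"], of m] that
    by (simp add: shear_def trunc_def one_seq_def)
  ultimately have "?t m \<noteq> ?t n" if "m < n" for m n using that by metis
  hence "inj ?t" by (intro linorder_injI)
  moreover have "range ?t \<subseteq> carrier tower" using shear_carrier[OF b] by blast
  ultimately show ?thesis using finite_imageD finite_subset infinite_UNIV_nat by metis
qed

text \<open>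
  For \<open>g\<close> in the level \<open>n + 1\<close>, cutting off after \<open>n\<close> factors and continuing gives an \<open>f\<close> in the level \<open>n\<close>, and
  \<open>g f\<^sup>-\<^sup>1\<close> belongs to the block \<open>n\<close>.
\<close>

theorem tower_free_tower: "free_tower tower level shears labels sign_char (\<lambda>n. {base_point n})"
proof (rule free_tower.intro)
  show "group_cstar tower" by (rule group_cstar.intro[OF tower_group])
  show "free_tower_axioms tower level shears labels sign_char (\<lambda>n. {base_point n})"
  proof (rule free_tower_axioms.intro)
    show "free_character tower (level n) (shears n) (labels n) (sign_char n) {base_point n}" for n
      by (rule tower_free_character)
    show "finite (level n)" for n by (rule finite_level)
    show "level n \<subseteq> level (Suc n)" for n by (rule level_mono) simp
    show "carrier tower = (\<Union>n. level n)" by simp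
    show "infinite (carrier tower)" by (rule infinite_tower)
    fix H n g assume H: "H \<lhd> tower" and VH: "shears n \<subseteq> H" and g: "g \<in> level (Suc n)"
    let ?f = "extend n (trunc n g)"
    have f: "?f \<in> level n" by (rule extend_level[OF level_trunc[OF g]])
    have f': "?f \<in> level (Suc n)" using f level_mono[of n "Suc n"] by auto
    have tf: "trunc n ?f = trunc n g" by (simp add: fun_eq_iff trunc_def extend_below)
    let ?x = "mult_seq g (inv_seq ?f)"
    have x: "?x \<in> level (Suc n)" by (rule level_mult[OF g level_inv[OF f']])
    have "trunc n ?x = trunc n (mult_seq ?f (inv_seq ?f))" by (simp only: trunc_mult tf)
    also have "mult_seq ?f (inv_seq ?f) = one_seq" by (rule inv_seq_mult(2)) (rule levelD(1)[OF f])
    finally have "trunc n ?x = one_seq" by simp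
    from insert_at_unique[OF x this] have "?x \<in> H" using insert_at_in_normal[OF H VH levelD(1)[OF x, of n]] by simp
    hence "g \<otimes>\<^bsub>tower\<^esub> inv\<^bsub>tower\<^esub> ?f \<in> H" by (simp add: tower_inv[OF level_mem_carrier[OF f]])
    thus "\<exists>f\<in>level n. g \<otimes>\<^bsub>tower\<^esub> inv\<^bsub>tower\<^esub> f \<in> H" using f by (rule bexI)
  qed
qed

section \<open>Residual finiteness and change of the underlying type\<close>

text \<open>
  The construction yields a group of sequences of maps.  It is countable, so along a bijection it
  becomes a group whose elements are functions on the natural numbers.
\<close>

lemma free_tower_transport:
  fixes G (structure) and G' (structure)
  assumes G: "free_tower G F V I \<kappa> i0" and G': "group G'" and c: "c \<in> iso G G'"
  defines "d \<equiv> inv_into (carrier G) c"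
  shows "free_tower G' (\<lambda>n. c ` F n) (\<lambda>n. c ` V n) I (\<lambda>n i v. \<kappa> n i (d v)) i0"
proof -
  interpret free_tower G F V I \<kappa> i0 by (rule G)
  interpret G': group G' by (rule G')
  interpret c: group_hom G G' c using c by unfold_locales (simp add: iso_def)
  have inj: "inj_on c (carrier G)" and surj: "c ` carrier G = carrier G'"
    using c by (simp_all add: iso_def bij_betw_def)
  have dc: "d (c x) = x" if "x \<in> carrier G" for x unfolding d_def by (rule inv_into_f_f[OF inj that])
  have conj: "c x \<otimes>\<^bsub>G'\<^esub> c y \<otimes>\<^bsub>G'\<^esub> inv\<^bsub>G'\<^esub> c x = c (x \<otimes> y \<otimes> inv x)" if "x \<in> carrier G" "y \<in> carrier G" for x y
    using that by simp
  have VG: "v \<in> V n \<Longrightarrow> v \<in> carrier G" for v n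
    by (rule free_character.VG[OF free])
  have chr: "free_character G' (c ` F n) (c ` V n) (I n) (\<lambda>i v. \<kappa> n i (d v)) (i0 n)" for n
  proof -
    interpret fc: free_character G "F n" "V n" "I n" "\<kappa> n" "i0 n" by (rule free)
    show ?thesis
    proof (rule free_character.intro[OF G'], rule free_character_axioms.intro)
      show "subgroup (c ` F n) G'" "subgroup (c ` V n) G'"
        by (rule c.subgroup_img_is_subgroup[OF fc.F], rule c.subgroup_img_is_subgroup[OF fc.V])
      show "finite (c ` V n)" "finite (I n)" "i0 n \<in> I n"
        using fc.finite_V fc.finite_I fc.i0 by simp_all
      show "card (c ` V n) = Suc (card (I n))"
        using fc.card_I card_image[OF inj_on_subset[OF inj subsetI[OF VG]]] by simp
    next
      fix i v w assume i: "i \<in> I n" and "v \<in> c ` V n" "w \<in> c ` V n"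
      then obtain v' w' where v: "v' \<in> V n" "v = c v'" and w: "w' \<in> V n" "w = c w'" by blast
      have eq: "v \<otimes>\<^bsub>G'\<^esub> w = c (v' \<otimes> w')" using v w VG by simp
      show "\<kappa> n i (d (v \<otimes>\<^bsub>G'\<^esub> w)) = \<kappa> n i (d v) * \<kappa> n i (d w)"
        unfolding eq using fc.chi_mult[OF i v(1) w(1)]
        by (simp only: v(2) w(2) dc[OF VG[OF v(1)]] dc[OF VG[OF w(1)]] dc[OF m_closed[OF VG[OF v(1)] VG[OF w(1)]]])
    next
      fix i v assume i: "i \<in> I n" and "v \<in> c ` V n"
      then obtain v' where v: "v' \<in> V n" "v = c v'" by blast
      show "\<kappa> n i (d v) = 1 \<or> \<kappa> n i (d v) = -1"
        using fc.chi_sign[OF i v(1)] v VG by (simp add: dc)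
    next
      fix f v assume "f \<in> c ` F n" "v \<in> c ` V n"
      then obtain f' v' where f: "f' \<in> F n" "f = c f'" and v: "v' \<in> V n" "v = c v'" by blast
      show "f \<otimes>\<^bsub>G'\<^esub> v \<otimes>\<^bsub>G'\<^esub> inv\<^bsub>G'\<^esub> f \<in> c ` V n"
        unfolding f(2) v(2) conj[OF F_carrier[OF f(1)] VG[OF v(1)]] by (rule imageI[OF fc.F_conj[OF f(1) v(1)]])
    next
      fix f assume "f \<in> c ` F n" "f \<noteq> \<one>\<^bsub>G'\<^esub>"
      then obtain f' where f': "f' \<in> F n" "f = c f'" "c f' \<noteq> \<one>\<^bsub>G'\<^esub>" by blast
      hence f: "f' \<in> F n" "f = c f'" "f' \<noteq> \<one>" using c.hom_one by auto
      from fc.F_free[OF f(1,3)] obtain v where v: "v \<in> V n" "\<kappa> n (i0 n) (f' \<otimes> v \<otimes> inv f') \<noteq> \<kappa> n (i0 n) v" by blast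
      have "f \<otimes>\<^bsub>G'\<^esub> c v \<otimes>\<^bsub>G'\<^esub> inv\<^bsub>G'\<^esub> f = c (f' \<otimes> v \<otimes> inv f')"
        unfolding f(2) by (rule conj[OF F_carrier[OF f(1)] VG[OF v(1)]])
      hence "\<kappa> n (i0 n) (d (f \<otimes>\<^bsub>G'\<^esub> c v \<otimes>\<^bsub>G'\<^esub> inv\<^bsub>G'\<^esub> f)) \<noteq> \<kappa> n (i0 n) (d (c v))"
        using v(2) F_carrier[OF f(1)] VG[OF v(1)] by (simp only: dc m_closed inv_closed) simp
      thus "\<exists>v\<in>c ` V n. \<kappa> n (i0 n) (d (f \<otimes>\<^bsub>G'\<^esub> v \<otimes>\<^bsub>G'\<^esub> inv\<^bsub>G'\<^esub> f)) \<noteq> \<kappa> n (i0 n) (d v)"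
        using imageI[OF v(1)] by (rule bexI)
    next
      fix i assume i: "i \<in> I n"
      from fc.transitive[OF i] obtain g where g: "g \<in> carrier G"
        and gv: "\<forall>v\<in>V n. g \<otimes> v \<otimes> inv g \<in> V n \<and> \<kappa> n i (g \<otimes> v \<otimes> inv g) = \<kappa> n (i0 n) v" by blast
      show "\<exists>g\<in>carrier G'. \<forall>v\<in>c ` V n. g \<otimes>\<^bsub>G'\<^esub> v \<otimes>\<^bsub>G'\<^esub> inv\<^bsub>G'\<^esub> g \<in> c ` V n \<and>
          \<kappa> n i (d (g \<otimes>\<^bsub>G'\<^esub> v \<otimes>\<^bsub>G'\<^esub> inv\<^bsub>G'\<^esub> g)) = \<kappa> n (i0 n) (d v)"
      proof (rule bexI[OF _ c.hom_closed[OF g]], rule ballI)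
        fix w assume "w \<in> c ` V n"
        then obtain v where v: "v \<in> V n" "w = c v" by blast
        have "g \<otimes> v \<otimes> inv g \<in> V n" "\<kappa> n i (g \<otimes> v \<otimes> inv g) = \<kappa> n (i0 n) v" using gv v(1) by blast+
        thus "c g \<otimes>\<^bsub>G'\<^esub> w \<otimes>\<^bsub>G'\<^esub> inv\<^bsub>G'\<^esub> c g \<in> c ` V n \<and>
            \<kappa> n i (d (c g \<otimes>\<^bsub>G'\<^esub> w \<otimes>\<^bsub>G'\<^esub> inv\<^bsub>G'\<^esub> c g)) = \<kappa> n (i0 n) (d w)"
          unfolding v(2) conj[OF g VG[OF v(1)]] using VG by (simp add: dc VG[OF v(1)] imageI)
      qed
    next
      fix v assume "v \<in> c ` V n" "v \<noteq> \<one>\<^bsub>G'\<^esub>"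
      then obtain v' where v': "v' \<in> V n" "v = c v'" "c v' \<noteq> \<one>\<^bsub>G'\<^esub>" by blast
      hence v: "v' \<in> V n" "v = c v'" "v' \<noteq> \<one>" using c.hom_one by auto
      show "(\<Sum>i\<in>I n. \<kappa> n i (d v)) = -1"
        using fc.sum_chi[OF v(1,3)] by (simp add: v(2) dc[OF VG[OF v(1)]])
    qed
  qed
  show ?thesis
  proof (rule free_tower.intro, rule group_cstar.intro[OF G'], rule free_tower_axioms.intro)
    show "free_character G' (c ` F n) (c ` V n) (I n) (\<lambda>i v. \<kappa> n i (d v)) (i0 n)" for n by (rule chr)
    show "finite (c ` F n)" "c ` F n \<subseteq> c ` F (Suc n)" for n
      using finite_F image_mono[OF F_Suc] by simp_all
    show "carrier G' = (\<Union>n. c ` F n)" unfolding surj[symmetric] F_Union by (rule image_UN)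
    show "infinite (carrier G')" unfolding surj[symmetric] using infinite_carrier finite_imageD[OF _ inj] by blast
    fix H n g assume H: "H \<lhd> G'" and VH: "c ` V n \<subseteq> H" and g: "g \<in> c ` F (Suc n)"
    let ?H = "{x \<in> carrier G. c x \<in> H}"
    have subH: "subgroup H G'" using H by (rule normal_imp_subgroup)
    have "?H \<lhd> G"
      unfolding normal_inv_iff
    proof (intro conjI ballI)
      show "subgroup ?H G"
        by (rule subgroupI)
           (use subgroup.one_closed[OF subH] subgroup.m_closed[OF subH] subgroup.m_inv_closed[OF subH] in auto)
      fix x h assume x: "x \<in> carrier G" and h: "h \<in> ?H"
      have "c x \<otimes>\<^bsub>G'\<^esub> c h \<otimes>\<^bsub>G'\<^esub> inv\<^bsub>G'\<^esub> c x \<in> H"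
        using H h c.hom_closed[OF x] unfolding G'.normal_inv_iff by blast
      thus "x \<otimes> h \<otimes> inv x \<in> ?H" using x h by simp
    qed
    moreover have "V n \<subseteq> ?H" using VH VG by blast
    moreover obtain g' where g': "g' \<in> F (Suc n)" "g = c g'" using g by blast
    ultimately obtain f where f: "f \<in> F n" "g' \<otimes> inv f \<in> ?H" using F_step by blast
    have "g \<otimes>\<^bsub>G'\<^esub> inv\<^bsub>G'\<^esub> c f = c (g' \<otimes> inv f)"
      unfolding g'(2) using F_carrier[OF g'(1)] F_carrier[OF f(1)] by simp
    hence "g \<otimes>\<^bsub>G'\<^esub> inv\<^bsub>G'\<^esub> c f \<in> H" using f(2) by simp
    thus "\<exists>f\<in>c ` F n. g \<otimes>\<^bsub>G'\<^esub> inv\<^bsub>G'\<^esub> f \<in> H" using imageI[OF f(1)] by (rule bexI)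
  qed
qed

lemma (in free_tower) locally_finite_tower: "locally_finite G"
  unfolding locally_finite_def
proof (intro allI impI)
  fix S assume S: "S \<subseteq> carrier G" "finite S"
  obtain n where "S \<subseteq> F n" using finite_subset_F[OF S(2,1)] by blast
  hence "generate G S \<subseteq> F n" by (rule generate_subgroup_incl[OF _ F_subgroup])
  thus "finite (generate G S)" using finite_F by (rule finite_subset)
qed

text \<open>
  Kernels of homomorphisms into finite groups have finite index.
\<close>

lemma (in group) residually_finiteI:
  assumes "\<And>g. g \<in> carrier G \<Longrightarrow> g \<noteq> \<one> \<Longrightarrow>
    \<exists>(Q :: 'q monoid) h. group Q \<and> finite (carrier Q) \<and> h \<in> hom G Q \<and> h g \<noteq> \<one>\<^bsub>Q\<^esub>"
  shows "residually_finite G"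
  unfolding residually_finite_def
proof (intro ballI impI)
  fix g assume g: "g \<in> carrier G" "g \<noteq> \<one>"
  from assms[OF g] obtain Q :: "'q monoid" and h where
    Q: "group Q" "finite (carrier Q)" "h \<in> hom G Q" "h g \<noteq> \<one>\<^bsub>Q\<^esub>" by blast
  interpret h: group_hom G Q h using Q(1,3) is_group by (simp add: group_hom_def group_hom_axioms_def)
  let ?N = "kernel G Q h"
  have "finite (carrier (G Mod ?N))"
    by (rule inj_on_finite[OF h.FactGroup_inj_on _ Q(2)]) (use h.FactGroup_the_elem_mem in blast)
  moreover have "g \<notin> ?N" using Q(4) by (simp add: kernel_def)
  ultimately show "\<exists>N. N \<lhd> G \<and> finite (carrier (G Mod N)) \<and> g \<notin> N" using h.normal_kernel by blast
qed

definition tuple_group :: "nat \<Rightarrow> seq monoid" where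
  "tuple_group n = \<lparr>carrier = tuples n, mult = mult_seq, one = one_seq\<rparr>"

lemma tuple_group: "group (tuple_group n)"
proof (rule groupI)
  fix x assume x: "x \<in> carrier (tuple_group n)"
  hence xt: "x \<in> tuples n" by (simp add: tuple_group_def)
  have "mult_seq (inv_seq x) x = one_seq" by (rule inv_seq_mult(1)) (rule tuples_block[OF xt])
  thus "\<exists>y\<in>carrier (tuple_group n). y \<otimes>\<^bsub>tuple_group n\<^esub> x = \<one>\<^bsub>tuple_group n\<^esub>"
    using inv_seq_tuples[OF xt] by (intro bexI[of _ "inv_seq x"]) (simp_all add: tuple_group_def)
qed (simp_all add: tuple_group_def tuples_closed mult_seq_assoc)

lemma trunc_hom: "trunc n \<in> hom tower (tuple_group n)"
  by (rule homI) (auto simp: tuple_group_def trunc_mult intro: level_trunc)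

lemma trunc_separates:
  assumes "x \<noteq> one_seq" shows "\<exists>n. trunc n x \<noteq> one_seq"
proof -
  from assms obtain k where "x k \<noteq> one_seq k" by (auto simp: fun_eq_iff)
  hence "trunc (Suc k) x k \<noteq> one_seq k" by (simp add: trunc_def)
  thus ?thesis by (intro exI[of _ "Suc k"]) (rule notI, simp)
qed

lemma countable_tower: "countable (carrier tower)"
  by (simp add: countable_finite finite_level)

theorem theorem2p5:
  shows "\<exists>G :: (nat \<Rightarrow> nat) monoid.
    group G \<and> infinite (carrier G) \<and> residually_finite G \<and> locally_finite G \<and>
    just_infinite (full_group_cstar_algebra G)"
proof -
  interpret T: group tower by (rule tower_group)
  define c :: "seq \<Rightarrow> nat \<Rightarrow> nat" where "c x = (\<lambda>_. to_nat_on (carrier tower) x)" for x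
  define d where "d = inv_into (carrier tower) c"
  have inj: "inj_on c (carrier tower)"
    using inj_on_to_nat_on[OF countable_tower] by (auto simp: c_def inj_on_def fun_eq_iff)
  have dc: "d (c x) = x" if "x \<in> carrier tower" for x unfolding d_def by (rule inv_into_f_f[OF inj that])
  define G :: "(nat \<Rightarrow> nat) monoid" where
    "G = \<lparr>carrier = c ` carrier tower, mult = (\<lambda>a b. c (d a \<otimes>\<^bsub>tower\<^esub> d b)), one = c \<one>\<^bsub>tower\<^esub>\<rparr>"
  have mult: "c x \<otimes>\<^bsub>G\<^esub> c y = c (x \<otimes>\<^bsub>tower\<^esub> y)" if "x \<in> carrier tower" "y \<in> carrier tower" for x y
    unfolding G_def by (simp only: monoid.simps dc[OF that(1)] dc[OF that(2)])
  have carr: "carrier G = c ` carrier tower" and one: "\<one>\<^bsub>G\<^esub> = c \<one>\<^bsub>tower\<^esub>" unfolding G_def by (simp_all only: monoid.simps partial_object.simps)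
  have grp: "group G"
  proof (rule groupI)
    fix a b assume "a \<in> carrier G" "b \<in> carrier G"
    then obtain x y where "x \<in> carrier tower" "a = c x" "y \<in> carrier tower" "b = c y" unfolding carr by blast
    thus "a \<otimes>\<^bsub>G\<^esub> b \<in> carrier G" unfolding carr by (simp only: mult imageI[OF T.m_closed])
  next
    show "\<one>\<^bsub>G\<^esub> \<in> carrier G" unfolding carr one by (rule imageI[OF T.one_closed])
  next
    fix a b k assume "a \<in> carrier G" "b \<in> carrier G" "k \<in> carrier G"
    then obtain x y z where "x \<in> carrier tower" "a = c x" "y \<in> carrier tower" "b = c y" "z \<in> carrier tower" "k = c z"
      unfolding carr by blast
    thus "a \<otimes>\<^bsub>G\<^esub> b \<otimes>\<^bsub>G\<^esub> k = a \<otimes>\<^bsub>G\<^esub> (b \<otimes>\<^bsub>G\<^esub> k)"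
      by (simp only: mult T.m_closed T.m_assoc)
  next
    fix a assume "a \<in> carrier G"
    then obtain x where x: "x \<in> carrier tower" "a = c x" unfolding carr by blast
    show "\<one>\<^bsub>G\<^esub> \<otimes>\<^bsub>G\<^esub> a = a" unfolding one x(2) mult[OF T.one_closed x(1)] T.l_one[OF x(1)] ..
    have "c (inv\<^bsub>tower\<^esub> x) \<otimes>\<^bsub>G\<^esub> a = \<one>\<^bsub>G\<^esub>"
      unfolding x(2) mult[OF T.inv_closed[OF x(1)] x(1)] T.l_inv[OF x(1)] one ..
    moreover have "c (inv\<^bsub>tower\<^esub> x) \<in> carrier G" unfolding carr by (rule imageI[OF T.inv_closed[OF x(1)]])
    ultimately show "\<exists>b\<in>carrier G. b \<otimes>\<^bsub>G\<^esub> a = \<one>\<^bsub>G\<^esub>" by (rule bexI)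
  qed
  have iso: "c \<in> iso tower G"
  proof (rule isoI)
    show "c \<in> hom tower G"
    proof (rule homI)
      show "c x \<in> carrier G" if "x \<in> carrier tower" for x unfolding carr by (rule imageI[OF that])
      show "c (x \<otimes>\<^bsub>tower\<^esub> y) = c x \<otimes>\<^bsub>G\<^esub> c y" if "x \<in> carrier tower" "y \<in> carrier tower" for x y
        by (rule mult[OF that, symmetric])
    qed
    show "bij_betw c (carrier tower) (carrier G)" unfolding carr by (rule inj_on_imp_bij_betw[OF inj])
  qed
  interpret G: free_tower G "\<lambda>n. c ` level n" "\<lambda>n. c ` shears n" labels
    "\<lambda>n i v. sign_char n i (inv_into (carrier tower) c v)" "\<lambda>n. {base_point n}"
    by (rule free_tower_transport[OF tower_free_tower grp iso])
  have "residually_finite G"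
  proof (rule G.residually_finiteI)
    fix g assume g: "g \<in> carrier G" "g \<noteq> \<one>\<^bsub>G\<^esub>"
    then obtain x where x: "x \<in> carrier tower" "g = c x" unfolding carr by blast
    have "x \<noteq> one_seq" using g(2) unfolding x(2) one by auto
    then obtain n where n: "trunc n x \<noteq> one_seq" using trunc_separates by blast
    \<comment> \<open>Forgetting all factors from \<open>n\<close> on is a homomorphism to a finite group that does not kill \<open>g\<close>.\<close>
    have "trunc n \<circ> d \<in> hom G (tuple_group n)"
    proof (rule homI)
      fix a assume "a \<in> carrier G"
      then obtain y where y: "y \<in> carrier tower" "a = c y" unfolding carr by blast
      show "(trunc n \<circ> d) a \<in> carrier (tuple_group n)"
        unfolding y(2) comp_apply dc[OF y(1)] by (rule hom_in_carrier[OF trunc_hom y(1)])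
      fix b assume "b \<in> carrier G"
      then obtain z where z: "z \<in> carrier tower" "b = c z" unfolding carr by blast
      show "(trunc n \<circ> d) (a \<otimes>\<^bsub>G\<^esub> b) = (trunc n \<circ> d) a \<otimes>\<^bsub>tuple_group n\<^esub> (trunc n \<circ> d) b"
        unfolding y(2) z(2) comp_apply mult[OF y(1) z(1)] dc[OF y(1)] dc[OF z(1)] dc[OF T.m_closed[OF y(1) z(1)]]
        by (rule hom_mult[OF trunc_hom y(1) z(1)])
    qed
    moreover have "(trunc n \<circ> d) g \<noteq> \<one>\<^bsub>tuple_group n\<^esub>"
      using n by (simp add: x(2) dc[OF x(1)] tuple_group_def)
    moreover have "finite (carrier (tuple_group n))" using card_tuples[of n] by (simp add: tuple_group_def)
    ultimately show "\<exists>(Q :: seq monoid) h. group Q \<and> finite (carrier Q) \<and> h \<in> hom G Q \<and> h g \<noteq> \<one>\<^bsub>Q\<^esub>"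
      using tuple_group[of n] by blast
  qed
  thus ?thesis
    using grp G.infinite_carrier G.locally_finite_tower G.just_infinite_full_group_cstar_algebra by blast
qed

end
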